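(* Let $X$ be a real Banach lattice with $\dim X>1$, and let $K>0$ be a compact operator on $X$ such that either $[K\rangle$ or $\langle K]$ is ideal irreducible. Assume $r(K)=1$. Let $P$ be the spectral projection of $K$ for $\sigma_{per}(K)$. \begin{enumerate} \item There exist pairwise disjoint positive vectors $x_1,\dots,x_r\in X$ and pairwise disjoint positive functionals $x_1^*,\dots,x_r^*\in X^*$, where $r=\mathrm{rank}(P)$, such that $$P=\sum_{i=1}^r x_i^*\otimes x_i,\qquad x_i^*(x_j)=\delta_{ij}\ \text{ for all } i,j.$$ \item (For these vectors and functionals) $K|_{PX}$ is a permutation on $\{x_i\}_{i=1}^r$ and $K^*|_{P^*X^*}$ is a permutation on $\{x_i^*\}_{i=1}^r$. In particular, there exists $m\ge 1$ such that $P=\lim_{n} K^{nm}$. \item There exist a quasi-interior point $x_0>0$ and a strictly positive functional $x_0^*>0$ such that $Kx_0=x_0$ and $K^*x_0^*=x_0^*$. \item For any $0<x\in X$ and any $0<x^*\in X^*$, $$0<\inf_n\|K^nx\|\le \sup_n\|K^nx\|<\infty,\qquad 0<\inf_n\|(K^{n})^*x^*\|\le \sup_n\|(K^{n})^*x^*\|<\infty.$$ In particular, $\lim_n\|K^nx\|^{1/n}=1$ for all $x>0$ and $\lim_n\|(K^{n})^*x^*\|^{1/n}=1$ for all $x^*>0$. \item Every operator in $L(X)$ semi-commuting with $K$ commutes with $K$. In particular, $[K\rangle=\langle K]=L_+(X)\cap\{K\}'$. \item For every operator $S>0$ on $X$ commuting with $K$, there exist $\lambda_S\ge 0$, $0<x\in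 X$ and $0<x^*\in X^*$ such that $Sx=\lambda_Sx$ and $S^*x^*=\lambda_Sx^*$. \end{enumerate}
   Context: $L(X)$ is the space of bounded linear operators on $X$; $L_+(X)$ is the set of positive operators; $\{K\}'$ is the commutant of $K$ in $L(X)$; $A^*$ is the Banach space adjoint. For vectors, functionals and operators, $a>0$ means $a\ge 0$ and $a\neq 0$. For a positive operator $K$, $[K\rangle:=\{S\ge 0: SK\ge KS\}$ and $\langle K]:=\{S\ge 0: SK\le KS\}$. A collection of positive operators is ideal irreducible if no closed (lattice) ideal of $X$ other than $\{0\}$ and $X$ is invariant under every member of the collection. Two operators semi-commute if their commutator is positive or negative, i.e. $UV-VU\ge0$ or $UV-VU\le 0$. $\sigma(T)$ and $r(T)$ are the spectrum and spectral radius (computed in the complexification), and $\sigma_{per}(T)=\{\lambda\in\sigma(T):|\lambda|=r(T)\}$ is the peripheral spectrum. $x^*\otimes x$ is the operator $y\mapsto x^*(y)x$. "Permutation on $\{x_i\}$" means the operator maps each $x_i$ to $x_{\pi(i)}$ for some permutation $\pi$ of $\{1,\dots,r\}$. The limit $P=\lim_n K^{nm}$ is in operator norm. A vector $x_0>0$ is a quasi-interior point if the ideal it generates is norm dense in $X$. A functional $x_0^*$ is strictly positive if it is positive and $x_0^*(x)>0$ for all $x>0$. *)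

theory Defs
  imports "HOL-Complex_Analysis.Complex_Analysis" "HOL-Library.Lattice_Algebras"
    "HOL-Combinatorics.Permutations"
begin

section \<open>Banach lattices\<close>

class banach_lattice = lattice_ab_group_add_abs + ordered_real_vector + banach +
  assumes norm_lattice: "\<bar>x\<bar> \<le> \<bar>y\<bar> \<Longrightarrow> norm x \<le> norm y"

instance real :: banach_lattice
  by standard simp

definition lattice_ideal :: "'a::banach_lattice set \<Rightarrow> bool" where
  "lattice_ideal I \<longleftrightarrow> subspace I \<and> (\<forall>x y. y \<in> I \<and> \<bar>x\<bar> \<le> \<bar>y\<bar> \<longrightarrow> x \<in> I)"

definition quasi_interior :: "'a::banach_lattice \<Rightarrow> bool" where
  "quasi_interior x \<longleftrightarrow> 0 < x \<and> closure (lattice_ideal hull {x}) = UNIV"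


section \<open>Order on bounded operators and on the dual\<close>

text \<open>The order applies in particular to the Banach dual \<open>'a \<Rightarrow>\<^sub>L real\<close>.\<close>

instantiation blinfun :: (banach_lattice, banach_lattice) order
begin

definition less_eq_blinfun :: "'a \<Rightarrow>\<^sub>L 'b \<Rightarrow> 'a \<Rightarrow>\<^sub>L 'b \<Rightarrow> bool" where
  "S \<le> T \<longleftrightarrow> (\<forall>x\<ge>0. blinfun_apply S x \<le> blinfun_apply T x)"

definition less_blinfun :: "'a \<Rightarrow>\<^sub>L 'b \<Rightarrow> 'a \<Rightarrow>\<^sub>L 'b \<Rightarrow> bool" where
  "(S :: 'a \<Rightarrow>\<^sub>L 'b) < T \<longleftrightarrow> S \<le> T \<and> S \<noteq> T"

instance
proof
  have antisym: "S = T" if "S \<le> T" "T \<le> S" for S T :: "'a \<Rightarrow>\<^sub>L 'b"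
  proof (rule blinfun_eqI)
    fix x :: 'a
    have pos: "blinfun_apply S y = blinfun_apply T y" if "0 \<le> y" for y
      using \<open>S \<le> T\<close> \<open>T \<le> S\<close> that by (auto simp: less_eq_blinfun_def intro: order_antisym)
    have "blinfun_apply S (- nprt x) = blinfun_apply T (- nprt x)"
      by (rule pos) simp
    then have "blinfun_apply S (pprt x + nprt x) = blinfun_apply T (pprt x + nprt x)"
      using pos[of "pprt x"] by (simp add: blinfun.add_right blinfun.minus_right)
    then show "blinfun_apply S x = blinfun_apply T x"
      by (simp flip: prts)
  qed
  fix R S T :: "'a \<Rightarrow>\<^sub>L 'b"
  show "S \<le> S"
    by (simp add: less_eq_blinfun_def)
  show "R \<le> T" if "R \<le> S" "S \<le> T"
    using that unfolding less_eq_blinfun_def by (blast intro: order_trans)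
  show "S = T" if "S \<le> T" "T \<le> S"
    using that by (rule antisym)
  show "S < T \<longleftrightarrow> S \<le> T \<and> \<not> T \<le> S"
    using antisym by (auto simp: less_blinfun_def)
qed

end

text \<open>Disjointness of positive functionals: their infimum in the dual lattice is \<open>0\<close>. The
  infimum is expressed as a greatest lower bound because no lattice instance is set up on the
  dual.\<close>

definition disjoint_functionals ::
    "('a::banach_lattice \<Rightarrow>\<^sub>L real) \<Rightarrow> ('a \<Rightarrow>\<^sub>L real) \<Rightarrow> bool" where
  "disjoint_functionals f g \<longleftrightarrow> 0 \<le> f \<and> 0 \<le> g \<and> (\<forall>h. h \<le> f \<and> h \<le> g \<longrightarrow> h \<le> 0)"

definition strictly_positive :: "('a::banach_lattice \<Rightarrow>\<^sub>L real) \<Rightarrow> bool" where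
  "strictly_positive f \<longleftrightarrow> 0 \<le> f \<and> (\<forall>x>0. 0 < blinfun_apply f x)"


section \<open>Bounded operators\<close>

definition compact_operator ::
    "('a::real_normed_vector \<Rightarrow>\<^sub>L 'b::real_normed_vector) \<Rightarrow> bool" where
  "compact_operator T \<longleftrightarrow> compact (closure (blinfun_apply T ` cball 0 1))"

lift_definition banach_adjoint ::
    "('a::real_normed_vector \<Rightarrow>\<^sub>L 'b::real_normed_vector) \<Rightarrow> ('b \<Rightarrow>\<^sub>L real) \<Rightarrow>\<^sub>L ('a \<Rightarrow>\<^sub>L real)"
  is "\<lambda>T f. f o\<^sub>L T"
  by (rule bounded_bilinear.bounded_linear_left[OF bounded_bilinear_blinfun_compose])

lift_definition rank_one ::
    "('a::real_normed_vector \<Rightarrow>\<^sub>L real) \<Rightarrow> 'b::real_normed_vector \<Rightarrow> 'a \<Rightarrow>\<^sub>L 'b"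
    (infixr \<open>\<otimes>\<^sub>L\<close> 75)
  is "\<lambda>f x y. blinfun_apply f y *\<^sub>R x"
  by (rule bounded_linear_scaleR_const[OF blinfun.bounded_linear_right])

primrec blinfun_power :: "('a::real_normed_vector \<Rightarrow>\<^sub>L 'a) \<Rightarrow> nat \<Rightarrow> 'a \<Rightarrow>\<^sub>L 'a"
    (infixr \<open>^\<^sub>L\<close> 80) where
  "T ^\<^sub>L 0 = id_blinfun"
| "T ^\<^sub>L Suc n = T o\<^sub>L T ^\<^sub>L n"

definition commutant :: "('a::real_normed_vector \<Rightarrow>\<^sub>L 'a) \<Rightarrow> ('a \<Rightarrow>\<^sub>L 'a) set" where
  "commutant K = {S. S o\<^sub>L K = K o\<^sub>L S}"

definition semi_commute :: "('a::banach_lattice \<Rightarrow>\<^sub>L 'a) \<Rightarrow> ('a \<Rightarrow>\<^sub>L 'a) \<Rightarrow> bool" where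
  "semi_commute U V \<longleftrightarrow> (U o\<^sub>L V) - (V o\<^sub>L U) \<ge> 0 \<or> (U o\<^sub>L V) - (V o\<^sub>L U) \<le> 0"

text \<open>The sets \<open>[K\<rangle>\<close> and \<open>\<langle>K]\<close> of super right- and super left-commutants.\<close>

definition super_right_commutant :: "('a::banach_lattice \<Rightarrow>\<^sub>L 'a) \<Rightarrow> ('a \<Rightarrow>\<^sub>L 'a) set" where
  "super_right_commutant K = {S. S \<ge> 0 \<and> S o\<^sub>L K \<ge> K o\<^sub>L S}"

definition super_left_commutant :: "('a::banach_lattice \<Rightarrow>\<^sub>L 'a) \<Rightarrow> ('a \<Rightarrow>\<^sub>L 'a) set" where
  "super_left_commutant K = {S. S \<ge> 0 \<and> S o\<^sub>L K \<le> K o\<^sub>L S}"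

definition ideal_irreducible :: "('a::banach_lattice \<Rightarrow>\<^sub>L 'a) set \<Rightarrow> bool" where
  "ideal_irreducible C \<longleftrightarrow>
     (\<forall>I. lattice_ideal I \<and> closed I \<and> (\<forall>T\<in>C. blinfun_apply T ` I \<subseteq> I) \<longrightarrow> I = {0} \<or> I = UNIV)"


section \<open>Complexification and spectrum\<close>

text \<open>
  The complexification of \<open>'a\<close> is \<open>'a \<times> 'a\<close>, with \<open>(x, y)\<close> standing for \<open>x + i y\<close>.
  Its complex structure is given by the operators \<open>cscale z\<close> of multiplication by \<open>z\<close>.
  The product norm is equivalent to the usual complexification norms, and spectra, resolvents and
  operator-valued integrals depend only on the norm up to equivalence. Inverses are
  taken among real-linear operators; the inverse of a complex-linear operator is automatically
  complex-linear.
\<close>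

lift_definition cscale :: "complex \<Rightarrow> ('a::real_normed_vector \<times> 'a) \<Rightarrow>\<^sub>L ('a \<times> 'a)"
  is "\<lambda>z (x, y). (Re z *\<^sub>R x - Im z *\<^sub>R y, Im z *\<^sub>R x + Re z *\<^sub>R y)"
  unfolding case_prod_beta
  by (intro bounded_linear_Pair bounded_linear_sub bounded_linear_add
      bounded_linear_const_scaleR bounded_linear_fst bounded_linear_snd)

lift_definition complexify ::
    "('a::real_normed_vector \<Rightarrow>\<^sub>L 'a) \<Rightarrow> ('a \<times> 'a) \<Rightarrow>\<^sub>L ('a \<times> 'a)"
  is "\<lambda>T (x, y). (T x, T y)"
  unfolding case_prod_beta
  by (intro bounded_linear_Pair bounded_linear_compose[OF _ bounded_linear_fst]
      bounded_linear_compose[OF _ bounded_linear_snd])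

definition blinfun_inverses ::
    "('b::real_normed_vector \<Rightarrow>\<^sub>L 'b) \<Rightarrow> ('b \<Rightarrow>\<^sub>L 'b) \<Rightarrow> bool" where
  "blinfun_inverses A B \<longleftrightarrow> A o\<^sub>L B = id_blinfun \<and> B o\<^sub>L A = id_blinfun"

definition spectrum :: "('a::real_normed_vector \<Rightarrow>\<^sub>L 'a) \<Rightarrow> complex set" where
  "spectrum T = {z. \<nexists>B. blinfun_inverses (cscale z - complexify T) B}"

definition resolvent ::
    "('a::real_normed_vector \<Rightarrow>\<^sub>L 'a) \<Rightarrow> complex \<Rightarrow> ('a \<times> 'a) \<Rightarrow>\<^sub>L ('a \<times> 'a)" where
  "resolvent T z = (THE B. blinfun_inverses (cscale z - complexify T) B)"

definition spectral_radius :: "('a::real_normed_vector \<Rightarrow>\<^sub>L 'a) \<Rightarrow> real" where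
  "spectral_radius T = (SUP z\<in>spectrum T. norm z)"

definition peripheral_spectrum :: "('a::real_normed_vector \<Rightarrow>\<^sub>L 'a) \<Rightarrow> complex set" where
  "peripheral_spectrum T = {z \<in> spectrum T. norm z = spectral_radius T}"


section \<open>Spectral projections\<close>

text \<open>The operator \<open>(1 / 2\<pi>i) \<integral>\<^sub>\<gamma> (z - T)\<inverse> dz\<close> on the complexification. The library's contour integral
  covers only complex-valued integrands, so the integral is written out in the same way.\<close>

definition riesz_integral ::
    "('a::banach \<Rightarrow>\<^sub>L 'a) \<Rightarrow> (real \<Rightarrow> complex) \<Rightarrow> ('a \<times> 'a) \<Rightarrow>\<^sub>L ('a \<times> 'a)" where
  "riesz_integral T \<gamma> =
     cscale (1 / (2 * of_real pi * \<i>)) o\<^sub>L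
       integral {0..1}
         (\<lambda>t. cscale (vector_derivative \<gamma> (at t within {0..1})) o\<^sub>L resolvent T (\<gamma> t))"

text \<open>A cycle, given as a list of closed paths, that winds once around the points of \<open>A\<close>
  and not around those of \<open>B\<close>.\<close>

definition separating_cycle :: "(real \<Rightarrow> complex) list \<Rightarrow> complex set \<Rightarrow> complex set \<Rightarrow> bool" where
  "separating_cycle \<Gamma> A B \<longleftrightarrow>
     (\<forall>\<gamma>\<in>set \<Gamma>. valid_path \<gamma> \<and> pathfinish \<gamma> = pathstart \<gamma> \<and> path_image \<gamma> \<inter> (A \<union> B) = {}) \<and>
     (\<forall>z\<in>A. (\<Sum>\<gamma>\<leftarrow>\<Gamma>. winding_number \<gamma> z) = 1) \<and>
     (\<forall>z\<in>B. (\<Sum>\<gamma>\<leftarrow>\<Gamma>. winding_number \<gamma> z) = 0)"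

text \<open>The Riesz projection of \<open>T\<close> for a relatively clopen part \<open>A\<close> of its spectrum. By Cauchy's
  theorem the integral does not depend on the cycle.\<close>

definition spectral_projection ::
    "('a::banach \<Rightarrow>\<^sub>L 'a) \<Rightarrow> complex set \<Rightarrow> ('a \<times> 'a) \<Rightarrow>\<^sub>L ('a \<times> 'a)" where
  "spectral_projection T A =
     (THE Q. \<exists>\<Gamma>. separating_cycle \<Gamma> A (spectrum T - A) \<and> Q = (\<Sum>\<gamma>\<leftarrow>\<Gamma>. riesz_integral T \<gamma>))"

end

theory Submission
  imports Defs "HOL-Combinatorics.Cycles"
begin

text \<open>
  The Krein-Rutman theorem gives a vector \<open>u > 0\<close> and a functional \<open>h > 0\<close> that are fixed by \<open>K\<close>. It is
  proved here by a normal families argument: the normalised positive resolvents \<open>A\<close> near the spectral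
  radius almost commute with \<open>K\<close>, and \<open>A \<mapsto> K A K\<close> is a compact map on operators
  (\<open>compact_sandwich_subseq\<close>), so that a limit operator \<open>Q\<close> with \<open>K Q = Q K = r(K) Q\<close> exists
  (\<open>krein_rutman_operator\<close>). Its values are eigenvectors, and \<open>g Q\<close> is an eigenfunctional for each
  positive functional \<open>g\<close>. For \<open>S\<close> and \<open>T\<close> in the irreducible cone, semi-commutation makes \<open>T u\<close> and
  \<open>h S\<close> sub- or superharmonic in opposite directions, and since the vectors \<open>T u\<close> generate a dense ideal
  and the functionals \<open>h S\<close> detect positive vectors, all of them are fixed by \<open>K\<close>
  (\<open>irreducible_fixed_vectors\<close>).

  From this point on only these fixed vectors and functionals matter. The fixed functionals force
  the powers of \<open>K\<close> to be bounded (\<open>power_bounded\<close>). Hence the powers have a limit point \<open>P\<close>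
  that is a positive compact projection (\<open>power_limit_projection\<close>). Since the fixed functionals detect
  positive vectors, the range of \<open>P\<close> is a sublattice, and compactness bounds the size of its disjoint
  families, so a maximal one is a basis (\<open>span_maximal\<close>). On the range \<open>K\<close> has a positive
  inverse, thus permutes the rays through the basis vectors, and it permutes the vectors themselves if they
  are normalised by a fixed functional \<open>f\<^sub>0\<close> (\<open>K_x_basis\<close>). The coordinate functionals composed
  with \<open>P\<close> are the dual basis, the sum \<open>x\<^sub>0\<close> of the basis is a quasi-interior fixed point, and
  \<open>f\<^sub>0\<close> is strictly positive. A positive commutator is annihilated by the pair \<open>(x\<^sub>0, f\<^sub>0)\<close> and
  therefore vanishes. An operator \<open>S\<close> that commutes with \<open>K\<close> also commutes with \<open>P\<close>, and the
  Krein-Rutman theorem for the compact operator \<open>S P + P\<close> gives its eigenvectors.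

  It remains to identify \<open>P\<close> with the contour integral of the resolvent over an arbitrary cycle
  around the peripheral spectrum (\<open>spectral_projection_peripheral\<close>). On the range of \<open>P\<close> some power of \<open>K\<close> is
  the identity, so the resolvent is a sum of simple poles at roots of unity. On the kernel
  of \<open>P\<close> the powers decay geometrically, and the resolvent is holomorphic off the rest of the spectrum.
  Because the spectrum of a compact operator is countable (\<open>countable_spectrum\<close>), its complement is
  connected, the cycle can be replaced by a single loop (\<open>cycle_to_loop\<close>), and Cauchy's theorem
  evaluates the integral functional by functional.
\<close>

section \<open>Norm, order and disjointness in a Banach lattice\<close>

lemma norm_abs_lattice [simp]: "norm \<bar>x\<bar> = norm (x::'a::banach_lattice)"
  by (intro antisym norm_lattice) auto

lemma norm_mono_nonneg: "0 \<le> x \<Longrightarrow> x \<le> y \<Longrightarrow> norm x \<le> norm (y::'a::banach_lattice)"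
  by (rule norm_lattice) (metis abs_of_nonneg order_trans)

lemma pprt_conv_abs: "pprt x = (1/2) *\<^sub>R (x + \<bar>x::'a::banach_lattice\<bar>)"
proof -
  have "x + \<bar>x\<bar> = pprt x + pprt x"
    by (subst (1) prts) (simp add: abs_prts)
  then show ?thesis
    by (metis scaleR_2 scaleR_half_double)
qed

lemma inf_conv_pprt: "inf x y = x - pprt (x - (y::'a::banach_lattice))"
proof -
  have "x - pprt (x - y) = x + inf (- (x - y)) (- 0)"
    by (simp only: pprt_def diff_sup_eq_inf)
  also have "\<dots> = inf (x + - (x - y)) (x + - 0)"
    by (rule add_inf_distrib_left)
  finally show ?thesis
    by (simp add: inf_commute)
qed

lemma norm_abs_diff_le: "norm (\<bar>x\<bar> - \<bar>y\<bar>) \<le> norm (x - (y::'a::banach_lattice))"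
  by (rule norm_lattice) (rule abs_triangle_ineq3)

lemma tendsto_abs_lattice [tendsto_intros]:
  fixes l :: "'a::banach_lattice"
  assumes "(f \<longlongrightarrow> l) F" shows "((\<lambda>x. \<bar>f x\<bar>) \<longlongrightarrow> \<bar>l\<bar>) F"
proof -
  have "((\<lambda>x. norm (f x - l)) \<longlongrightarrow> 0) F"
    using tendsto_norm_zero[OF LIM_zero[OF assms]] .
  then have "((\<lambda>x. \<bar>f x\<bar> - \<bar>l\<bar>) \<longlongrightarrow> 0) F"
    by (rule Lim_null_comparison[rotated]) (simp add: norm_abs_diff_le)
  then show ?thesis
    by (simp add: LIM_zero_iff)
qed

lemma tendsto_pprt [tendsto_intros]:
  fixes l :: "'a::banach_lattice"
  shows "(f \<longlongrightarrow> l) F \<Longrightarrow> ((\<lambda>x. pprt (f x)) \<longlongrightarrow> pprt l) F"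
  unfolding pprt_conv_abs by (intro tendsto_intros)

lemma tendsto_inf [tendsto_intros]:
  fixes l :: "'a::banach_lattice"
  shows "(f \<longlongrightarrow> l) F \<Longrightarrow> (g \<longlongrightarrow> m) F \<Longrightarrow> ((\<lambda>x. inf (f x) (g x)) \<longlongrightarrow> inf l m) F"
  unfolding inf_conv_pprt by (intro tendsto_intros)

lemma nonneg_limit:
  fixes l :: "'a::banach_lattice"
  assumes "f \<longlonglongrightarrow> l" "\<And>n. 0 \<le> f n" shows "0 \<le> l"
proof -
  have "(\<lambda>n. \<bar>f n\<bar>) \<longlonglongrightarrow> \<bar>l\<bar>"
    using assms(1) by (rule tendsto_abs_lattice)
  then have "f \<longlonglongrightarrow> \<bar>l\<bar>"
    using assms(2) by (simp add: abs_of_nonneg)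
  then have "l = \<bar>l\<bar>"
    using assms(1) LIMSEQ_unique by blast
  then show ?thesis
    by (metis abs_ge_zero)
qed

lemma abs_scaleR_lattice [simp]: "\<bar>c *\<^sub>R x\<bar> = \<bar>c\<bar> *\<^sub>R \<bar>x::'a::banach_lattice\<bar>"
proof -
  have le: "\<bar>c *\<^sub>R x\<bar> \<le> c *\<^sub>R \<bar>x\<bar>" if "c \<ge> 0" for c and x :: 'a
  proof (rule abs_leI)
    show "c *\<^sub>R x \<le> c *\<^sub>R \<bar>x\<bar>"
      using that by (intro scaleR_left_mono abs_ge_self)
    show "- (c *\<^sub>R x) \<le> c *\<^sub>R \<bar>x\<bar>"
      using scaleR_left_mono[OF abs_ge_minus_self[of x] that] by simp
  qed
  have eq: "\<bar>c *\<^sub>R x\<bar> = c *\<^sub>R \<bar>x\<bar>" if "c > 0" for c and x :: 'a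
  proof (rule antisym)
    have "\<bar>inverse c *\<^sub>R c *\<^sub>R x\<bar> \<le> inverse c *\<^sub>R \<bar>c *\<^sub>R x\<bar>"
      using that by (intro le) auto
    then have "c *\<^sub>R \<bar>inverse c *\<^sub>R c *\<^sub>R x\<bar> \<le> c *\<^sub>R inverse c *\<^sub>R \<bar>c *\<^sub>R x\<bar>"
      using that by (intro scaleR_left_mono) auto
    then show "c *\<^sub>R \<bar>x\<bar> \<le> \<bar>c *\<^sub>R x\<bar>"
      using that by simp
  qed (use le that in auto)
  consider "c > 0" | "c = 0" | "- c > 0" by linarith
  then show ?thesis
  proof cases
    case 3
    have "\<bar>c *\<^sub>R x\<bar> = \<bar>(- c) *\<^sub>R x\<bar>"
      by simp
    also have "\<dots> = (- c) *\<^sub>R \<bar>x\<bar>"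
      using 3 by (rule eq)
    finally show ?thesis
      using 3 by simp
  qed (use eq in auto)
qed

lemma inf_scaleR:
  fixes x y :: "'a::banach_lattice"
  assumes "0 \<le> c" shows "inf (c *\<^sub>R x) (c *\<^sub>R y) = c *\<^sub>R inf x y"
proof -
  have "c *\<^sub>R x - c *\<^sub>R y = c *\<^sub>R (x - y)"
    by (simp add: scaleR_right_diff_distrib)
  then have "pprt (c *\<^sub>R x - c *\<^sub>R y) = c *\<^sub>R pprt (x - y)"
    using assms by (simp only: pprt_conv_abs) (simp add: scaleR_right_distrib)
  then show ?thesis
    by (simp add: inf_conv_pprt scaleR_right_diff_distrib)
qed

lemma disjoint_mono:
  fixes x y :: "'a::banach_lattice"
  assumes "inf x y = 0" "0 \<le> u" "0 \<le> v" "u \<le> x" "v \<le> y" shows "inf u v = 0"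
  using assms by (metis inf_mono inf_greatest antisym)

lemma disjoint_scaleR:
  fixes x y :: "'a::banach_lattice"
  assumes "inf x y = 0" "0 \<le> s" "0 \<le> t" shows "inf (s *\<^sub>R x) (t *\<^sub>R y) = 0"
proof (rule disjoint_mono)
  have "0 \<le> x" "0 \<le> y"
    using assms by (metis inf_le1, metis inf_le2)
  then show "s *\<^sub>R x \<le> max s t *\<^sub>R x" "t *\<^sub>R y \<le> max s t *\<^sub>R y" "0 \<le> s *\<^sub>R x" "0 \<le> t *\<^sub>R y"
    using assms by (auto intro: scaleR_right_mono scaleR_nonneg_nonneg)
  show "inf (max s t *\<^sub>R x) (max s t *\<^sub>R y) = 0"
    using assms by (simp add: inf_scaleR)
qed

text \<open>Subadditivity of \<open>x \<mapsto> inf x z\<close> is what makes disjointness from \<open>z\<close> stable under sums.\<close>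

lemma inf_add_le:
  fixes x y z :: "'a::banach_lattice"
  assumes "0 \<le> x" "0 \<le> y" "0 \<le> z"
  shows "inf (x + y) z \<le> inf x z + inf y z"
proof -
  have "inf x z + inf y z = inf (inf (x + y) (x + z)) (inf (z + y) (z + z))"
    by (metis add_inf_distrib_left add_inf_distrib_right)
  moreover have "inf (x + y) z \<le> x + z" "inf (x + y) z \<le> z + y" "inf (x + y) z \<le> z + z"
    using assms by (auto intro: le_infI2 simp: add_increasing add_increasing2)
  ultimately show ?thesis by simp
qed

lemma disjoint_sum:
  fixes f :: "'b \<Rightarrow> 'a::banach_lattice"
  assumes "\<And>a. a \<in> A \<Longrightarrow> inf (f a) z = 0" "0 \<le> z"
  shows "inf (sum f A) z = 0"
proof (cases "finite A")
  case True
  then show ?thesis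
    using assms(1)
  proof (induction A)
    case empty
    then show ?case using assms(2) by (simp add: inf_absorb1)
  next
    case (insert a A)
    have nn: "0 \<le> f b" if "b \<in> insert a A" for b
      using insert.prems[OF that] by (metis inf_le1)
    have "inf (f a + sum f A) z \<le> inf (f a) z + inf (sum f A) z"
      using nn assms(2) by (intro inf_add_le sum_nonneg) auto
    also have "\<dots> = 0"
      using insert by auto
    finally show ?case
      using nn assms(2) insert by (intro antisym) (auto intro!: sum_nonneg add_nonneg_nonneg)
  qed
next
  case False
  then show ?thesis using assms(2) by (simp add: inf_absorb1)
qed

lemma inf_pprt_nprt: "inf (pprt x) (- nprt (x::'a::banach_lattice)) = 0"
proof -
  have "pprt x = - nprt x + x"
    using prts[of x] by (metis add.commute add_uminus_conv_diff diff_eq_eq)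
  then have "inf (pprt x) (- nprt x) = - nprt x + inf x 0"
    by (metis add_inf_distrib_left add.right_neutral)
  moreover have "inf x 0 = nprt x"
    by (simp add: nprt_def)
  ultimately show ?thesis
    by (metis ab_left_minus)
qed

text \<open>The Riesz decomposition property, with the explicit choice of \<open>inf z (x a)\<close> for the first
  summand.\<close>

lemma riesz_decomposition:
  fixes x :: "'b \<Rightarrow> 'a::banach_lattice"
  assumes "finite A" "\<And>a. a \<in> A \<Longrightarrow> 0 \<le> x a" "0 \<le> z" "z \<le> sum x A"
  shows "\<exists>u. z = sum u A \<and> (\<forall>a\<in>A. 0 \<le> u a \<and> u a \<le> x a)"
  using assms
proof (induction A arbitrary: z)
  case empty
  then show ?case by auto
next
  case (insert a A)
  define v where "v = inf z (x a)"
  have z: "z - v = sup 0 (z - x a)"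
    by (simp add: v_def diff_inf_eq_sup add_sup_distrib_left)
  have "z - v \<le> sum x A"
    unfolding z using insert.prems(3) insert.hyps insert.prems(1)
    by (auto intro!: sum_nonneg simp: diff_le_eq add.commute)
  moreover have "0 \<le> z - v"
    unfolding z by simp
  ultimately obtain u where u: "z - v = sum u A" "\<forall>a\<in>A. 0 \<le> u a \<and> u a \<le> x a"
    using insert.IH[of "z - v"] insert.prems by blast
  have "sum (u(a := v)) A = sum u A"
    using insert.hyps by (intro sum.cong) auto
  then have "z = sum (u(a := v)) (insert a A)"
    using u(1) insert.hyps by (simp add: diff_eq_eq add.commute)
  moreover have "\<forall>b\<in>insert a A. 0 \<le> (u(a := v)) b \<and> (u(a := v)) b \<le> x b"
    using u(2) insert.prems by (auto simp: v_def)
  ultimately show ?case by blast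
qed

lemma lattice_ideal_closure:
  assumes "lattice_ideal (I :: 'a::banach_lattice set)" shows "lattice_ideal (closure I)"
  unfolding lattice_ideal_def
proof (intro conjI allI impI)
  have sub: "subspace I" and solid: "\<And>x y. y \<in> I \<Longrightarrow> \<bar>x\<bar> \<le> \<bar>y\<bar> \<Longrightarrow> x \<in> I"
    using assms unfolding lattice_ideal_def by blast+
  show "subspace (closure I)"
    unfolding subspace_def
  proof (intro conjI ballI allI)
    show "0 \<in> closure I"
      using sub closure_subset subspace_0 by blast
    fix x y assume "x \<in> closure I" "y \<in> closure I"
    then obtain f g where fg: "\<forall>n. f n \<in> I" "f \<longlonglongrightarrow> x" "\<forall>n. g n \<in> I" "g \<longlonglongrightarrow> y"
      unfolding closure_sequential by blast
    then show "x + y \<in> closure I"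
      unfolding closure_sequential using sub subspace_add tendsto_add
      by (intro exI[of _ "\<lambda>n. f n + g n"]) blast
  next
    fix c x assume "x \<in> closure I"
    then obtain f where "\<forall>n. f n \<in> I" "f \<longlonglongrightarrow> x"
      unfolding closure_sequential by blast
    then show "c *\<^sub>R x \<in> closure I"
      unfolding closure_sequential using sub subspace_scale
      by (intro exI[of _ "\<lambda>n. c *\<^sub>R f n"]) (auto intro!: tendsto_intros)
  qed
  fix x y :: 'a assume "y \<in> closure I \<and> \<bar>x\<bar> \<le> \<bar>y\<bar>"
  then obtain f where f: "\<And>n. f n \<in> I" "f \<longlonglongrightarrow> y" and xy: "\<bar>x\<bar> \<le> \<bar>y\<bar>"
    unfolding closure_sequential by blast
  \<comment> \<open>Truncating the positive and the negative part of \<open>x\<close> at \<open>|f n|\<close> keeps the approximants in \<open>I\<close>.\<close>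
  define g where "g n = inf (pprt x) \<bar>f n\<bar> - inf (pprt (- x)) \<bar>f n\<bar>" for n
  have "inf (pprt z) \<bar>f n\<bar> \<in> I" for n z
    using solid[OF f(1)[of n], of "inf (pprt z) \<bar>f n\<bar>"] by (simp add: abs_of_nonneg)
  then have gI: "g n \<in> I" for n
    unfolding g_def using sub subspace_diff by blast
  have "g \<longlonglongrightarrow> inf (pprt x) \<bar>y\<bar> - inf (pprt (- x)) \<bar>y\<bar>"
    unfolding g_def by (intro tendsto_intros f)
  moreover have "pprt z \<le> \<bar>y\<bar>" if "\<bar>z\<bar> \<le> \<bar>y\<bar>" for z
    using that order_trans[OF abs_ge_self that] by (simp add: pprt_def)
  then have "inf (pprt x) \<bar>y\<bar> = pprt x" "inf (pprt (- x)) \<bar>y\<bar> = pprt (- x)"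
    using xy by (auto intro!: inf_absorb1)
  then have "inf (pprt x) \<bar>y\<bar> - inf (pprt (- x)) \<bar>y\<bar> = x"
    using prts[of x] by (simp add: pprt_neg)
  ultimately show "x \<in> closure I"
    unfolding closure_sequential using gI by auto
qed

section \<open>Positive operators\<close>

lemma blinfun_nonneg_iff:
  "0 \<le> (T :: 'a::banach_lattice \<Rightarrow>\<^sub>L 'b::banach_lattice) \<longleftrightarrow> (\<forall>x\<ge>0. 0 \<le> T x)"
  by (simp add: less_eq_blinfun_def)

lemma blinfun_nonneg_apply: "0 \<le> T \<Longrightarrow> 0 \<le> x \<Longrightarrow> 0 \<le> blinfun_apply T x"
  by (simp add: blinfun_nonneg_iff)

lemma blinfun_le_apply: "S \<le> T \<Longrightarrow> 0 \<le> x \<Longrightarrow> blinfun_apply S x \<le> blinfun_apply T x"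
  by (simp add: less_eq_blinfun_def)

lemma blinfun_le_iff_diff:
  "S \<le> T \<longleftrightarrow> 0 \<le> (T - S :: 'a::banach_lattice \<Rightarrow>\<^sub>L 'b::banach_lattice)"
  by (simp add: less_eq_blinfun_def blinfun.diff_left)

lemma blinfun_nonneg_mono: "0 \<le> T \<Longrightarrow> x \<le> y \<Longrightarrow> blinfun_apply T x \<le> blinfun_apply T y"
  using blinfun_nonneg_apply[of T "y - x"] by (simp add: blinfun.diff_right)

lemma blinfun_nonneg_abs: 
  assumes "0 \<le> T" shows "\<bar>blinfun_apply T x\<bar> \<le> blinfun_apply T \<bar>x\<bar>"
proof (rule abs_leI)
  show "blinfun_apply T x \<le> blinfun_apply T \<bar>x\<bar>"
    using assms by (intro blinfun_nonneg_mono abs_ge_self)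
  show "- blinfun_apply T x \<le> blinfun_apply T \<bar>x\<bar>"
    using blinfun_nonneg_mono[OF assms abs_ge_minus_self, of x] by (simp add: blinfun.minus_right)
qed

lemma blinfun_nonneg_id [simp]: "0 \<le> (id_blinfun :: 'a::banach_lattice \<Rightarrow>\<^sub>L 'a)"
  by (simp add: blinfun_nonneg_iff)

lemma blinfun_nonneg_compose:
  fixes S :: "'b::banach_lattice \<Rightarrow>\<^sub>L 'c::banach_lattice" and T :: "'a::banach_lattice \<Rightarrow>\<^sub>L 'b"
  shows "0 \<le> S \<Longrightarrow> 0 \<le> T \<Longrightarrow> 0 \<le> S o\<^sub>L T"
  by (simp add: blinfun_nonneg_iff)

lemma blinfun_nonneg_scaleR:
  fixes S :: "'b::banach_lattice \<Rightarrow>\<^sub>L 'c::banach_lattice"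
  shows "0 \<le> c \<Longrightarrow> 0 \<le> S \<Longrightarrow> 0 \<le> c *\<^sub>R S"
  by (simp add: blinfun_nonneg_iff blinfun.scaleR_left scaleR_nonneg_nonneg)

lemma blinfun_nonneg_add:
  fixes S :: "'b::banach_lattice \<Rightarrow>\<^sub>L 'c::banach_lattice"
  shows "0 \<le> T \<Longrightarrow> 0 \<le> S \<Longrightarrow> 0 \<le> T + S"
  by (simp add: blinfun_nonneg_iff blinfun.add_left)

lemma blinfun_nonneg_power: "0 \<le> (T :: 'a::banach_lattice \<Rightarrow>\<^sub>L 'a) \<Longrightarrow> 0 \<le> T ^\<^sub>L n"
  by (induction n) (auto intro: blinfun_nonneg_compose)

lemma blinfun_nonneg_limit:
  fixes T :: "nat \<Rightarrow> 'a::banach_lattice \<Rightarrow>\<^sub>L 'b::banach_lattice"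
  assumes "T \<longlonglongrightarrow> L" "\<And>n. 0 \<le> T n" shows "0 \<le> L"
  unfolding blinfun_nonneg_iff
proof (intro allI impI)
  fix x :: 'a assume "0 \<le> x"
  then show "0 \<le> L x"
    using nonneg_limit[OF blinfun.tendsto[OF assms(1) tendsto_const]] assms(2)
    by (simp add: blinfun_nonneg_iff)
qed

lemma norm_blinfun_mono:
  fixes S T :: "'a::banach_lattice \<Rightarrow>\<^sub>L 'b::banach_lattice"
  assumes "0 \<le> S" "S \<le> T" shows "norm S \<le> norm T"
proof (rule norm_blinfun_bound)
  fix x :: 'a
  have "\<bar>S x\<bar> \<le> T \<bar>x\<bar>"
    using blinfun_nonneg_abs[OF assms(1), of x] blinfun_le_apply[OF assms(2) abs_ge_zero, of x]
    by (rule order_trans)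
  then have "norm (S x) \<le> norm (T \<bar>x\<bar>)"
    using norm_mono_nonneg[of "\<bar>S x\<bar>" "T \<bar>x\<bar>"] by simp
  also have "\<dots> \<le> norm T * norm x"
    using norm_blinfun[of T "\<bar>x\<bar>"] by simp
  finally show "norm (S x) \<le> norm T * norm x" .
qed simp

lemma rank_one_apply [simp]: "blinfun_apply (f \<otimes>\<^sub>L x) y = f y *\<^sub>R x"
  by transfer simp

lemma banach_adjoint_apply [simp]: "banach_adjoint T f = f o\<^sub>L T"
  by transfer simp

lemma blinfun_power_add: "T ^\<^sub>L (m + n) = T ^\<^sub>L m o\<^sub>L T ^\<^sub>L n"
  by (induction m) (auto intro!: blinfun_eqI)

lemma blinfun_power_commute: "T ^\<^sub>L n o\<^sub>L T = T o\<^sub>L T ^\<^sub>L n"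
  by (induction n) (auto intro!: blinfun_eqI dest: arg_cong[of _ _ blinfun_apply] simp: fun_eq_iff)

lemma norm_blinfun_power: "norm (T ^\<^sub>L n) \<le> norm T ^ n"
proof (induction n)
  case 0
  then show ?case by (simp add: norm_blinfun_id_le)
next
  case (Suc n)
  have "norm (T o\<^sub>L T ^\<^sub>L n) \<le> norm T * norm (T ^\<^sub>L n)"
    by (rule norm_blinfun_compose)
  also have "\<dots> \<le> norm T * norm T ^ n"
    using Suc by (simp add: mult_left_mono)
  finally show ?case by simp
qed

section \<open>The Hahn-Banach theorem for sublinear functionals\<close>

definition sublinear :: "('a::real_vector \<Rightarrow> real) \<Rightarrow> bool" where
  "sublinear p \<longleftrightarrow> (\<forall>x y. p (x + y) \<le> p x + p y) \<and> (\<forall>c\<ge>0. \<forall>x. p (c *\<^sub>R x) = c * p x)"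

lemma sublinear_add: "sublinear p \<Longrightarrow> p (x + y) \<le> p x + p y"
  and sublinear_scaleR: "sublinear p \<Longrightarrow> 0 \<le> c \<Longrightarrow> p (c *\<^sub>R x) = c * p x"
  by (auto simp: sublinear_def)

lemma sublinear_0: "sublinear p \<Longrightarrow> p 0 = 0"
  using sublinear_scaleR[of p 0 0] by simp

lemma sublinear_minus: "sublinear p \<Longrightarrow> - p (- x) \<le> p x"
  using sublinear_add[of p x "- x"] by (simp add: sublinear_0)

text \<open>The largest sublinear functional below \<open>p\<close> whose value at \<open>- y\<close> is \<open>- p y\<close>.\<close>

definition straighten :: "('a::real_vector \<Rightarrow> real) \<Rightarrow> 'a \<Rightarrow> 'a \<Rightarrow> real" where
  "straighten p y x = (INF t\<in>{0..}. p (x + t *\<^sub>R y) - t * p y)"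

lemma straighten_bdd:
  assumes "sublinear p" shows "bdd_below ((\<lambda>t. p (x + t *\<^sub>R y) - t * p y) ` {0..})"
proof (rule bdd_belowI2)
  fix t :: real assume "t \<in> {0..}"
  then have "t * p y = p ((x + t *\<^sub>R y) + - x)"
    using sublinear_scaleR[OF assms] by simp
  also have "\<dots> \<le> p (x + t *\<^sub>R y) + p (- x)"
    by (rule sublinear_add[OF assms])
  finally show "- p (- x) \<le> p (x + t *\<^sub>R y) - t * p y" by simp
qed

lemma straighten_le: "sublinear p \<Longrightarrow> 0 \<le> t \<Longrightarrow> straighten p y x \<le> p (x + t *\<^sub>R y) - t * p y"
  unfolding straighten_def by (rule cINF_lower) (auto intro: straighten_bdd)

lemma straighten_le_self: "sublinear p \<Longrightarrow> straighten p y x \<le> p x"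
  using straighten_le[of p 0] by simp

lemma straighten_greatest:
  "(\<And>t. 0 \<le> t \<Longrightarrow> c \<le> p (x + t *\<^sub>R y) - t * p y) \<Longrightarrow> c \<le> straighten p y x"
  unfolding straighten_def by (rule cINF_greatest) auto

lemma sublinear_straighten:
  assumes p: "sublinear p" shows "sublinear (straighten p y)"
  unfolding sublinear_def
proof (intro conjI allI impI)
  fix u v
  have *: "straighten p y (u + v) \<le> (p (u + s *\<^sub>R y) - s * p y) + (p (v + t *\<^sub>R y) - t * p y)"
    if "0 \<le> s" "0 \<le> t" for s t
  proof -
    have "straighten p y (u + v) \<le> p (u + v + (s + t) *\<^sub>R y) - (s + t) * p y"
      using that by (intro straighten_le p) auto
    also have "u + v + (s + t) *\<^sub>R y = (u + s *\<^sub>R y) + (v + t *\<^sub>R y)"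
      by (simp add: algebra_simps)
    also have "p \<dots> \<le> p (u + s *\<^sub>R y) + p (v + t *\<^sub>R y)"
      by (rule sublinear_add[OF p])
    finally show ?thesis by (simp add: algebra_simps)
  qed
  have "straighten p y (u + v) - (p (v + t *\<^sub>R y) - t * p y) \<le> straighten p y u" if "0 \<le> t" for t
    using *[OF _ that] by (intro straighten_greatest) (auto simp: algebra_simps)
  then have "straighten p y (u + v) - straighten p y u \<le> straighten p y v"
    by (intro straighten_greatest) (smt (verit))
  then show "straighten p y (u + v) \<le> straighten p y u + straighten p y v" by simp
next
  have le: "c * straighten p y u \<le> straighten p y (c *\<^sub>R u)" if "0 < c" for c u
  proof (rule straighten_greatest)
    fix t :: real assume "0 \<le> t"
    then have "straighten p y u \<le> p (u + (t / c) *\<^sub>R y) - (t / c) * p y"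
      using that by (intro straighten_le p) auto
    then have "c * straighten p y u \<le> c * p (u + (t / c) *\<^sub>R y) - t * p y"
      using that by (simp add: field_simps)
    also have "c * p (u + (t / c) *\<^sub>R y) = p (c *\<^sub>R u + t *\<^sub>R y)"
      using that sublinear_scaleR[OF p, of c "u + (t / c) *\<^sub>R y"] by (simp add: scaleR_right_distrib)
    finally show "c * straighten p y u \<le> p (c *\<^sub>R u + t *\<^sub>R y) - t * p y" .
  qed
  fix c :: real and u assume "0 \<le> c"
  have 0: "straighten p y 0 = 0"
    using straighten_le_self[OF p, of y 0] sublinear_0[OF p] sublinear_scaleR[OF p]
    by (intro antisym straighten_greatest) auto
  show "straighten p y (c *\<^sub>R u) = c * straighten p y u"
  proof (cases "c = 0")
    case False
    with \<open>0 \<le> c\<close> have "0 < c" by simp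
    have "inverse c * straighten p y (c *\<^sub>R u) \<le> straighten p y u"
      using le[of "inverse c" "c *\<^sub>R u"] \<open>0 < c\<close> by simp
    then have "straighten p y (c *\<^sub>R u) \<le> c * straighten p y u"
      using \<open>0 < c\<close> by (simp add: field_simps)
    with le[OF \<open>0 < c\<close>, of u] show ?thesis by simp
  qed (simp add: 0)
qed

text \<open>A pointwise minimal sublinear functional \<open>q\<close> agrees with each \<open>straighten q y\<close>, which makes it
  additive. Zorn's lemma supplies a minimal one below \<open>straighten p y\<^sub>0\<close>, and that functional is at
  most \<open>- p y\<^sub>0\<close> at \<open>- y\<^sub>0\<close>.\<close>

theorem hahn_banach_sublinear:
  fixes p :: "'a::real_vector \<Rightarrow> real"
  assumes p: "sublinear p"
  shows "\<exists>f. linear f \<and> (\<forall>x. f x \<le> p x) \<and> f y\<^sub>0 = p y\<^sub>0"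
proof -
  define p' where "p' = straighten p y\<^sub>0"
  have p': "sublinear p'"
    unfolding p'_def by (rule sublinear_straighten[OF p])
  define A where "A = {q :: 'a \<Rightarrow> real. sublinear q \<and> (\<forall>x. q x \<le> p' x)}"
  have "\<exists>m\<in>A. \<forall>a\<in>A. (\<forall>x. a x \<le> m x) \<longrightarrow> a = m"
  proof (rule predicate_Zorn)
    show "partial_order_on A (relation_of (\<lambda>q r. \<forall>x. r x \<le> q x) A)"
      by (rule partial_order_on_relation_ofI) (auto intro: order_trans intro!: ext antisym)
    fix C assume "C \<in> Chains (relation_of (\<lambda>q r. \<forall>x. r x \<le> q x) A)"
    then have CA: "C \<subseteq> A" and chain: "\<And>q r. q \<in> C \<Longrightarrow> r \<in> C \<Longrightarrow> (\<forall>x. q x \<le> r x) \<or> (\<forall>x. r x \<le> q x)"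
      unfolding Chains_def relation_of_def by auto
    show "\<exists>u\<in>A. \<forall>a\<in>C. \<forall>x. u x \<le> a x"
    proof (cases "C = {}")
      case True
      then show ?thesis using p' by (auto simp: A_def)
    next
      case False
      then obtain q0 where q0: "q0 \<in> C" by blast
      have sub: "sublinear q" and le: "q x \<le> p' x" if "q \<in> C" for q x
        using CA that by (auto simp: A_def)
      define u where "u x = (INF q\<in>C. q x)" for x
      have bdd: "bdd_below ((\<lambda>q. q x) ` C)" for x
      proof (rule bdd_belowI2)
        fix q assume "q \<in> C"
        then show "- p' (- x) \<le> q x"
          using sublinear_minus[OF sub, of q x] le[of q "- x"] by linarith
      qed
      have ule: "u x \<le> q x" if "q \<in> C" for q x
        unfolding u_def using that bdd by (intro cINF_lower) auto
      have ugr: "c \<le> u x" if "\<And>q. q \<in> C \<Longrightarrow> c \<le> q x" for c x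
        unfolding u_def using False that by (intro cINF_greatest) auto
      have "sublinear u"
        unfolding sublinear_def
      proof (intro conjI allI impI)
        fix x y
        have "u (x + y) \<le> q x + r y" if "q \<in> C" "r \<in> C" for q r
        proof (cases "\<forall>x. q x \<le> r x")
          case True
          have "u (x + y) \<le> q x + q y"
            using ule[OF that(1), of "x + y"] sublinear_add[OF sub[OF that(1)], of x y] by linarith
          then show ?thesis using True by (meson add_left_mono order_trans)
        next
          case False
          then have "\<forall>x. r x \<le> q x" using chain that by blast
          moreover have "u (x + y) \<le> r x + r y"
            using ule[OF that(2), of "x + y"] sublinear_add[OF sub[OF that(2)], of x y] by linarith
          ultimately show ?thesis by (meson add_right_mono order_trans)
        qed
        then have "u (x + y) - r y \<le> u x" if "r \<in> C" for r
          using that by (intro ugr) (auto simp: algebra_simps)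
        then have "u (x + y) - u x \<le> u y"
          by (intro ugr) (smt (verit))
        then show "u (x + y) \<le> u x + u y" by simp
      next
        fix c :: real and x assume c: "0 \<le> c"
        show "u (c *\<^sub>R x) = c * u x"
        proof (rule antisym)
          show "c * u x \<le> u (c *\<^sub>R x)"
            using c ule by (intro ugr) (auto simp: sublinear_scaleR[OF sub] intro: mult_left_mono)
          show "u (c *\<^sub>R x) \<le> c * u x"
          proof (cases "c = 0")
            case True
            then show ?thesis using ule[OF q0, of 0] sublinear_0[OF sub[OF q0]] by simp
          next
            case False
            have "u (c *\<^sub>R x) / c \<le> u x"
            proof (rule ugr)
              fix q assume "q \<in> C"
              then show "u (c *\<^sub>R x) / c \<le> q x"
                using ule[of q "c *\<^sub>R x"] c False
                by (simp add: sublinear_scaleR[OF sub] field_simps)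
            qed
            then show ?thesis using c False by (simp add: field_simps)
          qed
        qed
      qed
      moreover have "u x \<le> p' x" for x
        using ule[OF q0] le[OF q0] by (rule order_trans)
      ultimately show ?thesis using ule by (auto simp: A_def)
    qed
  qed
  then obtain q where q: "sublinear q" "\<And>x. q x \<le> p' x"
    and min: "\<And>a. sublinear a \<Longrightarrow> (\<And>x. a x \<le> p' x) \<Longrightarrow> (\<And>x. a x \<le> q x) \<Longrightarrow> a = q"
    unfolding A_def by blast
  have straight: "straighten q y = q" for y
    using q straighten_le_self[OF q(1)] sublinear_straighten[OF q(1)]
    by (intro min) (auto intro: order_trans)
  have add: "q (x + y) = q x + q y" for x y
    using straighten_le[OF q(1), of 1 y x] sublinear_add[OF q(1), of x y] by (simp add: straight)
  have minus: "q (- x) = - q x" for x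
    using add[of x "- x"] sublinear_0[OF q(1)] by simp
  have "q (c *\<^sub>R x) = c * q x" for c x
  proof (cases "0 \<le> c")
    case False
    then have "q (c *\<^sub>R x) = - q ((- c) *\<^sub>R x)"
      by (simp add: minus)
    also have "q ((- c) *\<^sub>R x) = - c * q x"
      using False by (intro sublinear_scaleR[OF q(1)]) simp
    finally show ?thesis by simp
  qed (simp add: sublinear_scaleR[OF q(1)])
  then have lin: "linear q"
    using add by (intro linearI) auto
  have le: "q x \<le> p x" for x
    using q(2)[of x] straighten_le_self[OF p, of y\<^sub>0 x] by (simp add: p'_def)
  have "q (- y\<^sub>0) \<le> p (- y\<^sub>0 + 1 *\<^sub>R y\<^sub>0) - 1 * p y\<^sub>0"
    using q(2)[of "- y\<^sub>0"] straighten_le[OF p, of 1 y\<^sub>0 "- y\<^sub>0"] unfolding p'_def by linarith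
  then have "p y\<^sub>0 \<le> q y\<^sub>0"
    by (simp add: minus sublinear_0[OF p])
  with lin le show ?thesis
    by (intro exI[of _ q]) (auto intro: antisym)
qed

lemma bounded_linear_of_dominated:
  fixes f :: "'a::real_normed_vector \<Rightarrow> real"
  assumes "linear f" "\<And>x. f x \<le> norm x" shows "bounded_linear f"
  unfolding bounded_linear_def bounded_linear_axioms_def
proof (intro conjI exI[of _ 1] allI)
  fix x
  show "norm (f x) \<le> norm x * 1"
    using assms(2)[of x] assms(2)[of "- x"] by (simp add: linear_neg[OF assms(1)])
qed (fact assms(1))

text \<open>Domination by the norm itself gives the functionals that separate points.\<close>

lemma exists_norming_functional:
  fixes x :: "'a::real_normed_vector"
  shows "\<exists>f :: 'a \<Rightarrow>\<^sub>L real. f x = norm x"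
proof -
  have "sublinear (norm :: 'a \<Rightarrow> real)"
    by (simp add: sublinear_def norm_triangle_ineq)
  then obtain f where f: "linear f" "\<And>y. f y \<le> norm y" "f x = norm x"
    using hahn_banach_sublinear by blast
  then show ?thesis
    by (intro exI[of _ "Blinfun f"]) (simp add: bounded_linear_of_dominated bounded_linear_Blinfun_apply)
qed

text \<open>A functional dominated by \<open>\<lambda>y. norm (pprt y)\<close> is at most \<open>0\<close> on the negative cone, hence
  positive.\<close>

lemma exists_positive_functional:
  fixes x :: "'a::banach_lattice"
  assumes "0 < x" shows "\<exists>f :: 'a \<Rightarrow>\<^sub>L real. 0 \<le> f \<and> 0 < blinfun_apply f x"
proof -
  have "norm (pprt (u + v)) \<le> norm (pprt u) + norm (pprt v)" for u v :: 'a
  proof -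
    have "u + v \<le> pprt u + pprt v"
      by (intro add_mono) (simp_all add: pprt_def)
    then have "pprt (u + v) \<le> pprt u + pprt v"
      by (simp add: pprt_def[of "u + v"])
    then show ?thesis
      by (meson norm_mono_nonneg norm_triangle_ineq order_trans zero_le_pprt)
  qed
  moreover have "norm (pprt (c *\<^sub>R u)) = c * norm (pprt u)" if "0 \<le> c" for c and u :: 'a
  proof -
    have "pprt (c *\<^sub>R u) = c *\<^sub>R pprt u"
      using that by (simp add: pprt_conv_abs scaleR_right_distrib)
    then show ?thesis using that by simp
  qed
  ultimately have "sublinear (\<lambda>u::'a. norm (pprt u))"
    by (simp add: sublinear_def)
  then obtain f where f: "linear f" "\<And>y. f y \<le> norm (pprt y)" "f x = norm (pprt x)"
    using hahn_banach_sublinear[of "\<lambda>u. norm (pprt u)" x] by blast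
  have "norm (pprt y) \<le> norm y" for y :: 'a
    by (rule norm_lattice) (simp add: pprt_def abs_of_nonneg abs_ge_self)
  then have bl: "bounded_linear f"
    by (intro bounded_linear_of_dominated f(1)) (rule order_trans[OF f(2)])
  have "0 \<le> f y" if "0 \<le> y" for y
    using f(2)[of "- y"] that by (simp add: linear_neg[OF f(1)])
  moreover have "0 < f x"
    using assms f(3) by simp
  ultimately show ?thesis using bl
    by (intro exI[of _ "Blinfun f"]) (auto simp: bounded_linear_Blinfun_apply blinfun_nonneg_iff)
qed

section \<open>Compact operators\<close>

lemma compact_operator_net:
  assumes "compact_operator T"
  shows "compact (closure (blinfun_apply T ` cball 0 M))"
proof -
  have "blinfun_apply T ` cball 0 M \<subseteq> (\<lambda>y. \<bar>M\<bar> *\<^sub>R y) ` closure (blinfun_apply T ` cball 0 1)" (is "_ \<subseteq> ?S")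
  proof
    fix y assume "y \<in> blinfun_apply T ` cball 0 M"
    then obtain x where x: "y = T x" "norm x \<le> M" by auto
    show "y \<in> ?S"
    proof (cases "M > 0")
      case True
      then have "(1 / M) *\<^sub>R x \<in> cball 0 1"
        using x by (simp add: field_simps)
      then have "T ((1 / M) *\<^sub>R x) \<in> closure (blinfun_apply T ` cball 0 1)"
        by (intro closure_subset[THEN subsetD] imageI)
      moreover have "y = \<bar>M\<bar> *\<^sub>R T ((1 / M) *\<^sub>R x)"
        using True x by (simp add: blinfun.scaleR_right)
      ultimately show ?thesis by blast
    next
      case False
      have "norm x = 0" and M: "M = 0"
        using False x(2) norm_ge_zero[of x] by linarith+
      then have "x = 0" by simp
      moreover have "T 0 \<in> closure (blinfun_apply T ` cball 0 1)"
        by (intro closure_subset[THEN subsetD] imageI) simp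
      ultimately show ?thesis
        using M x(1) by (intro image_eqI[of _ _ "T 0"]) simp_all
    qed
  qed
  moreover have "compact ?S"
    using assms unfolding compact_operator_def by (rule compact_scaling)
  ultimately show ?thesis
    by (metis closure_minimal compact_imp_closed closed_closure compact_Int_closed inf.absorb_iff2)
qed

lemma compact_operator_subseq:
  assumes "compact_operator T" "\<And>n. norm (u n) \<le> M"
  obtains l r where "strict_mono (r :: nat \<Rightarrow> nat)" "(\<lambda>n. blinfun_apply T (u (r n))) \<longlonglongrightarrow> l"
proof -
  have "\<And>n. T (u n) \<in> closure (blinfun_apply T ` cball 0 M)"
    using assms(2) by (intro closure_subset[THEN subsetD]) auto
  then obtain l r where "strict_mono r" "((\<lambda>n. T (u n)) \<circ> r) \<longlonglongrightarrow> l"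
    using compact_operator_net[OF assms(1), of M] unfolding compact_def by meson
  then show ?thesis
    using that by (auto simp: o_def)
qed

text \<open>Points of the closure are approximated by image points along the sequence, so only sequences in
  the image itself need to be considered.\<close>

lemma compact_operatorI:
  fixes T :: "'a::real_normed_vector \<Rightarrow>\<^sub>L 'b::real_normed_vector"
  assumes "\<And>u. (\<And>n. norm (u n) \<le> 1) \<Longrightarrow>
    \<exists>l r. strict_mono (r :: nat \<Rightarrow> nat) \<and> (\<lambda>n. blinfun_apply T (u (r n))) \<longlonglongrightarrow> l"
  shows "compact_operator T"
  unfolding compact_operator_def compact_def
proof (intro allI impI)
  fix f :: "nat \<Rightarrow> 'b" assume f: "\<forall>n. f n \<in> closure (blinfun_apply T ` cball 0 1)"
  have "\<exists>u. norm u \<le> 1 \<and> dist (T u) (f n) < inverse (real (Suc n))" for n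
    using f[rule_format, of n] unfolding closure_approachable
    by (metis (no_types, lifting) imageE mem_cball_0 inverse_positive_iff_positive of_nat_0_less_iff zero_less_Suc)
  then obtain u where u: "\<And>n. norm (u n) \<le> 1" "\<And>n. dist (T (u n)) (f n) < inverse (real (Suc n))"
    by metis
  obtain l r where r: "strict_mono (r :: nat \<Rightarrow> nat)" "(\<lambda>n. T (u (r n))) \<longlonglongrightarrow> l"
    using assms u(1) by blast
  have "(\<lambda>n. T (u n) - f n) \<longlonglongrightarrow> 0"
    using u(2) by (intro Lim_null_comparison[OF _ LIMSEQ_inverse_real_of_nat] always_eventually)
      (auto simp: dist_norm intro: less_imp_le)
  then have "(\<lambda>n. T (u (r n)) - f (r n)) \<longlonglongrightarrow> 0"
    using LIMSEQ_subseq_LIMSEQ[OF _ r(1)] by (auto simp: o_def)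
  then have lim: "(f \<circ> r) \<longlonglongrightarrow> l"
    using tendsto_diff[OF r(2)] by (fastforce simp: o_def)
  moreover have "l \<in> closure (blinfun_apply T ` cball 0 1)"
    using closed_sequentially[OF closed_closure _ lim] f by (simp add: o_def)
  ultimately show "\<exists>l\<in>closure (blinfun_apply T ` cball 0 1). \<exists>r. strict_mono r \<and> (f \<circ> r) \<longlonglongrightarrow> l"
    using r(1) by blast
qed

lemma compact_operator_compose_right:
  assumes "compact_operator T" shows "compact_operator (T o\<^sub>L S)"
proof (rule compact_operatorI)
  fix u :: "nat \<Rightarrow> 'c" assume u: "\<And>n. norm (u n) \<le> 1"
  have "norm (S (u n)) \<le> norm S" for n
    using norm_blinfun[of S "u n"] mult_left_mono[OF u[of n] norm_ge_zero[of S]] by simp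
  then show "\<exists>l r. strict_mono (r :: nat \<Rightarrow> nat) \<and> (\<lambda>n. (T o\<^sub>L S) (u (r n))) \<longlonglongrightarrow> l"
    using compact_operator_subseq[OF assms, of "\<lambda>n. S (u n)" "norm S"] by fastforce
qed

lemma compact_operator_compose_left:
  assumes "compact_operator T" shows "compact_operator (S o\<^sub>L T)"
proof (rule compact_operatorI)
  fix u :: "nat \<Rightarrow> 'a" assume u: "\<And>n. norm (u n) \<le> 1"
  obtain l r where "strict_mono (r :: nat \<Rightarrow> nat)" "(\<lambda>n. T (u (r n))) \<longlonglongrightarrow> l"
    using compact_operator_subseq[OF assms, of u, OF u] .
  then show "\<exists>l r. strict_mono (r :: nat \<Rightarrow> nat) \<and> (\<lambda>n. (S o\<^sub>L T) (u (r n))) \<longlonglongrightarrow> l"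
    by (auto intro!: exI[of _ r] exI[of _ "S l"] blinfun.tendsto tendsto_const)
qed

lemma compact_operator_add:
  assumes "compact_operator S" "compact_operator T" shows "compact_operator (S + T)"
proof (rule compact_operatorI)
  fix u :: "nat \<Rightarrow> 'a" assume u: "\<And>n. norm (u n) \<le> 1"
  obtain l r where r: "strict_mono (r :: nat \<Rightarrow> nat)" "(\<lambda>n. T (u (r n))) \<longlonglongrightarrow> l"
    using compact_operator_subseq[OF assms(2), of u, OF u] .
  obtain m q where q: "strict_mono (q :: nat \<Rightarrow> nat)" "(\<lambda>n. S (u (r (q n)))) \<longlonglongrightarrow> m"
    using compact_operator_subseq[OF assms(1), of "\<lambda>n. u (r n)", OF u] .
  have "(\<lambda>n. T (u (r (q n)))) \<longlonglongrightarrow> l"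
    using LIMSEQ_subseq_LIMSEQ[OF r(2) q(1)] by (simp add: o_def)
  then have "(\<lambda>n. (S + T) (u ((r \<circ> q) n))) \<longlonglongrightarrow> m + l"
    using tendsto_add[OF q(2)] by (simp add: blinfun.add_left)
  then show "\<exists>l r. strict_mono (r :: nat \<Rightarrow> nat) \<and> (\<lambda>n. (S + T) (u (r n))) \<longlonglongrightarrow> l"
    using strict_mono_o[OF r(1) q(1)] by blast
qed

lemma norm_blinfun_le_unit_ball:
  fixes T :: "'a::real_normed_vector \<Rightarrow>\<^sub>L 'b::real_normed_vector"
  assumes "0 \<le> c" "\<And>x. norm x \<le> 1 \<Longrightarrow> norm (T x) \<le> c" shows "norm T \<le> c"
proof (rule norm_blinfun_bound[OF assms(1)])
  fix x
  show "norm (T x) \<le> c * norm x"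
  proof (cases "x = 0")
    case False
    then show ?thesis
      using assms(2)[of "(1 / norm x) *\<^sub>R x"] by (simp add: blinfun.scaleR_right field_simps)
  qed simp
qed

text \<open>Compactness of \<open>A \<mapsto> S A T\<close>: the factor \<open>T\<close> makes an operator \<open>A\<close> of controlled norm
  recognisable, up to a small error, by its values at finitely many points, and the factor \<open>S\<close>
  leaves, up to a small error, finitely many possibilities for those values.\<close>

lemma compact_sandwich_subseq:
  fixes S :: "'c::real_normed_vector \<Rightarrow>\<^sub>L 'd::banach"
    and T :: "'a::real_normed_vector \<Rightarrow>\<^sub>L 'b::real_normed_vector" and A :: "nat \<Rightarrow> 'b \<Rightarrow>\<^sub>L 'c"
  assumes S: "compact_operator S" and T: "compact_operator T" and M: "\<And>n. norm (A n) \<le> M"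
  obtains L r where "strict_mono (r :: nat \<Rightarrow> nat)" "(\<lambda>n. S o\<^sub>L A (r n) o\<^sub>L T) \<longlonglongrightarrow> L"
proof -
  have M0: "0 \<le> M"
    using M[of 0] norm_ge_zero order_trans by blast
  let ?F = "\<lambda>n. S o\<^sub>L A n o\<^sub>L T"
  have "\<exists>k. finite k \<and> closure (range ?F) \<subseteq> (\<Union>x\<in>k. ball x e)" if "e > 0" for e
  proof -
    define a where "a = e / (8 * (norm S * M + 1))"
    define b where "b = e / 8"
    have SM: "norm S * M + 1 > 0"
      using M0 by (simp add: add_nonneg_pos)
    have ab: "a > 0" "b > 0"
      using that SM by (auto simp: a_def b_def)
    have aS: "norm S * M * a \<le> e / 8"
      using that SM M0 by (simp add: a_def field_simps)
    obtain k1 where k1: "finite k1" "blinfun_apply T ` cball 0 1 \<subseteq> (\<Union>x\<in>k1. ball x a)"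
      using T ab closure_subset unfolding compact_operator_def compact_eq_totally_bounded
      by (meson order_trans)
    obtain R where R: "\<And>c. c \<in> k1 \<Longrightarrow> norm c \<le> R"
      using finite_imp_bounded[OF k1(1)] unfolding bounded_iff by blast
    obtain k2 where k2: "finite k2" "blinfun_apply S ` cball 0 (M * R) \<subseteq> (\<Union>x\<in>k2. ball x b)"
      using compact_operator_net[OF S, of "M * R"] ab closure_subset unfolding compact_eq_totally_bounded
      by (meson order_trans)
    have "\<exists>z\<in>k2. dist z (S (A n c)) < b" if "c \<in> k1" for n c
    proof -
      have "norm (A n c) \<le> norm (A n) * norm c"
        by (rule norm_blinfun)
      also have "\<dots> \<le> M * R"
        using M R[OF that] by (intro mult_mono) (auto intro: M0)
      finally have "S (A n c) \<in> blinfun_apply S ` cball 0 (M * R)" by simp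
      then obtain z where "z \<in> k2" "S (A n c) \<in> ball z b"
        using k2(2) by blast
      then show ?thesis by auto
    qed
    then have "\<forall>n c. \<exists>z. c \<in> k1 \<longrightarrow> z \<in> k2 \<and> dist z (S (A n c)) < b"
      by meson
    then obtain z where z: "\<And>n c. c \<in> k1 \<Longrightarrow> z n c \<in> k2 \<and> dist (z n c) (S (A n c)) < b"
      by metis
    define s where "s n = restrict (z n) k1" for n
    have "range s \<subseteq> k1 \<rightarrow>\<^sub>E k2"
      using z by (auto simp: s_def)
    then have fin: "finite (range s)"
      using k1(1) k2(1) finite_PiE finite_subset by metis
    define rep where "rep n = (SOME m. s m = s n)" for n
    have rep: "s (rep n) = s n" for n
      unfolding rep_def by (rule someI) simp
    have "rep n = inv s (s n)" for n
      by (simp add: rep_def inv_def)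
    then have "range rep \<subseteq> inv s ` range s" by auto
    then have finrep: "finite (range rep)"
      using fin finite_subset by blast
    have close: "dist (?F n) (?F (rep n)) \<le> e / 2" for n
    proof -
      have "norm (?F n - ?F (rep n)) \<le> e / 2"
      proof (rule norm_blinfun_le_unit_ball)
        fix x :: 'a assume "norm x \<le> 1"
        then obtain c where c: "c \<in> k1" "norm (c - T x) < a"
          using k1(2) by (fastforce simp: dist_norm)
        have 1: "norm (S (A m (T x - c))) \<le> e / 8" for m
        proof -
          have "norm (S (A m (T x - c))) \<le> norm S * (norm (A m) * norm (T x - c))"
            by (intro order_trans[OF norm_blinfun] mult_left_mono norm_blinfun norm_ge_zero)
          also have "\<dots> \<le> norm S * (M * a)"
            using c(2) M[of m] M0 ab by (intro mult_left_mono mult_mono) (auto simp: norm_minus_commute)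
          finally show ?thesis using aS by (simp add: mult.assoc)
        qed
        have "z n c = z (rep n) c"
          using rep[of n] c(1) unfolding s_def by (metis restrict_apply')
        then have 2: "norm (S (A n c) - S (A (rep n) c)) \<le> e / 4"
          using z[OF c(1), of n] z[OF c(1), of "rep n"]
            dist_triangle3[of "S (A n c)" "S (A (rep n) c)" "z n c"]
          by (simp add: b_def dist_norm)
        have eq: "(?F n - ?F (rep n)) x
          = S (A n (T x - c)) - S (A (rep n) (T x - c)) + (S (A n c) - S (A (rep n) c))"
          by (simp add: blinfun.diff_left blinfun.diff_right)
        have "norm ((?F n - ?F (rep n)) x) \<le> (e / 8 + e / 8) + e / 4"
          unfolding eq
          using 1[of n] 1[of "rep n"] 2 norm_triangle_ineq4[of "S (A n (T x - c))" "S (A (rep n) (T x - c))"]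
            norm_triangle_ineq[of "S (A n (T x - c)) - S (A (rep n) (T x - c))" "S (A n c) - S (A (rep n) c)"]
          by linarith
        then show "norm ((?F n - ?F (rep n)) x) \<le> e / 2" by simp
      qed (use that in simp)
      then show ?thesis by (simp add: dist_norm)
    qed
    have "closure (range ?F) \<subseteq> (\<Union>x\<in>?F ` range rep. cball x (e / 2))"
    proof (rule closure_minimal)
      show "range ?F \<subseteq> (\<Union>x\<in>?F ` range rep. cball x (e / 2))"
        using close by (auto simp: dist_commute)
      show "closed (\<Union>x\<in>?F ` range rep. cball x (e / 2))"
        using finrep by (intro closed_UN) auto
    qed
    also have "\<dots> \<subseteq> (\<Union>x\<in>?F ` range rep. ball x e)"
      using that by fastforce
    finally show ?thesis
      using finrep by blast
  qed
  then have "compact (closure (range ?F))"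
    unfolding compact_eq_totally_bounded by (simp add: complete_eq_closed)
  moreover have "\<forall>n. ?F n \<in> closure (range ?F)"
    by (intro allI closure_subset[THEN subsetD] rangeI)
  ultimately obtain L r where "strict_mono r" "(?F \<circ> r) \<longlonglongrightarrow> L"
    unfolding compact_def by meson
  then show ?thesis
    using that by (auto simp: o_def)
qed

section \<open>Inverses and Neumann series\<close>

lemmas tendsto_blinfun_compose [tendsto_intros] = bounded_bilinear.tendsto[OF bounded_bilinear_blinfun_compose]

lemma blinfun_inverses_apply:
  assumes "blinfun_inverses A B" shows "blinfun_apply A (blinfun_apply B x) = x" "blinfun_apply B (blinfun_apply A x) = x"
proof -
  have "(A o\<^sub>L B) x = x" "(B o\<^sub>L A) x = x"
    using assms by (simp_all add: blinfun_inverses_def)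
  then show "A (B x) = x" "B (A x) = x" by simp_all
qed

lemma blinfun_inversesI:
  "(\<And>x. blinfun_apply A (blinfun_apply B x) = x) \<Longrightarrow> (\<And>x. blinfun_apply B (blinfun_apply A x) = x) \<Longrightarrow> blinfun_inverses A B"
  by (auto simp: blinfun_inverses_def intro!: blinfun_eqI)

lemma blinfun_inverses_unique:
  assumes "blinfun_inverses A B" "blinfun_inverses A C" shows "B = C"
  by (rule blinfun_eqI) (metis assms blinfun_inverses_apply)

lemma blinfun_inverses_compose:
  "blinfun_inverses A B \<Longrightarrow> blinfun_inverses C D \<Longrightarrow> blinfun_inverses (A o\<^sub>L C) (D o\<^sub>L B)"
  by (rule blinfun_inversesI) (auto simp: blinfun_inverses_apply)

lemma neumann_series:
  fixes A :: "'a::banach \<Rightarrow>\<^sub>L 'a"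
  assumes "summable (\<lambda>n. norm (A ^\<^sub>L n))"
  shows "blinfun_inverses (id_blinfun - A) (\<Sum>n. A ^\<^sub>L n)"
proof -
  have sm: "summable (\<lambda>n. A ^\<^sub>L n)"
    using assms by (rule summable_norm_cancel)
  have 1: "A o\<^sub>L (\<Sum>n. A ^\<^sub>L n) = (\<Sum>n. A ^\<^sub>L n) - id_blinfun"
    using bounded_linear.suminf[OF bounded_bilinear.bounded_linear_right[OF bounded_bilinear_blinfun_compose] sm, of A]
      suminf_split_head[OF sm] by simp
  have 2: "(\<Sum>n. A ^\<^sub>L n) o\<^sub>L A = (\<Sum>n. A ^\<^sub>L n) - id_blinfun"
    using bounded_linear.suminf[OF bounded_bilinear.bounded_linear_left[OF bounded_bilinear_blinfun_compose] sm, of A]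
      suminf_split_head[OF sm] by (simp add: blinfun_power_commute)
  show ?thesis
  proof (rule blinfun_inversesI)
    fix x
    show "(id_blinfun - A) ((\<Sum>n. A ^\<^sub>L n) x) = x"
      using arg_cong[OF 1, of "\<lambda>T. T x"] by (simp add: blinfun.diff_left)
    show "(\<Sum>n. A ^\<^sub>L n) ((id_blinfun - A) x) = x"
      using arg_cong[OF 2, of "\<lambda>T. T x"] by (simp add: blinfun.diff_left blinfun.diff_right)
  qed
qed

lemma summable_norm_power_lt_1:
  assumes "norm A < 1" shows "summable (\<lambda>n. norm (A ^\<^sub>L n))"
  using assms by (intro summable_comparison_test[OF _ summable_geometric[of "norm A"]])
    (auto intro: norm_blinfun_power)

text \<open>\<open>A - D = A (1 - B D)\<close>, and the second factor is inverted by its Neumann series. The explicit inverse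
  is recorded because its positivity matters below.\<close>

lemma blinfun_inverses_perturb:
  fixes A :: "'a::banach \<Rightarrow>\<^sub>L 'a"
  assumes AB: "blinfun_inverses A B" and "norm D * norm B < 1"
  shows "blinfun_inverses (A - D) ((\<Sum>n. (B o\<^sub>L D) ^\<^sub>L n) o\<^sub>L B)"
proof -
  have "norm (B o\<^sub>L D) < 1"
    using assms(2) norm_blinfun_compose[of B D] by (simp add: mult.commute)
  then have "blinfun_inverses (id_blinfun - (B o\<^sub>L D)) (\<Sum>n. (B o\<^sub>L D) ^\<^sub>L n)"
    by (intro neumann_series summable_norm_power_lt_1)
  from blinfun_inverses_compose[OF AB this]
  have "blinfun_inverses (A o\<^sub>L (id_blinfun - (B o\<^sub>L D))) ((\<Sum>n. (B o\<^sub>L D) ^\<^sub>L n) o\<^sub>L B)" .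
  moreover have "A o\<^sub>L (id_blinfun - (B o\<^sub>L D)) = A - D"
    by (rule blinfun_eqI) (simp add: blinfun.diff_left blinfun.diff_right blinfun_inverses_apply[OF AB])
  ultimately show ?thesis by simp
qed

lemma suminf_power_nonneg:
  fixes A :: "'a::banach_lattice \<Rightarrow>\<^sub>L 'a"
  assumes "0 \<le> A" "summable (\<lambda>n. norm (A ^\<^sub>L n))"
  shows "0 \<le> (\<Sum>n. A ^\<^sub>L n)"
proof (rule blinfun_nonneg_limit)
  show "(\<lambda>N. \<Sum>n<N. A ^\<^sub>L n) \<longlonglongrightarrow> (\<Sum>n. A ^\<^sub>L n)"
    using summable_LIMSEQ[OF summable_norm_cancel[OF assms(2)]] .
  show "0 \<le> (\<Sum>n<N. A ^\<^sub>L n)" for N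
    using blinfun_nonneg_power[OF assms(1)] by (induction N) (auto intro: blinfun_nonneg_add)
qed

section \<open>The Krein-Rutman theorem\<close>

text \<open>The real numbers at which the resolvent exists and is positive. For a positive operator they
  form a half-line, whose left end is the spectral radius.\<close>

definition pos_resolvent_set :: "('a::banach_lattice \<Rightarrow>\<^sub>L 'a) \<Rightarrow> real set" where
  "pos_resolvent_set K = {t. 0 < t \<and> (\<exists>R\<ge>0. blinfun_inverses (t *\<^sub>R id_blinfun - K) R)}"

abbreviation pos_radius :: "('a::banach_lattice \<Rightarrow>\<^sub>L 'a) \<Rightarrow> real" where
  "pos_radius K \<equiv> Inf (pos_resolvent_set K)"

lemma blinfun_inverses_scaleR:
  "c \<noteq> 0 \<Longrightarrow> blinfun_inverses A B \<Longrightarrow> blinfun_inverses (c *\<^sub>R A) ((1 / c) *\<^sub>R B)"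
  by (rule blinfun_inversesI) (simp_all add: blinfun.scaleR_left blinfun.scaleR_right blinfun_inverses_apply)

lemma pos_resolvent_set_large:
  assumes K: "0 \<le> K" and t: "norm K < t" shows "t \<in> pos_resolvent_set K"
proof -
  have t0: "0 < t"
    using t norm_ge_zero[of K] by linarith
  let ?A = "(1 / t) *\<^sub>R K"
  have "norm ?A < 1"
    using t t0 by (simp add: field_simps)
  then have sm: "summable (\<lambda>n. norm (?A ^\<^sub>L n))"
    by (rule summable_norm_power_lt_1)
  have "blinfun_inverses (t *\<^sub>R (id_blinfun - ?A)) ((1 / t) *\<^sub>R (\<Sum>n. ?A ^\<^sub>L n))"
    using t0 by (intro blinfun_inverses_scaleR neumann_series sm) simp
  moreover have "t *\<^sub>R (id_blinfun - ?A) = t *\<^sub>R id_blinfun - K"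
    using t0 by (simp add: scaleR_right_diff_distrib)
  moreover have "0 \<le> (1 / t) *\<^sub>R (\<Sum>n. ?A ^\<^sub>L n)"
    using t0 K by (intro blinfun_nonneg_scaleR suminf_power_nonneg sm) auto
  ultimately show ?thesis
    using t0 by (auto simp: pos_resolvent_set_def)
qed

text \<open>If \<open>R\<close> inverts \<open>t - K\<close> then \<open>t R = 1 + K R\<close>. Iterating this identity and dropping
  positive terms bounds the powers of \<open>K\<close>.\<close>

lemma pos_resolvent_growth:
  assumes K: "0 \<le> K" and t: "t \<in> pos_resolvent_set K"
  shows "\<exists>C\<ge>0. \<forall>n. norm (K ^\<^sub>L n) \<le> C * t ^ n"
proof -
  obtain R where R: "0 < t" "0 \<le> R" "blinfun_inverses (t *\<^sub>R id_blinfun - K) R"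
    using t by (auto simp: pos_resolvent_set_def)
  have eq: "t *\<^sub>R R x = x + K (R x)" for x
    using blinfun_inverses_apply(1)[OF R(3), of x]
    by (simp add: blinfun.diff_left blinfun.scaleR_left diff_eq_eq)
  have le: "(K ^\<^sub>L n) x \<le> t ^ Suc n *\<^sub>R R x" if "0 \<le> x" for n x
  proof (induction n)
    case 0
    then show ?case
      using eq[of x] that R(2) K by (simp add: blinfun_nonneg_apply)
  next
    case (Suc n)
    have "(K ^\<^sub>L Suc n) x \<le> K (t ^ Suc n *\<^sub>R R x)"
      using Suc by (simp add: blinfun_nonneg_mono[OF K])
    also have "\<dots> = t ^ Suc n *\<^sub>R K (R x)"
      by (simp add: blinfun.scaleR_right)
    also have "\<dots> \<le> t ^ Suc n *\<^sub>R (x + K (R x))"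
      using that R(1) by (intro scaleR_left_mono) auto
    also have "\<dots> = t ^ Suc (Suc n) *\<^sub>R R x"
      by (simp only: eq[symmetric]) (simp add: mult.commute)
    finally show ?case .
  qed
  have "norm (K ^\<^sub>L n) \<le> (t * norm R) * t ^ n" for n
  proof -
    have "norm (K ^\<^sub>L n) \<le> norm (t ^ Suc n *\<^sub>R R)"
      using le by (intro norm_blinfun_mono blinfun_nonneg_power K)
        (auto simp: less_eq_blinfun_def blinfun.scaleR_left)
    then show ?thesis
      using R(1) by (simp add: mult_ac)
  qed
  then show ?thesis
    using R(1) by (intro exI[of _ "t * norm R"]) auto
qed

text \<open>The positive resolvent set is open to the left: for \<open>s \<le> t\<close> the Neumann series in
  \<open>(t - s) R\<close> has positive terms.\<close>

lemma pos_resolvent_set_lower: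
  assumes R: "0 \<le> R" "blinfun_inverses (t *\<^sub>R id_blinfun - K) R"
    and s: "0 < s" "s \<le> t" "(t - s) * norm R < 1"
  shows "s \<in> pos_resolvent_set K"
proof -
  let ?D = "(t - s) *\<^sub>R id_blinfun :: 'a \<Rightarrow>\<^sub>L 'a"
  have "norm ?D \<le> \<bar>t - s\<bar> * 1"
    unfolding norm_scaleR by (intro mult_left_mono norm_blinfun_id_le) simp
  then have "norm ?D * norm R \<le> (t - s) * norm R"
    using s by (intro mult_right_mono) auto
  then have nD: "norm ?D * norm R < 1"
    using s by linarith
  have "blinfun_inverses (t *\<^sub>R id_blinfun - K - ?D) ((\<Sum>n. (R o\<^sub>L ?D) ^\<^sub>L n) o\<^sub>L R)"
    using R(2) nD by (rule blinfun_inverses_perturb)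
  moreover have "t *\<^sub>R id_blinfun - K - ?D = s *\<^sub>R id_blinfun - K"
    by (simp add: scaleR_left_diff_distrib)
  moreover have "norm (R o\<^sub>L ?D) < 1"
    using nD norm_blinfun_compose[of R ?D] by (simp add: mult.commute)
  then have "0 \<le> (\<Sum>n. (R o\<^sub>L ?D) ^\<^sub>L n)"
    using R(1) s by (intro suminf_power_nonneg summable_norm_power_lt_1 blinfun_nonneg_compose
        blinfun_nonneg_scaleR) auto
  ultimately show ?thesis
    using s R(1) unfolding pos_resolvent_set_def
    by (auto intro!: exI[of _ "(\<Sum>n. (R o\<^sub>L ?D) ^\<^sub>L n) o\<^sub>L R"] blinfun_nonneg_compose)
qed

text \<open>As \<open>t\<close> decreases to the left end \<open>\<rho>\<close> of the positive resolvent set, the norm of the resolvent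
  tends to infinity, since \<open>\<rho>\<close> would otherwise not be an end. The normalised resolvents \<open>A\<close> then
  satisfy \<open>(\<rho> - K) A \<longlonglongrightarrow> 0\<close>, hence \<open>K A K - \<rho>\<^sup>2 A \<longlonglongrightarrow> 0\<close>, and compactness of
  \<open>A \<mapsto> K A K\<close> gives a limit point \<open>Q\<close> of norm \<open>1\<close>.\<close>

theorem krein_rutman_operator:
  fixes K :: "'a::banach_lattice \<Rightarrow>\<^sub>L 'a"
  assumes K: "0 \<le> K" and cK: "compact_operator K" and pos: "0 < pos_radius K"
  defines "\<rho> \<equiv> pos_radius K"
  shows "\<exists>Q. 0 \<le> Q \<and> Q \<noteq> 0 \<and> K o\<^sub>L Q = \<rho> *\<^sub>R Q \<and> Q o\<^sub>L K = \<rho> *\<^sub>R Q"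
proof -
  have \<rho>: "0 < \<rho>"
    using pos by (simp add: \<rho>_def)
  have ne: "pos_resolvent_set K \<noteq> {}"
    using pos_resolvent_set_large[OF K, of "norm K + 1"] by auto
  have bdd: "bdd_below (pos_resolvent_set K)"
    by (rule bdd_belowI[of _ 0]) (auto simp: pos_resolvent_set_def)
  have "\<exists>t R. t < \<rho> + 1 / Suc k \<and> \<rho> \<le> t \<and> 0 \<le> R \<and> blinfun_inverses (t *\<^sub>R id_blinfun - K) R" for k
  proof -
    have "Inf (pos_resolvent_set K) < \<rho> + 1 / Suc k"
      by (simp add: \<rho>_def)
    then obtain t where "t \<in> pos_resolvent_set K" "t < \<rho> + 1 / Suc k"
      using cInf_lessD[OF ne] by blast
    then show ?thesis
      using cInf_lower[OF _ bdd, of t] by (auto simp: pos_resolvent_set_def \<rho>_def)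
  qed
  then obtain t R where t: "\<And>k. t k < \<rho> + 1 / Suc k" "\<And>k. \<rho> \<le> t k"
    and R: "\<And>k. 0 \<le> R k" "\<And>k. blinfun_inverses (t k *\<^sub>R id_blinfun - K) (R k)"
    by metis
  have tlim: "(\<lambda>k. t k - \<rho>) \<longlonglongrightarrow> 0"
  proof (rule tendsto_sandwich[OF _ _ tendsto_const LIMSEQ_inverse_real_of_nat])
    show "\<forall>\<^sub>F k in sequentially. 0 \<le> t k - \<rho>"
      using t by auto
    show "\<forall>\<^sub>F k in sequentially. t k - \<rho> \<le> inverse (real (Suc k))"
      using less_imp_le[OF t(1)] by (intro always_eventually allI) (simp add: field_simps)
  qed
  have big: "1 \<le> (t k - \<rho>) * norm (R k)" for k
  proof (rule ccontr)
    assume "\<not> ?thesis"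
    then have less: "(t k - \<rho>) * norm (R k) < 1" by simp
    define d where "d = min (\<rho> / 2) ((1 - (t k - \<rho>) * norm (R k)) / (2 * (norm (R k) + 1)))"
    have d: "0 < d"
      using \<rho> less by (auto simp: d_def add_nonneg_pos)
    have d2: "d \<le> \<rho> / 2"
      by (simp only: d_def min.cobounded1)
    have "d * norm (R k) \<le> (1 - (t k - \<rho>) * norm (R k)) / (2 * (norm (R k) + 1)) * norm (R k)"
      unfolding d_def by (rule mult_right_mono) auto
    also have "\<dots> = (1 - (t k - \<rho>) * norm (R k)) * (norm (R k) / (2 * (norm (R k) + 1)))"
      by simp
    also have "\<dots> < (1 - (t k - \<rho>) * norm (R k)) * 1"
    proof (rule mult_strict_left_mono)
      have "a / (2 * (a + 1)) < 1" if "0 \<le> a" for a :: real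
        using that by (simp add: divide_less_eq)
      then show "norm (R k) / (2 * (norm (R k) + 1)) < 1"
        using norm_ge_zero by blast
    qed (use less in simp)
    finally have "(t k - (\<rho> - d)) * norm (R k) < 1"
      by (simp add: algebra_simps)
    then have "\<rho> - d \<in> pos_resolvent_set K"
      using d d2 t(2)[of k] \<rho> by (intro pos_resolvent_set_lower[OF R]) auto
    then have "\<rho> \<le> \<rho> - d"
      unfolding \<rho>_def by (rule cInf_lower[OF _ bdd])
    then show False using d by simp
  qed
  then have Rpos: "0 < norm (R k)" for k
    by (metis less_eq_real_def mult_zero_right not_one_le_zero norm_ge_zero)
  have Rinv: "1 / norm (R k) \<le> t k - \<rho>" for k
    using big[of k] Rpos[of k] by (simp add: divide_le_eq)
  have Rlim: "(\<lambda>k. 1 / norm (R k)) \<longlonglongrightarrow> 0"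
    using Rinv by (intro tendsto_sandwich[OF _ _ tendsto_const tlim]) auto
  define A where "A k = (1 / norm (R k)) *\<^sub>R R k" for k
  have nA: "norm (A k) = 1" for k
    using Rpos[of k] by (simp add: A_def)
  have left: "(t k *\<^sub>R id_blinfun - K) o\<^sub>L A k = (1 / norm (R k)) *\<^sub>R id_blinfun"
    and right: "A k o\<^sub>L (t k *\<^sub>R id_blinfun - K) = (1 / norm (R k)) *\<^sub>R id_blinfun" for k
    using blinfun_inverses_apply[OF R(2)[of k]]
    by (auto intro!: blinfun_eqI simp: A_def blinfun.scaleR_left blinfun.scaleR_right)
  define L where "L k = (t k - \<rho>) *\<^sub>R A k - (1 / norm (R k)) *\<^sub>R id_blinfun" for k
  have KA: "K o\<^sub>L A k = \<rho> *\<^sub>R A k + L k" for k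
  proof (rule blinfun_eqI)
    fix x
    show "(K o\<^sub>L A k) x = (\<rho> *\<^sub>R A k + L k) x"
      using arg_cong[OF left[of k], of "\<lambda>T. T x"]
      by (simp add: L_def blinfun.diff_left blinfun.add_left blinfun.scaleR_left algebra_simps)
  qed
  have AK: "A k o\<^sub>L K = \<rho> *\<^sub>R A k + L k" for k
  proof (rule blinfun_eqI)
    fix x
    show "(A k o\<^sub>L K) x = (\<rho> *\<^sub>R A k + L k) x"
      using arg_cong[OF right[of k], of "\<lambda>T. T x"]
      by (simp add: L_def blinfun.diff_left blinfun.diff_right blinfun.add_left
          blinfun.scaleR_left blinfun.scaleR_right algebra_simps)
  qed
  have "norm (L k) \<le> (t k - \<rho>) + 1 / norm (R k)" for k
  proof -
    have "norm (L k) \<le> norm ((t k - \<rho>) *\<^sub>R A k) + norm ((1 / norm (R k)) *\<^sub>R (id_blinfun :: 'a \<Rightarrow>\<^sub>L 'a))"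
      unfolding L_def by (rule norm_triangle_ineq4)
    also have "\<dots> \<le> (t k - \<rho>) + (1 / norm (R k)) * 1"
      using t(2)[of k] nA[of k] norm_blinfun_id_le
      by (intro add_mono) (auto intro: divide_right_mono)
    finally show ?thesis by simp
  qed
  then have Llim: "L \<longlonglongrightarrow> 0"
    using tendsto_add[OF tlim Rlim] by (intro Lim_null_comparison[of L]) auto
  obtain Q' r where r: "strict_mono (r :: nat \<Rightarrow> nat)" "(\<lambda>n. K o\<^sub>L A (r n) o\<^sub>L K) \<longlonglongrightarrow> Q'"
    using compact_sandwich_subseq[OF cK cK, of A 1] nA by (metis order_refl)
  have Lr: "(\<lambda>n. L (r n)) \<longlonglongrightarrow> 0"
    using LIMSEQ_subseq_LIMSEQ[OF Llim r(1)] by (simp add: o_def)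
  define Q where "Q = (1 / \<rho>\<^sup>2) *\<^sub>R (Q' - (\<rho> *\<^sub>R 0 + (K o\<^sub>L 0)))"
  have Aeq: "A k = (1 / \<rho>\<^sup>2) *\<^sub>R ((K o\<^sub>L A k o\<^sub>L K) - (\<rho> *\<^sub>R L k + (K o\<^sub>L L k)))" for k
  proof (rule blinfun_eqI)
    fix x
    have "K (A k (K x)) = \<rho> *\<^sub>R K (A k x) + K (L k x)"
      using arg_cong[OF AK[of k], of "\<lambda>T. K (T x)"]
      by (simp add: blinfun.add_left blinfun.scaleR_left blinfun.add_right blinfun.scaleR_right)
    also have "K (A k x) = \<rho> *\<^sub>R A k x + L k x"
      using arg_cong[OF KA[of k], of "\<lambda>T. T x"] by (simp add: blinfun.add_left blinfun.scaleR_left)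
    finally show "A k x = ((1 / \<rho>\<^sup>2) *\<^sub>R ((K o\<^sub>L A k o\<^sub>L K) - (\<rho> *\<^sub>R L k + (K o\<^sub>L L k)))) x"
      using \<rho> by (simp add: blinfun.add_left blinfun.scaleR_left blinfun.diff_left
          scaleR_right_distrib power2_eq_square)
  qed
  have "(\<lambda>n. (1 / \<rho>\<^sup>2) *\<^sub>R ((K o\<^sub>L A (r n) o\<^sub>L K) - (\<rho> *\<^sub>R L (r n) + (K o\<^sub>L L (r n))))) \<longlonglongrightarrow> Q"
    unfolding Q_def by (intro tendsto_intros r Lr)
  then have Alim: "(\<lambda>n. A (r n)) \<longlonglongrightarrow> Q"
    by (simp only: Aeq[symmetric])
  have "0 \<le> A k" for k
    unfolding A_def by (intro blinfun_nonneg_scaleR R) simp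
  then have "0 \<le> Q"
    by (intro blinfun_nonneg_limit[OF Alim])
  moreover have "norm Q = 1"
    using tendsto_norm[OF Alim] by (simp add: nA LIMSEQ_const_iff)
  then have "Q \<noteq> 0" by auto
  moreover have rhs: "(\<lambda>n. \<rho> *\<^sub>R A (r n) + L (r n)) \<longlonglongrightarrow> \<rho> *\<^sub>R Q + 0"
    by (intro tendsto_intros Alim Lr)
  have "(\<lambda>n. K o\<^sub>L A (r n)) \<longlonglongrightarrow> (K o\<^sub>L Q)" "(\<lambda>n. A (r n) o\<^sub>L K) \<longlonglongrightarrow> (Q o\<^sub>L K)"
    by (intro tendsto_intros Alim)+
  then have "K o\<^sub>L Q = \<rho> *\<^sub>R Q" "Q o\<^sub>L K = \<rho> *\<^sub>R Q"
    using LIMSEQ_unique[OF _ rhs] unfolding KA AK by fastforce+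
  ultimately show ?thesis by blast
qed

text \<open>Each nonzero value \<open>Q y\<close> with \<open>y \<ge> 0\<close> is an eigenvector, and composing \<open>Q\<close> with a positive functional
  that does not vanish there gives an eigenfunctional for the same eigenvalue, without
  any compactness argument in the dual space.\<close>

corollary krein_rutman:
  fixes K :: "'a::banach_lattice \<Rightarrow>\<^sub>L 'a"
  assumes "0 \<le> K" "compact_operator K" "0 < pos_radius K"
  obtains x and f :: "'a \<Rightarrow>\<^sub>L real"
  where "0 < x" "K x = pos_radius K *\<^sub>R x" "0 < f" "f o\<^sub>L K = pos_radius K *\<^sub>R f"
proof -
  obtain Q where Q: "0 \<le> Q" "Q \<noteq> 0" "K o\<^sub>L Q = pos_radius K *\<^sub>R Q" "Q o\<^sub>L K = pos_radius K *\<^sub>R Q"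
    using krein_rutman_operator[OF assms] by blast
  have "\<exists>y\<ge>0. Q y \<noteq> 0"
  proof (rule ccontr)
    assume *: "\<not> ?thesis"
    have "Q \<le> 0" "0 \<le> Q"
      using * Q(1) by (auto simp: less_eq_blinfun_def)
    then show False using Q(2) by (simp add: antisym)
  qed
  then obtain y where y: "0 \<le> y" "Q y \<noteq> 0" by blast
  then have Qy: "0 < Q y"
    using Q(1) by (simp add: blinfun_nonneg_apply less_le)
  then obtain g :: "'a \<Rightarrow>\<^sub>L real" where g: "0 \<le> g" "0 < g (Q y)"
    using exists_positive_functional by blast
  show ?thesis
  proof (rule that[of "Q y" "g o\<^sub>L Q"])
    show "0 < Q y" by fact
    show "K (Q y) = pos_radius K *\<^sub>R Q y"
      using arg_cong[OF Q(3), of "\<lambda>T. T y"] by (simp add: blinfun.scaleR_left)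
    have "(g o\<^sub>L Q) y \<noteq> 0"
      using g by simp
    then have "g o\<^sub>L Q \<noteq> 0"
      by (metis blinfun.zero_left)
    then show "0 < g o\<^sub>L Q"
      using g(1) Q(1) by (simp add: less_le blinfun_nonneg_compose)
    show "g o\<^sub>L Q o\<^sub>L K = pos_radius K *\<^sub>R (g o\<^sub>L Q)"
    proof (rule blinfun_eqI)
      fix x
      show "(g o\<^sub>L Q o\<^sub>L K) x = (pos_radius K *\<^sub>R (g o\<^sub>L Q)) x"
        using arg_cong[OF Q(4), of "\<lambda>T. g (T x)"] by (simp add: blinfun.scaleR_left blinfun.scaleR_right)
    qed
  qed
qed

section \<open>Complexification and spectrum\<close>

lemma complexify_apply [simp]: "complexify T v = (T (fst v), T (snd v))"
  by transfer (simp add: case_prod_beta)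

lemma cscale_apply [simp]:
  "cscale z v = (Re z *\<^sub>R fst v - Im z *\<^sub>R snd v, Im z *\<^sub>R fst v + Re z *\<^sub>R snd v)"
  by transfer (simp add: case_prod_beta)

lemma complexify_compose: "complexify (S o\<^sub>L T) = complexify S o\<^sub>L complexify T"
  by (rule blinfun_eqI) simp

lemma complexify_diff: "complexify (S - T) = complexify S - complexify T"
  by (rule blinfun_eqI) (simp add: blinfun.diff_left)

lemma complexify_id [simp]: "complexify id_blinfun = id_blinfun"
  by (rule blinfun_eqI) simp

lemma complexify_power: "complexify (T ^\<^sub>L n) = complexify T ^\<^sub>L n"
  by (induction n) (simp_all add: complexify_compose)

lemma cscale_mult: "cscale (z * w) = cscale z o\<^sub>L cscale w"
  by (rule blinfun_eqI) (simp add: algebra_simps)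

lemma cscale_add: "cscale (z + w) = cscale z + cscale w"
  by (rule blinfun_eqI) (simp add: algebra_simps blinfun.add_left)

lemma cscale_diff: "cscale (z - w) = cscale z - cscale w"
  by (rule blinfun_eqI) (simp add: algebra_simps blinfun.diff_left)

lemma cscale_1 [simp]: "cscale 1 = id_blinfun"
  by (rule blinfun_eqI) simp

lemma cscale_0 [simp]: "cscale 0 = 0"
  by (rule blinfun_eqI) (simp add: zero_prod_def)

lemma cscale_complexify: "cscale z (complexify T v) = complexify T (cscale z v)"
  by (simp add: blinfun.add_right blinfun.diff_right blinfun.scaleR_right)

lemma cscale_inverse: "z \<noteq> 0 \<Longrightarrow> blinfun_inverses (cscale z) (cscale (1 / z))"
  by (simp add: blinfun_inverses_def flip: cscale_mult)

lemma norm_complexify: "norm (complexify T) \<le> norm T"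
proof (rule norm_blinfun_bound)
  fix v :: "'a \<times> 'a"
  have "(norm (T (fst v)))\<^sup>2 + (norm (T (snd v)))\<^sup>2 \<le> (norm T * norm (fst v))\<^sup>2 + (norm T * norm (snd v))\<^sup>2"
    by (intro add_mono power_mono norm_blinfun norm_ge_zero)
  also have "\<dots> = (norm T)\<^sup>2 * ((norm (fst v))\<^sup>2 + (norm (snd v))\<^sup>2)"
    by (simp add: algebra_simps)
  finally have "norm (complexify T v) \<le> sqrt ((norm T)\<^sup>2 * ((norm (fst v))\<^sup>2 + (norm (snd v))\<^sup>2))"
    by (simp add: norm_prod_def)
  then show "norm (complexify T v) \<le> norm T * norm v"
    by (simp add: real_sqrt_mult norm_prod_def)
qed simp

lemma norm_cscale: "norm (cscale z) \<le> 2 * cmod z"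
proof (rule norm_blinfun_bound)
  fix v :: "'a::real_normed_vector \<times> 'a"
  have "cscale z v = Re z *\<^sub>R v + Im z *\<^sub>R (- snd v, fst v)"
    by (cases v) simp
  also have "norm \<dots> \<le> \<bar>Re z\<bar> * norm v + \<bar>Im z\<bar> * norm (- snd v, fst v)"
    by (metis norm_scaleR norm_triangle_ineq)
  also have "norm (- snd v, fst v) = norm v"
    by (simp add: norm_prod_def add.commute)
  also have "\<bar>Re z\<bar> * norm v + \<bar>Im z\<bar> * norm v \<le> cmod z * norm v + cmod z * norm v"
    by (intro add_mono mult_right_mono abs_Re_le_cmod abs_Im_le_cmod norm_ge_zero)
  finally show "norm (cscale z v) \<le> 2 * cmod z * norm v" by simp
qed simp

lemma bounded_linear_cscale: "bounded_linear (cscale :: complex \<Rightarrow> ('a::real_normed_vector \<times> 'a) \<Rightarrow>\<^sub>L _)"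
proof (rule bounded_linear_intro)
  show "cscale (x + y) = cscale x + (cscale y :: ('a \<times> 'a) \<Rightarrow>\<^sub>L _)" for x y
    by (rule cscale_add)
  show "cscale (r *\<^sub>R x) = r *\<^sub>R (cscale x :: ('a \<times> 'a) \<Rightarrow>\<^sub>L _)" for r x
    by (rule blinfun_eqI) (simp add: blinfun.scaleR_left algebra_simps)
  show "norm (cscale x :: ('a \<times> 'a) \<Rightarrow>\<^sub>L _) \<le> norm x * 2" for x
    using norm_cscale by (metis mult.commute)
qed

lemma cscale_complexify_power: "(cscale c o\<^sub>L complexify T) ^\<^sub>L n = cscale (c ^ n) o\<^sub>L complexify (T ^\<^sub>L n)"
proof (induction n)
  case 0
  then show ?case by (auto intro!: blinfun_eqI)
next
  case (Suc n)
  show ?case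
    by (rule blinfun_eqI)
      (simp only: Suc blinfun_power.simps blinfun_apply_blinfun_compose complexify_compose power_Suc
        cscale_mult cscale_complexify)
qed

text \<open>The Neumann series for \<open>(z - T)\<inverse>\<close> converges outside each disc whose radius bounds the
  growth of the powers of \<open>T\<close>.\<close>

lemma neumann_outside_disc:
  fixes T :: "'a::banach \<Rightarrow>\<^sub>L 'a"
  assumes growth: "\<And>n. norm (T ^\<^sub>L n) \<le> C * t ^ n" and t: "0 \<le> t" "t < cmod z"
  shows "\<exists>B. blinfun_inverses (cscale z - complexify T) B"
    and "\<exists>B. blinfun_inverses (id_blinfun - (cscale (1 / z) o\<^sub>L complexify T)) B"
proof -
  have z: "z \<noteq> 0" using t by auto
  let ?A = "cscale (1 / z) o\<^sub>L complexify T"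
  have "norm (?A ^\<^sub>L n) \<le> 2 * C * (t / cmod z) ^ n" for n
  proof -
    have "norm (?A ^\<^sub>L n) \<le> norm (cscale ((1 / z) ^ n) :: ('a \<times> 'a) \<Rightarrow>\<^sub>L _) * norm (complexify (T ^\<^sub>L n))"
      unfolding cscale_complexify_power by (rule norm_blinfun_compose)
    also have "\<dots> \<le> (2 * cmod ((1 / z) ^ n)) * (C * t ^ n)"
      by (intro mult_mono norm_cscale order_trans[OF norm_complexify growth]) auto
    finally show ?thesis
      by (simp add: norm_power norm_divide power_divide)
  qed
  moreover have "summable (\<lambda>n. 2 * C * (t / cmod z) ^ n)"
    using t by (intro summable_mult summable_geometric) (auto simp: divide_less_eq)
  ultimately have "summable (\<lambda>n. norm (?A ^\<^sub>L n))"
    using summable_comparison_test'[of "\<lambda>n. 2 * C * (t / cmod z) ^ n" 0 "\<lambda>n. norm (?A ^\<^sub>L n)"] by auto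
  then obtain B where B: "blinfun_inverses (id_blinfun - ?A) B"
    using neumann_series by blast
  then show "\<exists>B. blinfun_inverses (id_blinfun - ?A) B" by blast
  have "blinfun_inverses (cscale z o\<^sub>L (id_blinfun - ?A)) (B o\<^sub>L cscale (1 / z))"
    using cscale_inverse[OF z] B by (rule blinfun_inverses_compose)
  moreover have "cscale z o\<^sub>L (id_blinfun - ?A) = cscale z - complexify T"
  proof (rule blinfun_eqI)
    fix v
    have "cscale z (cscale (1 / z) (complexify T v)) = complexify T v"
      using blinfun_inverses_apply(1)[OF cscale_inverse[OF z]] .
    then show "(cscale z o\<^sub>L (id_blinfun - ?A)) v = (cscale z - complexify T) v"
      by (simp only: blinfun_apply_blinfun_compose blinfun.diff_left blinfun.diff_right
          blinfun_apply_id_blinfun)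
  qed
  ultimately show "\<exists>B. blinfun_inverses (cscale z - complexify T) B" by auto
qed

lemma spectrum_subset_cball:
  fixes T :: "'a::banach \<Rightarrow>\<^sub>L 'a"
  assumes "\<And>n. norm (T ^\<^sub>L n) \<le> C * t ^ n" "0 \<le> t"
  shows "spectrum T \<subseteq> cball 0 t"
proof
  fix z assume "z \<in> spectrum T"
  then have "\<not> t < cmod z"
    using neumann_outside_disc(1)[OF assms] by (auto simp: spectrum_def)
  then show "z \<in> cball 0 t" by simp
qed

lemma eigenvalue_in_spectrum:
  assumes "complexify T v = cscale z v" "v \<noteq> 0" shows "z \<in> spectrum T"
proof (rule ccontr)
  assume "z \<notin> spectrum T"
  then obtain B where "blinfun_inverses (cscale z - complexify T) B"
    by (auto simp: spectrum_def)
  from blinfun_inverses_apply(2)[OF this, of v] have "v = 0"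
    by (simp only: blinfun.diff_left assms(1) diff_self blinfun.zero_right)
  then show False using assms(2) by simp
qed

text \<open>The definition of the spectral radius as a supremum gives information only if the spectrum
  is not empty. If \<open>pos_radius K > 0\<close> it is an eigenvalue. Otherwise the powers of \<open>K\<close>
  decay faster than any geometric sequence, which is impossible for an invertible operator, so
  that \<open>0\<close> is in the spectrum.\<close>

lemma spectral_radius_eq_pos_radius:
  fixes K :: "'a::banach_lattice \<Rightarrow>\<^sub>L 'a"
  assumes K: "0 \<le> K" "K \<noteq> 0" and cK: "compact_operator K"
  shows "spectral_radius K = pos_radius K"
proof -
  define \<rho> where "\<rho> = pos_radius K"
  have ne: "pos_resolvent_set K \<noteq> {}"
    using pos_resolvent_set_large[OF K(1), of "norm K + 1"] by auto
  have \<rho>0: "0 \<le> \<rho>"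
    unfolding \<rho>_def using ne by (intro cInf_greatest) (auto simp: pos_resolvent_set_def)
  have sub: "spectrum K \<subseteq> cball 0 t" if "t \<in> pos_resolvent_set K" for t
    using pos_resolvent_growth[OF K(1) that] that spectrum_subset_cball[of K _ t]
    by (auto simp: pos_resolvent_set_def)
  have le: "cmod z \<le> \<rho>" if "z \<in> spectrum K" for z
    unfolding \<rho>_def using sub that ne by (intro cInf_greatest) force+
  have mem: "of_real \<rho> \<in> spectrum K"
  proof (cases "\<rho> > 0")
    case True
    then obtain x where x: "0 < x" "K x = \<rho> *\<^sub>R x"
      using krein_rutman[OF K(1) cK] unfolding \<rho>_def by blast
    then show ?thesis
      by (intro eigenvalue_in_spectrum[of _ "(x, 0)"]) (auto simp: zero_prod_def)
  next
    case False
    with \<rho>0 have \<rho>: "\<rho> = 0" by simp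
    show ?thesis
    proof (rule ccontr)
      assume "\<not> ?thesis"
      then obtain B where B: "blinfun_inverses (- complexify K) B"
        by (auto simp: spectrum_def \<rho>)
      define b where "b = norm B + 1"
      have b: "0 < b" "norm B < b"
        using norm_ge_zero[of B] by (auto simp: b_def add_nonneg_pos)
      have "Inf (pos_resolvent_set K) < 1 / (2 * b)"
        using b \<rho> by (simp add: \<rho>_def)
      then obtain t where t: "t \<in> pos_resolvent_set K" "t < 1 / (2 * b)"
        using cInf_lessD[OF ne] by blast
      have t0: "0 < t" using t(1) by (simp add: pos_resolvent_set_def)
      obtain C where C: "0 \<le> C" "\<And>n. norm (K ^\<^sub>L n) \<le> C * t ^ n"
        using pos_resolvent_growth[OF K(1) t(1)] by blast
      obtain x where x: "K x \<noteq> 0"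
        using K(2) by (metis blinfun.zero_left blinfun_eqI)
      have xne: "norm x > 0" using x by auto
      have Binv: "B (complexify K v) = - v" for v
        using blinfun_inverses_apply(2)[OF B, of "v"]
        by (simp add: blinfun.minus_left blinfun.minus_right del: complexify_apply)
          (metis minus_minus)
      have step: "norm x \<le> b ^ n * norm (complexify (K ^\<^sub>L n) (x, 0))" for n
      proof (induction n)
        case 0
        then show ?case by simp
      next
        case (Suc n)
        have "norm (complexify (K ^\<^sub>L n) (x, 0)) = norm (B (complexify K (complexify (K ^\<^sub>L n) (x, 0))))"
          by (simp only: Binv norm_minus_cancel)
        also have "\<dots> \<le> b * norm (complexify K (complexify (K ^\<^sub>L n) (x, 0)))"
          using b by (intro order_trans[OF norm_blinfun] mult_right_mono) auto
        also have "complexify K (complexify (K ^\<^sub>L n) (x, 0)) = complexify (K ^\<^sub>L Suc n) (x, 0)"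
          by simp
        finally have "b ^ n * norm (complexify (K ^\<^sub>L n) (x, 0))
            \<le> b ^ n * (b * norm (complexify (K ^\<^sub>L Suc n) (x, 0)))"
          using b by (intro mult_left_mono) auto
        then show ?case
          using Suc by (simp add: mult_ac del: complexify_apply)
      qed
      have "norm x \<le> C * norm x * (1 / 2) ^ n" for n
      proof -
        have "norm (complexify (K ^\<^sub>L n) (x, 0)) \<le> (C * t ^ n) * norm x"
          by (simp add: norm_prod_def) (metis C(2) mult_right_mono norm_blinfun norm_ge_zero order_trans)
        then have "norm x \<le> b ^ n * ((C * t ^ n) * norm x)"
          using b by (intro order_trans[OF step[of n]] mult_left_mono) auto
        also have "\<dots> = C * norm x * (b * t) ^ n"
          by (simp add: power_mult_distrib)
        also have "\<dots> \<le> C * norm x * (1 / 2) ^ n"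
          using C(1) b t0 t(2) by (intro mult_left_mono power_mono) (auto simp: field_simps)
        finally show ?thesis .
      qed
      moreover have "(\<lambda>n. C * norm x * (1 / 2) ^ n) \<longlonglongrightarrow> C * norm x * 0"
        by (intro tendsto_intros LIMSEQ_power_zero) simp
      ultimately have "norm x \<le> C * norm x * 0"
        by (intro LIMSEQ_le_const) auto
      then show False using xne by simp
    qed
  qed
  show ?thesis
    unfolding spectral_radius_def \<rho>_def[symmetric]
  proof (rule antisym)
    show "(SUP z\<in>spectrum K. cmod z) \<le> \<rho>"
      using mem le by (intro cSUP_least) auto
    show "\<rho> \<le> (SUP z\<in>spectrum K. cmod z)"
      using mem le \<rho>0 by (intro cSUP_upper2[where x = "of_real \<rho>"] bdd_aboveI2[where M = \<rho>]) auto
  qed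
qed

section \<open>Irreducibility\<close>

text \<open>The common properties of \<open>[K\<rangle>\<close> and \<open>\<langle>K]\<close> from which irreducibility is exploited.\<close>

definition semi_commuting_cone ::
    "('a::banach_lattice \<Rightarrow>\<^sub>L 'a) \<Rightarrow> ('a \<Rightarrow>\<^sub>L 'a) set \<Rightarrow> bool" where
  "semi_commuting_cone K C \<longleftrightarrow>
     (\<forall>S\<in>C. 0 \<le> S) \<and> id_blinfun \<in> C \<and> (\<forall>S\<in>C. \<forall>T\<in>C. S o\<^sub>L T \<in> C \<and> S + T \<in> C) \<and>
     (\<forall>c\<ge>0. \<forall>S\<in>C. c *\<^sub>R S \<in> C) \<and>
     ((\<forall>S\<in>C. (K o\<^sub>L S) \<le> (S o\<^sub>L K)) \<or> (\<forall>S\<in>C. (S o\<^sub>L K) \<le> (K o\<^sub>L S)))"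

lemma semi_commuting_cone_super_right:
  fixes K :: "'a::banach_lattice \<Rightarrow>\<^sub>L 'a"
  shows "semi_commuting_cone K (super_right_commutant K)"
proof -
  have comp: "(K o\<^sub>L (S o\<^sub>L T)) \<le> (S o\<^sub>L T o\<^sub>L K)"
    if "0 \<le> S" "0 \<le> T" "(K o\<^sub>L S) \<le> (S o\<^sub>L K)" "(K o\<^sub>L T) \<le> (T o\<^sub>L K)" for S T
    unfolding less_eq_blinfun_def
  proof (intro allI impI)
    fix x :: 'a assume x: "0 \<le> x"
    have "K (S (T x)) \<le> S (K (T x))"
      using blinfun_le_apply[OF that(3) blinfun_nonneg_apply[OF that(2) x]] by simp
    also have "\<dots> \<le> S (T (K x))"
      using blinfun_nonneg_mono[OF that(1)] blinfun_le_apply[OF that(4) x] by simp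
    finally show "(K o\<^sub>L (S o\<^sub>L T)) x \<le> (S o\<^sub>L T o\<^sub>L K) x" by simp
  qed
  then show ?thesis
    unfolding semi_commuting_cone_def super_right_commutant_def
    by (auto simp: blinfun_nonneg_compose blinfun_nonneg_add blinfun_nonneg_scaleR less_eq_blinfun_def
        blinfun.add_left blinfun.add_right blinfun.scaleR_left blinfun.scaleR_right
        intro: add_mono scaleR_left_mono scaleR_nonneg_nonneg)
qed

lemma semi_commuting_cone_super_left:
  fixes K :: "'a::banach_lattice \<Rightarrow>\<^sub>L 'a"
  shows "semi_commuting_cone K (super_left_commutant K)"
proof -
  have comp: "(S o\<^sub>L T o\<^sub>L K) \<le> (K o\<^sub>L (S o\<^sub>L T))"
    if "0 \<le> S" "0 \<le> T" "(S o\<^sub>L K) \<le> (K o\<^sub>L S)" "(T o\<^sub>L K) \<le> (K o\<^sub>L T)" for S T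
    unfolding less_eq_blinfun_def
  proof (intro allI impI)
    fix x :: 'a assume x: "0 \<le> x"
    have "S (T (K x)) \<le> S (K (T x))"
      using blinfun_nonneg_mono[OF that(1)] blinfun_le_apply[OF that(4) x] by simp
    also have "\<dots> \<le> K (S (T x))"
      using blinfun_le_apply[OF that(3) blinfun_nonneg_apply[OF that(2) x]] by simp
    finally show "(S o\<^sub>L T o\<^sub>L K) x \<le> (K o\<^sub>L (S o\<^sub>L T)) x" by simp
  qed
  then show ?thesis
    unfolding semi_commuting_cone_def super_left_commutant_def
    by (auto simp: blinfun_nonneg_compose blinfun_nonneg_add blinfun_nonneg_scaleR less_eq_blinfun_def
        blinfun.add_left blinfun.add_right blinfun.scaleR_left blinfun.scaleR_right
        intro: add_mono scaleR_left_mono scaleR_nonneg_nonneg)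
qed

text \<open>A positive operator that vanishes at \<open>y \<ge> 0\<close> vanishes on the whole ideal generated by \<open>y\<close>.\<close>

lemma nonneg_blinfun_zero_if_dense:
  fixes D :: "'a::banach_lattice \<Rightarrow>\<^sub>L 'b::banach_lattice"
  assumes D: "0 \<le> D" and dense: "closure {z. \<exists>y\<in>Y. \<bar>z\<bar> \<le> y} = UNIV" and zero: "\<And>y. y \<in> Y \<Longrightarrow> D y = 0"
  shows "D = 0"
proof (rule blinfun_eqI)
  fix x
  have "D z = 0" if "\<bar>z\<bar> \<le> y" "y \<in> Y" for y z
  proof -
    have "\<bar>D z\<bar> \<le> D \<bar>z\<bar>"
      by (rule blinfun_nonneg_abs[OF D])
    also have "\<dots> \<le> 0"
      using blinfun_nonneg_mono[OF D that(1)] zero[OF that(2)] by simp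
    finally show ?thesis by simp
  qed
  moreover obtain u where u: "\<And>n. u n \<in> {z. \<exists>y\<in>Y. \<bar>z\<bar> \<le> y}" "u \<longlonglongrightarrow> x"
    using dense by (metis (no_types, lifting) UNIV_I closure_sequential)
  ultimately have "D (u n) = 0" for n
    by blast
  moreover have "(\<lambda>n. D (u n)) \<longlonglongrightarrow> D x"
    by (intro blinfun.tendsto tendsto_const u)
  ultimately show "D x = (0 :: 'a \<Rightarrow>\<^sub>L 'b) x"
    by (simp add: LIMSEQ_const_iff)
qed

text \<open>Let \<open>x\<close> and \<open>f\<close> be positive and fixed by \<open>K\<close>. The ideal generated by the vectors \<open>T x\<close>
  with \<open>T \<in> C\<close> and the common null ideal of the functionals \<open>f S\<close> with \<open>S \<in> C\<close> are invariant under
  \<open>C\<close>, so the first is dense and the second is trivial. Semi-commutation makes \<open>y = T x\<close> a sub- or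
  superharmonic vector and \<open>g = f S\<close> a functional with the opposite property, so that \<open>g (K y - y) = 0\<close>
  for all these \<open>g\<close> and \<open>y\<close>, and density turns both inequalities into equalities.\<close>

lemma irreducible_fixed_vectors:
  fixes K :: "'a::banach_lattice \<Rightarrow>\<^sub>L 'a" and f :: "'a \<Rightarrow>\<^sub>L real"
  assumes C: "semi_commuting_cone K C" and irr: "ideal_irreducible C"
    and x: "0 < x" "K x = x" and f: "0 < f" "f o\<^sub>L K = f"
  shows "closure {z. \<exists>y\<in>(\<lambda>T. blinfun_apply T x) ` C. \<bar>z\<bar> \<le> y} = UNIV" (is ?dense)
    and "\<And>z. 0 \<le> z \<Longrightarrow> (\<And>S. S \<in> C \<Longrightarrow> (f o\<^sub>L S) z = 0) \<Longrightarrow> z = 0"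
    and "\<And>T. T \<in> C \<Longrightarrow> K (blinfun_apply T x) = T x"
    and "\<And>S. S \<in> C \<Longrightarrow> f o\<^sub>L S o\<^sub>L K = f o\<^sub>L S"
proof -
  have pos: "\<And>S. S \<in> C \<Longrightarrow> 0 \<le> S" and id: "id_blinfun \<in> C"
    and comp: "\<And>S T. S \<in> C \<Longrightarrow> T \<in> C \<Longrightarrow> S o\<^sub>L T \<in> C"
    and add: "\<And>S T. S \<in> C \<Longrightarrow> T \<in> C \<Longrightarrow> S + T \<in> C"
    and scale: "\<And>c S. 0 \<le> c \<Longrightarrow> S \<in> C \<Longrightarrow> c *\<^sub>R S \<in> C"
    and comm: "(\<forall>S\<in>C. (K o\<^sub>L S) \<le> (S o\<^sub>L K)) \<or> (\<forall>S\<in>C. (S o\<^sub>L K) \<le> (K o\<^sub>L S))"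
    using C unfolding semi_commuting_cone_def by blast+
  have f0: "0 \<le> f" and fK: "f (K z) = f z" for z
    using f(1) arg_cong[OF f(2), of "\<lambda>T. T z"] by simp_all
  have trivial: "J = {0} \<or> J = UNIV"
    if "lattice_ideal J" "closed J" "\<And>T z. T \<in> C \<Longrightarrow> z \<in> J \<Longrightarrow> blinfun_apply T z \<in> J" for J
    using irr that unfolding ideal_irreducible_def by blast

  define I where "I = {z. \<exists>T\<in>C. \<bar>z\<bar> \<le> blinfun_apply T x}"
  have I: "lattice_ideal I"
    unfolding lattice_ideal_def subspace_def
  proof (intro conjI ballI allI impI)
    show "0 \<in> I"
      unfolding I_def using id x(1) by (auto intro!: bexI[of _ id_blinfun])
    fix u v assume "u \<in> I" "v \<in> I"
    then obtain S T where "S \<in> C" "\<bar>u\<bar> \<le> S x" "T \<in> C" "\<bar>v\<bar> \<le> T x"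
      unfolding I_def by blast
    moreover from this have "\<bar>u + v\<bar> \<le> (S + T) x"
      by (simp add: blinfun.add_left order_trans[OF abs_triangle_ineq] add_mono)
    ultimately show "u + v \<in> I"
      using add unfolding I_def by blast
  next
    fix c and u assume "u \<in> I"
    then obtain S where "S \<in> C" "\<bar>u\<bar> \<le> S x"
      unfolding I_def by blast
    moreover from this have "\<bar>c *\<^sub>R u\<bar> \<le> (\<bar>c\<bar> *\<^sub>R S) x"
      by (simp add: blinfun.scaleR_left scaleR_left_mono)
    ultimately show "c *\<^sub>R u \<in> I"
      using scale[of "\<bar>c\<bar>" S] unfolding I_def by auto
  next
    fix u v assume "v \<in> I \<and> \<bar>u\<bar> \<le> \<bar>v\<bar>"
    then show "u \<in> I"
      unfolding I_def by (auto intro: order_trans)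
  qed
  have I_inv: "blinfun_apply T z \<in> I" if T: "T \<in> C" and z: "z \<in> I" for T z
  proof -
    obtain S where S: "S \<in> C" "\<bar>z\<bar> \<le> S x"
      using z unfolding I_def by blast
    have "\<bar>T z\<bar> \<le> T \<bar>z\<bar>"
      by (rule blinfun_nonneg_abs[OF pos[OF T]])
    also have "\<dots> \<le> (T o\<^sub>L S) x"
      using blinfun_nonneg_mono[OF pos[OF T] S(2)] by simp
    finally show ?thesis
      using comp[OF T S(1)] unfolding I_def by blast
  qed
  have "closure I = {0} \<or> closure I = UNIV"
  proof (rule trivial)
    fix T z assume T: "T \<in> C" and "z \<in> closure I"
    then obtain u where u: "\<forall>n. u n \<in> I" "u \<longlonglongrightarrow> z"
      unfolding closure_sequential by blast
    have 1: "\<forall>n. T (u n) \<in> I"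
      using I_inv[OF T] u(1) by simp
    have 2: "(\<lambda>n. T (u n)) \<longlonglongrightarrow> T z"
      by (intro blinfun.tendsto tendsto_const u)
    show "T z \<in> closure I"
      unfolding closure_sequential by (rule exI[of _ "\<lambda>n. T (u n)"], rule conjI[OF 1 2])
  qed (simp_all add: I lattice_ideal_closure)
  moreover have "x \<in> I"
    using id x(1) unfolding I_def by (auto intro!: bexI[of _ id_blinfun] simp: abs_of_pos)
  then have "x \<in> closure I"
    by (rule closure_subset[THEN subsetD])
  moreover have "x \<notin> {0}"
    using x(1) by simp
  ultimately have dense: "closure I = UNIV"
    by metis
  moreover have Ieq: "I = {z. \<exists>y\<in>(\<lambda>T. blinfun_apply T x) ` C. \<bar>z\<bar> \<le> y}"
    by (auto simp: I_def)
  ultimately show ?dense by simp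

  define J where "J = {z. \<forall>S\<in>C. f (blinfun_apply S \<bar>z\<bar>) = 0}"
  have fSpos: "0 \<le> f (blinfun_apply S z)" if "S \<in> C" "0 \<le> z" for S z
    by (intro blinfun_nonneg_apply f0 pos that)
  have fSmono: "f (blinfun_apply S z) \<le> f (S w)" if "S \<in> C" "z \<le> w" for S z w
    by (intro blinfun_nonneg_mono f0 pos that)
  have Jsub: "z \<in> J" if "\<And>S. S \<in> C \<Longrightarrow> f (blinfun_apply S \<bar>z\<bar>) \<le> 0" for z
    unfolding J_def using that fSpos[of _ "\<bar>z\<bar>"] by (auto intro: antisym)
  have "lattice_ideal J"
    unfolding lattice_ideal_def subspace_def
  proof (intro conjI ballI allI impI)
    show "0 \<in> J" by (simp add: J_def)
    fix u v assume uv: "u \<in> J" "v \<in> J"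
    show "u + v \<in> J"
    proof (rule Jsub)
      fix S assume S: "S \<in> C"
      have "f (S \<bar>u + v\<bar>) \<le> f (S (\<bar>u\<bar> + \<bar>v\<bar>))"
        by (intro fSmono S abs_triangle_ineq)
      also have "\<dots> = 0"
        using uv S by (simp add: J_def blinfun.add_right)
      finally show "f (S \<bar>u + v\<bar>) \<le> 0" .
    qed
  next
    fix c and u assume "u \<in> J"
    then show "c *\<^sub>R u \<in> J"
      by (simp add: J_def blinfun.scaleR_right)
  next
    fix u v assume uv: "v \<in> J \<and> \<bar>u\<bar> \<le> \<bar>v\<bar>"
    show "u \<in> J"
    proof (rule Jsub)
      fix S assume S: "S \<in> C"
      have "f (S \<bar>u\<bar>) \<le> f (S \<bar>v\<bar>)"
        using uv by (intro fSmono S) simp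
      then show "f (S \<bar>u\<bar>) \<le> 0"
        using uv S by (simp add: J_def)
    qed
  qed
  moreover have "closed J"
    unfolding closed_sequential_limits
  proof (intro allI impI)
    fix u l assume u: "(\<forall>n. u n \<in> J) \<and> u \<longlonglongrightarrow> l"
    have "f (S \<bar>l\<bar>) = 0" if "S \<in> C" for S
    proof -
      have "(\<lambda>n. f (S \<bar>u n\<bar>)) \<longlonglongrightarrow> f (S \<bar>l\<bar>)"
        using u by (intro blinfun.tendsto tendsto_const tendsto_abs_lattice) auto
      moreover have "f (S \<bar>u n\<bar>) = 0" for n
        using u that by (simp add: J_def)
      ultimately show ?thesis by (simp add: LIMSEQ_const_iff)
    qed
    then show "l \<in> J" by (simp add: J_def)
  qed
  moreover have "blinfun_apply T z \<in> J" if T: "T \<in> C" and z: "z \<in> J" for T z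
  proof (rule Jsub)
    fix S assume S: "S \<in> C"
    have "f (S \<bar>T z\<bar>) \<le> f (S (T \<bar>z\<bar>))"
      by (intro fSmono S blinfun_nonneg_abs pos T)
    also have "\<dots> = f ((S o\<^sub>L T) \<bar>z\<bar>)" by simp
    also have "\<dots> = 0"
      using z comp[OF S T] unfolding J_def by blast
    finally show "f (S \<bar>T z\<bar>) \<le> 0" .
  qed
  ultimately have "J = {0} \<or> J = UNIV"
    by (rule trivial)
  moreover have "J \<noteq> UNIV"
  proof
    assume "J = UNIV"
    then have "z \<in> J" for z by simp
    then have *: "f (id_blinfun \<bar>z\<bar>) = 0" for z
      using id unfolding J_def by blast
    have "f z \<le> 0" if "0 \<le> z" for z
      using *[of z] that by (simp add: abs_of_nonneg)
    then have "f \<le> 0"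
      unfolding less_eq_blinfun_def blinfun.zero_left by blast
    then show False using f(1) by (metis less_le_not_le)
  qed
  ultimately have J: "J = {0}" by blast
  have sep: "z = 0" if "0 \<le> z" "\<And>S. S \<in> C \<Longrightarrow> f (blinfun_apply S z) = 0" for z
    using that J by (auto simp: J_def abs_of_nonneg)
  then show "\<And>z. 0 \<le> z \<Longrightarrow> (\<And>S. S \<in> C \<Longrightarrow> (f o\<^sub>L S) z = 0) \<Longrightarrow> z = 0"
    by simp

  have fixv: "K (T x) = T x" if T: "T \<in> C" for T
    using comm
  proof
    assume c: "\<forall>S\<in>C. (K o\<^sub>L S) \<le> (S o\<^sub>L K)"
    have "T x - K (T x) = 0"
    proof (rule sep)
      show "0 \<le> T x - K (T x)"
        using blinfun_le_apply[OF c[rule_format, OF T], of x] x by simp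
      then have *: "0 \<le> f (S (T x - K (T x)))" if "S \<in> C" for S
        using that by (intro fSpos)
      show "f (S (T x - K (T x))) = 0" if S: "S \<in> C" for S
      proof (rule antisym[OF _ *[OF S]])
        have "0 \<le> T x"
          using blinfun_nonneg_apply[OF pos[OF T]] x(1) by simp
        then have "K (S (T x)) \<le> S (K (T x))"
          using blinfun_le_apply[OF c[rule_format, OF S]] by simp
        from blinfun_nonneg_mono[OF f0 this] show "f (S (T x - K (T x))) \<le> 0"
          by (simp add: fK blinfun.diff_right)
      qed
    qed
    then show ?thesis by simp
  next
    assume c: "\<forall>S\<in>C. (S o\<^sub>L K) \<le> (K o\<^sub>L S)"
    have "K (T x) - T x = 0"
    proof (rule sep)
      show "0 \<le> K (T x) - T x"
        using blinfun_le_apply[OF c[rule_format, OF T], of x] x by simp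
      then have *: "0 \<le> f (S (K (T x) - T x))" if "S \<in> C" for S
        using that by (intro fSpos)
      show "f (S (K (T x) - T x)) = 0" if S: "S \<in> C" for S
      proof (rule antisym[OF _ *[OF S]])
        have "0 \<le> T x"
          using blinfun_nonneg_apply[OF pos[OF T]] x(1) by simp
        then have "S (K (T x)) \<le> K (S (T x))"
          using blinfun_le_apply[OF c[rule_format, OF S]] by simp
        from blinfun_nonneg_mono[OF f0 this] show "f (S (K (T x) - T x)) \<le> 0"
          by (simp add: fK blinfun.diff_right)
      qed
    qed
    then show ?thesis by simp
  qed
  then show "\<And>T. T \<in> C \<Longrightarrow> K (blinfun_apply T x) = T x" .

  fix S assume S: "S \<in> C"
  have "(f o\<^sub>L S o\<^sub>L K) y - (f o\<^sub>L S) y = 0" if "y \<in> (\<lambda>T. blinfun_apply T x) ` C" for y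
    using that fixv by auto
  then have "((f o\<^sub>L S o\<^sub>L K) - (f o\<^sub>L S)) y = 0" "((f o\<^sub>L S) - (f o\<^sub>L S o\<^sub>L K)) y = 0"
    if "y \<in> (\<lambda>T. blinfun_apply T x) ` C" for y
    using that by (simp_all add: blinfun.diff_left)
  note zero = nonneg_blinfun_zero_if_dense[OF _ dense[unfolded Ieq] this(1)]
    nonneg_blinfun_zero_if_dense[OF _ dense[unfolded Ieq] this(2)]
  show "f o\<^sub>L S o\<^sub>L K = f o\<^sub>L S"
    using comm
  proof
    assume c: "\<forall>S\<in>C. (K o\<^sub>L S) \<le> (S o\<^sub>L K)"
    have "0 \<le> (f o\<^sub>L S o\<^sub>L K) - (f o\<^sub>L S)"
      unfolding blinfun_nonneg_iff
    proof (intro allI impI)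
      fix z :: 'a assume "0 \<le> z"
      then have "K (S z) \<le> S (K z)"
        using blinfun_le_apply[OF c[rule_format, OF S]] by simp
      from blinfun_nonneg_mono[OF f0 this] show "0 \<le> ((f o\<^sub>L S o\<^sub>L K) - (f o\<^sub>L S)) z"
        by (simp add: fK blinfun.diff_left)
    qed
    from zero(1)[OF this] show ?thesis by simp
  next
    assume c: "\<forall>S\<in>C. (S o\<^sub>L K) \<le> (K o\<^sub>L S)"
    have "0 \<le> (f o\<^sub>L S) - (f o\<^sub>L S o\<^sub>L K)"
      unfolding blinfun_nonneg_iff
    proof (intro allI impI)
      fix z :: 'a assume "0 \<le> z"
      then have "S (K z) \<le> K (S z)"
        using blinfun_le_apply[OF c[rule_format, OF S]] by simp
      from blinfun_nonneg_mono[OF f0 this] show "0 \<le> ((f o\<^sub>L S) - (f o\<^sub>L S o\<^sub>L K)) z"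
        by (simp add: fK blinfun.diff_left)
    qed
    from zero(2)[OF this] show ?thesis by simp
  qed
qed

section \<open>The limit projection of a power bounded compact operator\<close>

text \<open>Since \<open>K\<^sup>n\<close> with \<open>n \<ge> 2\<close> factors through \<open>K\<close> on both sides, the powers of \<open>K\<close> are relatively
  compact in norm, and their limit points form a compact semigroup, which contains an idempotent.
  Concretely, if \<open>K\<^bsup>n j\<^esup> \<longlonglongrightarrow> L\<close> and \<open>Q\<close> is a limit of powers with exponents \<open>n (q j) - 2 n j\<close>, then
  \<open>L = L\<^sup>2 Q\<close>, so that \<open>L Q\<close> is idempotent.\<close>

lemma power_limit_projection:
  fixes K :: "'a::banach \<Rightarrow>\<^sub>L 'a"
  assumes cK: "compact_operator K" and M: "\<And>n. norm (K ^\<^sub>L n) \<le> M"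
  obtains P J e where "\<And>j. 1 \<le> e j" "(\<lambda>j. K ^\<^sub>L e j) \<longlonglongrightarrow> P" "(\<lambda>j. K ^\<^sub>L (e j - 1)) \<longlonglongrightarrow> J"
    "P o\<^sub>L P = P" "K o\<^sub>L J = P" "J o\<^sub>L K = P"
proof -
  have sandwich: "K o\<^sub>L K ^\<^sub>L n o\<^sub>L K = K ^\<^sub>L (n + 2)" for n
    by (rule blinfun_eqI) (simp add: numeral_2_eq_2 arg_cong[OF blinfun_power_commute[symmetric], of "\<lambda>T. T _", simplified])
  have subseq: "\<exists>L r. strict_mono (r :: nat \<Rightarrow> nat) \<and> (\<lambda>j. K ^\<^sub>L (n (r j) + 2)) \<longlonglongrightarrow> L" for n :: "nat \<Rightarrow> nat"
  proof -
    obtain L r where "strict_mono (r :: nat \<Rightarrow> nat)" "(\<lambda>j. K o\<^sub>L K ^\<^sub>L (n (r j)) o\<^sub>L K) \<longlonglongrightarrow> L"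
      using compact_sandwich_subseq[OF cK cK, of "\<lambda>j. K ^\<^sub>L n j" M] M by blast
    then show ?thesis by (auto simp only: sandwich)
  qed
  obtain L s where s: "strict_mono (s :: nat \<Rightarrow> nat)" "(\<lambda>j. K ^\<^sub>L (s j + 2)) \<longlonglongrightarrow> L"
    using subseq[of "\<lambda>j. j"] by blast
  define n where "n j = s j + 2" for j
  define q where "q j = 2 * n j + 2 + j" for j
  define p where "p j = n (q j) - 2 * n j - 2" for j
  have nq: "n (q j) = n j + n j + (p j + 2)" for j
    using seq_suble[OF s(1), of "q j"] unfolding p_def by (simp add: n_def q_def)
  obtain Q t where t: "strict_mono (t :: nat \<Rightarrow> nat)" "(\<lambda>j. K ^\<^sub>L (p (t j) + 2)) \<longlonglongrightarrow> Q"
    using subseq[of p] by blast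
  have nlim: "(\<lambda>j. K ^\<^sub>L n j) \<longlonglongrightarrow> L"
    using s(2) by (simp add: n_def)
  have A: "(\<lambda>j. K ^\<^sub>L n (t j)) \<longlonglongrightarrow> L"
    using LIMSEQ_subseq_LIMSEQ[OF nlim t(1)] by (simp add: o_def)
  have "j \<le> q (t j)" for j
    using seq_suble[OF t(1), of j] by (simp add: q_def)
  then have "filterlim (\<lambda>j. q (t j)) at_top sequentially"
    by (intro filterlim_at_top_mono[OF filterlim_ident]) auto
  then have "(\<lambda>j. K ^\<^sub>L n (q (t j))) \<longlonglongrightarrow> L"
    by (rule filterlim_compose[OF nlim])
  moreover have "(\<lambda>j. K ^\<^sub>L n (q (t j))) \<longlonglongrightarrow> (L o\<^sub>L L o\<^sub>L Q)"
    unfolding nq blinfun_power_add by (intro tendsto_intros A t(2)[unfolded blinfun_power_add])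
  ultimately have L: "L = L o\<^sub>L L o\<^sub>L Q"
    by (rule LIMSEQ_unique)
  define a where "a j = n (t j) + (p (t j) + 2)" for j
  have alim: "(\<lambda>j. K ^\<^sub>L a j) \<longlonglongrightarrow> (L o\<^sub>L Q)"
    unfolding a_def blinfun_power_add by (intro tendsto_intros A t(2)[unfolded blinfun_power_add])
  have "(\<lambda>j. K ^\<^sub>L a j) \<longlonglongrightarrow> (Q o\<^sub>L L)"
    unfolding a_def add.commute[of "n _"] blinfun_power_add[of _ "p _ + 2"]
    by (intro tendsto_intros A t(2))
  then have comm: "L o\<^sub>L Q = Q o\<^sub>L L"
    using LIMSEQ_unique[OF alim] by simp
  define P where "P = L o\<^sub>L Q"
  have PP: "P o\<^sub>L P = P"
  proof (rule blinfun_eqI)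
    fix x
    have "P (P x) = L (Q (L (Q x)))" by (simp add: P_def)
    also have "Q (L (Q x)) = L (Q (Q x))"
      using arg_cong[OF comm, of "\<lambda>T. T (Q x)"] by simp
    also have "L (L (Q (Q x))) = L (Q x)"
      using arg_cong[OF L, of "\<lambda>T. T (Q x)"] by simp
    finally show "(P o\<^sub>L P) x = P x" by (simp add: P_def)
  qed
  obtain J u where u: "strict_mono (u :: nat \<Rightarrow> nat)" "(\<lambda>j. K ^\<^sub>L (a (u j) - 3 + 2)) \<longlonglongrightarrow> J"
    using subseq[of "\<lambda>j. a j - 3"] by blast
  define e where "e j = a (u j)" for j
  have e3: "3 \<le> e j" for j
    by (simp add: e_def a_def n_def)
  have Jlim: "(\<lambda>j. K ^\<^sub>L (e j - 1)) \<longlonglongrightarrow> J"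
  proof -
    have "a (u j) - 3 + 2 = e j - 1" for j
      using e3[of j] by (simp add: e_def)
    then show ?thesis using u(2) by simp
  qed
  have Plim: "(\<lambda>j. K ^\<^sub>L e j) \<longlonglongrightarrow> P"
    using LIMSEQ_subseq_LIMSEQ[OF alim u(1)] by (simp add: o_def e_def P_def)
  have eS: "K ^\<^sub>L e j = K o\<^sub>L K ^\<^sub>L (e j - 1)" "K ^\<^sub>L e j = K ^\<^sub>L (e j - 1) o\<^sub>L K" for j
    using e3[of j] blinfun_power_commute[of K "e j - 1"] by (cases "e j"; simp)+
  have "(\<lambda>j. K ^\<^sub>L e j) \<longlonglongrightarrow> (K o\<^sub>L J)"
    unfolding eS(1) by (intro tendsto_intros Jlim)
  moreover have "(\<lambda>j. K ^\<^sub>L e j) \<longlonglongrightarrow> (J o\<^sub>L K)"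
    unfolding eS(2) by (intro tendsto_intros Jlim)
  ultimately have "K o\<^sub>L J = P" "J o\<^sub>L K = P"
    using LIMSEQ_unique[OF Plim] by auto
  moreover have "1 \<le> e j" for j
    using e3[of j] by simp
  ultimately show ?thesis
    using that Plim Jlim PP by blast
qed

text \<open>On the kernel of \<open>P\<close> some power \<open>K\<^sup>N\<close> has norm at most \<open>1/2\<close>, so the powers decay like \<open>\<theta>\<^sup>n\<close> with
  \<open>\<theta>\<^sup>N = 1/2\<close>.\<close>

lemma power_limit_decay:
  fixes K :: "'a::banach \<Rightarrow>\<^sub>L 'a"
  assumes M: "\<And>n. norm (K ^\<^sub>L n) \<le> M" and e: "\<And>j. 1 \<le> e j" "(\<lambda>j. K ^\<^sub>L e j) \<longlonglongrightarrow> P"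
    and PP: "P o\<^sub>L P = P" and comm: "P o\<^sub>L K = K o\<^sub>L P"
  shows "\<exists>C \<theta>. 0 \<le> C \<and> 0 < \<theta> \<and> \<theta> < 1 \<and> (\<forall>n. norm (K ^\<^sub>L n o\<^sub>L (id_blinfun - P)) \<le> C * \<theta> ^ n)"
proof -
  let ?E = "id_blinfun - P"
  have EE: "?E (?E x) = ?E x" for x
    using arg_cong[OF PP, of "\<lambda>T. T x"] by (simp add: blinfun.diff_left blinfun.diff_right)
  have EK: "?E ((K ^\<^sub>L n) x) = (K ^\<^sub>L n) (?E x)" for n x
  proof (induction n)
    case (Suc n)
    then show ?case
      using arg_cong[OF comm, of "\<lambda>T. T ((K ^\<^sub>L n) x)"]
      by (simp add: blinfun.diff_left blinfun.diff_right)
  qed simp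
  have "(\<lambda>j. K ^\<^sub>L e j o\<^sub>L ?E) \<longlonglongrightarrow> (P o\<^sub>L ?E)"
    by (intro tendsto_intros e)
  moreover have "P o\<^sub>L ?E = 0"
    using arg_cong[OF PP, of "\<lambda>T. T _"]
    by (intro blinfun_eqI) (simp add: blinfun.diff_left blinfun.diff_right)
  ultimately have "(\<lambda>j. norm (K ^\<^sub>L e j o\<^sub>L ?E)) \<longlonglongrightarrow> 0"
    using tendsto_norm_zero by metis
  from order_tendstoD(2)[OF this, of "1 / 2"]
  obtain j where "norm (K ^\<^sub>L e j o\<^sub>L ?E) < 1 / 2"
    unfolding eventually_sequentially by auto
  then obtain N where N: "1 \<le> N" "norm (K ^\<^sub>L N o\<^sub>L ?E) \<le> 1 / 2"
    using e(1) less_imp_le by blast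
  have M0: "0 \<le> M"
    using M[of 0] norm_ge_zero order_trans by blast
  have step: "norm (K ^\<^sub>L (N * k + r) o\<^sub>L ?E) \<le> (1 / 2) ^ k * (M * norm ?E)" for k r
  proof (induction k)
    case 0
    then show ?case
      using norm_blinfun_compose[of "K ^\<^sub>L r" ?E] mult_right_mono[OF M[of r] norm_ge_zero[of ?E]]
      by (simp add: order_trans)
  next
    case (Suc k)
    have "K ^\<^sub>L (N * Suc k + r) o\<^sub>L ?E = (K ^\<^sub>L N o\<^sub>L ?E) o\<^sub>L (K ^\<^sub>L (N * k + r) o\<^sub>L ?E)"
    proof (rule blinfun_eqI)
      fix x
      have "N * Suc k + r = N + (N * k + r)" by simp
      then show "(K ^\<^sub>L (N * Suc k + r) o\<^sub>L ?E) x = ((K ^\<^sub>L N o\<^sub>L ?E) o\<^sub>L (K ^\<^sub>L (N * k + r) o\<^sub>L ?E)) x"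
        by (simp only: blinfun_power_add blinfun_apply_blinfun_compose EK EE)
    qed
    then have "norm (K ^\<^sub>L (N * Suc k + r) o\<^sub>L ?E)
        \<le> norm (K ^\<^sub>L N o\<^sub>L ?E) * norm (K ^\<^sub>L (N * k + r) o\<^sub>L ?E)"
      by (simp add: norm_blinfun_compose)
    also have "\<dots> \<le> (1 / 2) * ((1 / 2) ^ k * (M * norm ?E))"
      by (intro mult_mono N Suc) auto
    finally show ?case by simp
  qed
  define \<theta> where "\<theta> = root N (1 / 2)"
  have \<theta>: "0 < \<theta>" "\<theta> < 1" "\<theta> ^ N = 1 / 2"
    using N(1) by (auto simp: \<theta>_def real_root_lt_1_iff)
  have "norm (K ^\<^sub>L n o\<^sub>L ?E) \<le> 2 * (M * norm ?E) * \<theta> ^ n" for n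
  proof -
    have "norm (K ^\<^sub>L n o\<^sub>L ?E) \<le> (1 / 2) ^ (n div N) * (M * norm ?E)"
      using step[of "n div N" "n mod N"] by simp
    also have "(1 / 2) ^ (n div N) \<le> 2 * \<theta> ^ n"
    proof -
      have "(1 / 2) ^ (n div N) * (1 / 2) \<le> (1 / 2) ^ (n div N) * \<theta> ^ (n mod N)"
      proof (rule mult_left_mono)
        have "\<theta> ^ N \<le> \<theta> ^ (n mod N)"
          using \<theta> N(1) by (intro power_decreasing) (auto intro: less_imp_le)
        then show "1 / 2 \<le> \<theta> ^ (n mod N)" by (simp add: \<theta>)
      qed simp
      also have "\<dots> = \<theta> ^ (N * (n div N) + n mod N)"
        by (simp only: power_add power_mult \<theta>(3))
      finally show ?thesis by simp
    qed
    then have "(1 / 2) ^ (n div N) * (M * norm ?E) \<le> 2 * \<theta> ^ n * (M * norm ?E)"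
      using M0 by (intro mult_right_mono) auto
    finally show ?thesis by (simp add: mult_ac)
  qed
  then show ?thesis
    using \<theta> M0 by (intro exI[of _ "2 * (M * norm ?E)"] exI[of _ \<theta>]) auto
qed

section \<open>Maximal disjoint families in finite-dimensional sublattices\<close>

definition unit_disjoint :: "'a::banach_lattice set \<Rightarrow> 'a set \<Rightarrow> bool" where
  "unit_disjoint V E \<longleftrightarrow> finite E \<and> E \<subseteq> V \<and> (\<forall>e\<in>E. 0 \<le> e \<and> norm e = 1) \<and>
     (\<forall>e\<in>E. \<forall>d\<in>E. e \<noteq> d \<longrightarrow> inf e d = 0)"

lemma unit_disjoint_insert:
  assumes E: "unit_disjoint V E" and V: "subspace V" and w: "w \<in> V" "0 \<le> w" "w \<noteq> 0"
    and disj: "\<And>e. e \<in> E \<Longrightarrow> inf w e = 0"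
  shows "unit_disjoint V (insert ((1 / norm w) *\<^sub>R w) E)"
    and "card (insert ((1 / norm w) *\<^sub>R w) E) = Suc (card E)"
proof -
  let ?u = "(1 / norm w) *\<^sub>R w"
  have d: "inf ?u e = 0" if "e \<in> E" for e
    using disjoint_scaleR[OF disj[OF that], of "1 / norm w" 1] by simp
  have n: "norm ?u = 1" using w(3) by simp
  have "?u \<notin> E"
  proof
    assume "?u \<in> E"
    from d[OF this] have "?u = 0" by simp
    then show False using n by simp
  qed
  then show "card (insert ?u E) = Suc (card E)"
    using E by (simp add: unit_disjoint_def)
  show "unit_disjoint V (insert ?u E)"
    using E w n d V subspace_scale[OF V w(1)] unfolding unit_disjoint_def
    by (auto simp: inf_commute scaleR_nonneg_nonneg)
qed

text \<open>Distinct members of such a family have distance at least \<open>1\<close>, so no ball of radius \<open>1/2\<close> contains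
  two of them, and finitely many such balls cover the image of the unit ball under \<open>P\<close>.\<close>

lemma unit_disjoint_card_bounded:
  fixes P :: "'a::banach_lattice \<Rightarrow>\<^sub>L 'a"
  assumes P: "compact_operator P" and V: "\<And>v. v \<in> V \<Longrightarrow> P v = v"
  shows "\<exists>N. \<forall>E. unit_disjoint V E \<longrightarrow> card E \<le> N"
proof -
  obtain k where k: "finite k" "blinfun_apply P ` cball 0 1 \<subseteq> (\<Union>x\<in>k. ball x (1 / 2))"
    using P closure_subset unfolding compact_operator_def compact_eq_totally_bounded
    by (meson order_trans half_gt_zero zero_less_one)
  have "card E \<le> card k" if E: "unit_disjoint V E" for E
  proof -
    have "\<exists>c\<in>k. dist c e < 1 / 2" if "e \<in> E" for e
    proof -
      have "P e = e" "norm e = 1"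
        using that E V unfolding unit_disjoint_def by blast+
      then have "e \<in> blinfun_apply P ` cball 0 1"
        by (intro image_eqI[of _ _ e]) auto
      then have "e \<in> (\<Union>x\<in>k. ball x (1 / 2))"
        using k(2) by blast
      then show ?thesis by simp
    qed
    then obtain c where c: "\<And>e. e \<in> E \<Longrightarrow> c e \<in> k" "\<And>e. e \<in> E \<Longrightarrow> dist (c e) e < 1 / 2"
      by metis
    have "inj_on c E"
    proof (rule inj_onI, rule ccontr)
      fix e d assume ed: "e \<in> E" "d \<in> E" "c e = c d" "e \<noteq> d"
      have e: "inf e d = 0" "0 \<le> e" "0 \<le> d" "norm e = 1"
        using E ed unfolding unit_disjoint_def by blast+
      have "e = inf e (\<bar>e - d\<bar> + d)"
        using abs_ge_self[of "e - d"] by (simp add: inf_absorb1 diff_le_eq)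
      also have "\<dots> \<le> inf e \<bar>e - d\<bar> + inf e d"
        using inf_add_le[of "\<bar>e - d\<bar>" d e] e by (simp add: inf_commute)
      also have "\<dots> \<le> \<bar>e - d\<bar>" by (simp add: e)
      finally have "1 \<le> norm (e - d)"
        using norm_mono_nonneg[of e "\<bar>e - d\<bar>"] e by simp
      moreover have "dist e d < 1"
        using dist_triangle3[of e d "c e"] c(2)[OF ed(1)] c(2)[OF ed(2)] ed(3) by simp
      ultimately show False by (simp add: dist_norm)
    qed
    then show ?thesis
      using c(1) k(1) by (intro card_inj_on_le[of c]) auto
  qed
  then show ?thesis by blast
qed

locale maximal_unit_disjoint =
  fixes V E :: "'a::banach_lattice set"
  assumes V: "subspace V" and abs_V: "v \<in> V \<Longrightarrow> \<bar>v\<bar> \<in> V"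
    and E: "unit_disjoint V E" and maximal: "unit_disjoint V F \<Longrightarrow> card F \<le> card E"
begin

lemma pprt_V: "v \<in> V \<Longrightarrow> pprt v \<in> V"
  unfolding pprt_conv_abs using V abs_V by (intro subspace_scale subspace_add) auto

lemma inf_V: "v \<in> V \<Longrightarrow> w \<in> V \<Longrightarrow> inf v w \<in> V"
  unfolding inf_conv_pprt using V by (intro subspace_diff pprt_V) auto

lemma E_props: 
  shows "finite E" "e \<in> E \<Longrightarrow> e \<in> V" "e \<in> E \<Longrightarrow> 0 \<le> e" "e \<in> E \<Longrightarrow> norm e = 1" "e \<in> E \<Longrightarrow> e \<noteq> 0"
    "e \<in> E \<Longrightarrow> d \<in> E \<Longrightarrow> e \<noteq> d \<Longrightarrow> inf e d = 0"
proof -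
  note * = E[unfolded unit_disjoint_def]
  show "finite E" using * by simp
  show "e \<in> V" if "e \<in> E" using * that by auto
  show "0 \<le> e" and n: "norm e = 1" if "e \<in> E" using * that by simp_all
  show "inf e d = 0" if "e \<in> E" "d \<in> E" "e \<noteq> d" using * that by simp
  show "e \<noteq> 0" if "e \<in> E"
    using n[OF that] by force
qed

text \<open>If both parts of \<open>v\<close> met \<open>e\<close>, then \<open>e\<close> could be replaced by two disjoint vectors below it.\<close>

lemma one_sided:
  assumes v: "v \<in> V" and e: "e \<in> E"
  shows "inf (pprt v) e = 0 \<or> inf (pprt (- v)) e = 0"
proof (rule ccontr)
  assume neg: "\<not> ?thesis"
  define a b where "a = inf (pprt v) e" and "b = inf (pprt (- v)) e"
  have ab: "a \<noteq> 0" "b \<noteq> 0" "0 \<le> a" "0 \<le> b" "a \<in> V" "b \<in> V"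
    using neg E_props(2,3)[OF e] v V by (auto simp: a_def b_def intro!: inf_V pprt_V subspace_neg)
  have dab: "inf a b = 0"
    by (rule disjoint_mono[OF inf_pprt_nprt[of v]])
      (use ab(3,4) in \<open>auto simp: a_def b_def pprt_neg\<close>)
  have d: "inf a f = 0" "inf b f = 0" if "f \<in> E - {e}" for f
  proof -
    have f: "inf e f = 0" "0 \<le> f"
      using that E_props(3)[of f] E_props(6)[OF e, of f] by blast+
    show "inf a f = 0" "inf b f = 0"
      using disjoint_mono[OF f(1) ab(3) f(2) _ order_refl] disjoint_mono[OF f(1) ab(4) f(2) _ order_refl]
      by (simp_all add: a_def b_def)
  qed
  have F: "unit_disjoint V (E - {e})"
    using E_props unfolding unit_disjoint_def by (intro conjI ballI impI) auto
  let ?F = "insert ((1 / norm a) *\<^sub>R a) (E - {e})"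
  note F1 = unit_disjoint_insert[OF F V ab(5,3,1) d(1)]
  have "inf b f = 0" if "f \<in> ?F" for f
    using that
  proof
    assume "f = (1 / norm a) *\<^sub>R a"
    then show ?thesis
      using disjoint_scaleR[OF dab, of "1 / norm a" 1] by (simp add: inf_commute)
  qed (rule d(2))
  note F2 = unit_disjoint_insert[OF F1(1) V ab(6,4,2) this]
  have "Suc (card ?F) \<le> card E"
    using maximal[OF F2(1)] F2(2) by simp
  moreover have "card ?F = card E"
    using F1(2) E_props(1) e by (metis card_Suc_Diff1)
  ultimately show False by simp
qed

text \<open>The sets of \<open>s\<close> for which the positive, respectively the negative, part of \<open>v - s e\<close> is disjoint
  from \<open>e\<close> are closed, not empty and cover the real line, which is connected.\<close>

lemma coefficient_exists:
  assumes v: "v \<in> V" and e: "e \<in> E"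
  shows "\<exists>c. inf \<bar>v - c *\<^sub>R e\<bar> e = 0"
proof -
  note e_props = E_props(2-5)[OF e]
  have mem: "w - s *\<^sub>R e \<in> V" if "w \<in> V" for w s
    using that V e_props(1) by (intro subspace_diff subspace_scale)
  have ex: "\<exists>s. inf (pprt (w - s *\<^sub>R e)) e = 0" if w: "w \<in> V" for w
  proof (rule ccontr)
    assume "\<not> ?thesis"
    then have *: "inf (pprt (- (w - s *\<^sub>R e))) e = 0" for s
      using one_sided[OF mem[OF w] e] by blast
    have "inf (pprt (e - (1 / Suc n) *\<^sub>R w)) e = 0" for n
    proof -
      have "(1 / Suc n) *\<^sub>R pprt (- (w - Suc n *\<^sub>R e)) = pprt ((1 / Suc n) *\<^sub>R (- (w - Suc n *\<^sub>R e)))"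
        by (simp add: pprt_conv_abs scaleR_right_distrib mult.commute[of 2])
      also have "(1 / Suc n) *\<^sub>R (- (w - Suc n *\<^sub>R e)) = e - (1 / Suc n) *\<^sub>R w"
        by (simp add: scaleR_right_diff_distrib)
      finally show ?thesis
        using disjoint_scaleR[OF *[of "Suc n"], of "1 / Suc n" 1] by simp
    qed
    moreover have "(\<lambda>n. 1 / real (Suc n)) \<longlonglongrightarrow> 0"
      using LIMSEQ_inverse_real_of_nat by (simp add: divide_inverse)
    then have "(\<lambda>n. inf (pprt (e - (1 / Suc n) *\<^sub>R w)) e) \<longlonglongrightarrow> inf (pprt (e - 0 *\<^sub>R w)) e"
      by (intro tendsto_intros)
    ultimately have "inf (pprt (e - 0 *\<^sub>R w)) e = 0"
      by (simp add: LIMSEQ_const_iff)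
    then show False using e_props by simp
  qed
  define A where "A = {s. inf (pprt (v - s *\<^sub>R e)) e = 0}"
  define B where "B = {s. inf (pprt (- (v - s *\<^sub>R e))) e = 0}"
  have "closed A" unfolding A_def
    by (intro closed_Collect_eq continuous_at_imp_continuous_on ballI) (auto simp: isCont_def intro!: tendsto_intros)
  moreover have "closed B" unfolding B_def
    by (intro closed_Collect_eq continuous_at_imp_continuous_on ballI) (auto simp: isCont_def intro!: tendsto_intros)
  moreover have "A \<union> B = UNIV"
    using one_sided[OF mem[OF v] e] by (auto simp: A_def B_def)
  moreover have "A \<noteq> {}"
    using ex[OF v] by (auto simp: A_def)
  moreover have "B \<noteq> {}"
  proof -
    obtain s where "inf (pprt (- v - s *\<^sub>R e)) e = 0"
      using ex[OF subspace_neg[OF V v]] by blast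
    moreover have "- (v - (- s) *\<^sub>R e) = - v - s *\<^sub>R e" by simp
    ultimately have "- s \<in> B"
      unfolding B_def by (metis (mono_tags, lifting) mem_Collect_eq)
    then show ?thesis by blast
  qed
  moreover have "\<not> (closed A \<and> closed B \<and> UNIV \<subseteq> A \<union> B \<and> A \<inter> B \<inter> UNIV = {} \<and> A \<inter> UNIV \<noteq> {} \<and> B \<inter> UNIV \<noteq> {})"
    using connected_UNIV[where 'a=real] unfolding connected_closed by blast
  ultimately have "A \<inter> B \<noteq> {}" by simp
  then obtain c where c: "c \<in> A" "c \<in> B" by blast
  let ?w = "v - c *\<^sub>R e"
  have "\<bar>?w\<bar> = pprt ?w + pprt (- ?w)"
    by (simp only: abs_prts pprt_neg diff_conv_add_uminus)
  then have "inf \<bar>?w\<bar> e \<le> inf (pprt ?w) e + inf (pprt (- ?w)) e"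
    using inf_add_le[of "pprt ?w" "pprt (- ?w)" e] e_props by simp
  also have "\<dots> = 0"
    using c by (simp add: A_def B_def)
  finally show ?thesis
    using e_props by (intro exI[of _ c] antisym) auto
qed

text \<open>Subtracting from \<open>v\<close> its components along the members of \<open>E\<close> leaves a vector that is disjoint from
  all of them, and by maximality there is none except \<open>0\<close>.\<close>

lemma span_maximal:
  assumes v: "v \<in> V" shows "\<exists>c. v = (\<Sum>e\<in>E. c e *\<^sub>R e)"
proof -
  obtain c where c: "\<And>e. e \<in> E \<Longrightarrow> inf \<bar>v - c e *\<^sub>R e\<bar> e = 0"
    using coefficient_exists[OF v] by metis
  define w where "w = v - (\<Sum>e\<in>E. c e *\<^sub>R e)"
  have "(\<Sum>e\<in>E. c e *\<^sub>R e) \<in> V"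
    using V E_props by (intro subspace_sum subspace_scale) auto
  then have wV: "w \<in> V"
    unfolding w_def using V v by (intro subspace_diff)
  have "inf \<bar>w\<bar> e = 0" if e: "e \<in> E" for e
  proof -
    have "w = (v - c e *\<^sub>R e) - (\<Sum>d\<in>E - {e}. c d *\<^sub>R d)"
      unfolding w_def using sum.remove[OF E_props(1) e, of "\<lambda>e. c e *\<^sub>R e"] by simp
    then have "\<bar>w\<bar> \<le> \<bar>v - c e *\<^sub>R e\<bar> + \<bar>\<Sum>d\<in>E - {e}. c d *\<^sub>R d\<bar>"
      using abs_triangle_ineq4 by metis
    also have "\<dots> \<le> \<bar>v - c e *\<^sub>R e\<bar> + (\<Sum>d\<in>E - {e}. \<bar>c d *\<^sub>R d\<bar>)"
      by (intro add_left_mono sum_abs)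
    finally have "\<bar>w\<bar> \<le> \<bar>v - c e *\<^sub>R e\<bar> + (\<Sum>d\<in>E - {e}. \<bar>c d\<bar> *\<^sub>R d)"
      using E_props(3) by (simp add: abs_of_nonneg)
    then have "inf \<bar>w\<bar> e \<le> inf (\<bar>v - c e *\<^sub>R e\<bar> + (\<Sum>d\<in>E - {e}. \<bar>c d\<bar> *\<^sub>R d)) e"
      by (intro inf_mono order_refl)
    also have "\<dots> \<le> inf \<bar>v - c e *\<^sub>R e\<bar> e + inf (\<Sum>d\<in>E - {e}. \<bar>c d\<bar> *\<^sub>R d) e"
      using E_props(3) e by (intro inf_add_le sum_nonneg scaleR_nonneg_nonneg) auto
    also have "inf (\<Sum>d\<in>E - {e}. \<bar>c d\<bar> *\<^sub>R d) e = 0"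
    proof (rule disjoint_sum)
      fix d assume d: "d \<in> E - {e}"
      then show "inf (\<bar>c d\<bar> *\<^sub>R d) e = 0"
        using disjoint_scaleR[OF E_props(6)[of d e], of "\<bar>c d\<bar>" 1] e by auto
    qed (use E_props(3) e in auto)
    finally show ?thesis
      using c[OF e] E_props(3)[OF e] by (intro antisym) auto
  qed
  have "w = 0"
  proof (rule ccontr)
    assume "w \<noteq> 0"
    then have "\<bar>w\<bar> \<noteq> 0" by simp
    from unit_disjoint_insert[OF E V abs_V[OF wV] abs_ge_zero this \<open>\<And>e. e \<in> E \<Longrightarrow> inf \<bar>w\<bar> e = 0\<close>]
    show False using maximal by fastforce
  qed
  then show ?thesis unfolding w_def by auto
qed

end

section \<open>Coordinates with respect to disjoint positive vectors\<close>

locale disjoint_positive =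
  fixes I :: "'i set" and x :: "'i \<Rightarrow> 'a::banach_lattice"
  assumes fin: "finite I" and x_pos: "i \<in> I \<Longrightarrow> 0 < x i"
    and x_disj: "i \<in> I \<Longrightarrow> j \<in> I \<Longrightarrow> i \<noteq> j \<Longrightarrow> inf (x i) (x j) = 0"
begin

lemma x_nonneg: "i \<in> I \<Longrightarrow> 0 \<le> x i"
  using x_pos by (simp add: less_imp_le)

lemma disjoint_others:
  assumes "i \<in> I" "0 \<le> c"
  shows "inf (\<Sum>j\<in>I - {i}. \<bar>d j\<bar> *\<^sub>R x j) (c *\<^sub>R x i) = 0"
proof (rule disjoint_sum)
  fix j assume "j \<in> I - {i}"
  then show "inf (\<bar>d j\<bar> *\<^sub>R x j) (c *\<^sub>R x i) = 0"
    using assms by (intro disjoint_scaleR x_disj) auto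
qed (use assms x_nonneg in \<open>auto intro: scaleR_nonneg_nonneg\<close>)

text \<open>A vector dominates each of its components because the others are disjoint from that one.
  Uniqueness of the coefficients and continuity of the coordinates follow from this estimate.\<close>

lemma abs_coeff_le:
  assumes i: "i \<in> I" shows "\<bar>c i\<bar> *\<^sub>R x i \<le> \<bar>\<Sum>j\<in>I. c j *\<^sub>R x j\<bar>"
proof -
  let ?v = "\<Sum>j\<in>I. c j *\<^sub>R x j" and ?R = "\<Sum>j\<in>I - {i}. \<bar>c j\<bar> *\<^sub>R x j" and ?a = "\<bar>c i\<bar> *\<^sub>R x i"
  have a0: "0 \<le> ?a"
    using x_nonneg[OF i] by (simp add: scaleR_nonneg_nonneg)
  have R0: "0 \<le> ?R"
    using x_nonneg by (intro sum_nonneg scaleR_nonneg_nonneg) auto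
  have "?a = \<bar>c i *\<^sub>R x i\<bar>"
    using x_nonneg[OF i] by (simp add: abs_of_nonneg)
  also have "c i *\<^sub>R x i = ?v - (\<Sum>j\<in>I - {i}. c j *\<^sub>R x j)"
    using sum.remove[OF fin i, of "\<lambda>j. c j *\<^sub>R x j"] by simp
  also have "\<bar>\<dots>\<bar> \<le> \<bar>?v\<bar> + \<bar>\<Sum>j\<in>I - {i}. c j *\<^sub>R x j\<bar>"
    by (rule abs_triangle_ineq4)
  also have "\<bar>\<Sum>j\<in>I - {i}. c j *\<^sub>R x j\<bar> \<le> (\<Sum>j\<in>I - {i}. \<bar>c j *\<^sub>R x j\<bar>)"
    by (rule sum_abs)
  also have "(\<Sum>j\<in>I - {i}. \<bar>c j *\<^sub>R x j\<bar>) = ?R"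
    using x_nonneg by (intro sum.cong) (auto simp: abs_of_nonneg)
  finally have "?a \<le> \<bar>?v\<bar> + ?R" by simp
  then have "?a = inf (\<bar>?v\<bar> + ?R) ?a"
    by (simp add: inf_absorb2)
  also have "\<dots> \<le> inf \<bar>?v\<bar> ?a + inf ?R ?a"
    using a0 R0 by (intro inf_add_le) auto
  also have "\<dots> = inf \<bar>?v\<bar> ?a"
    using disjoint_others[OF i, of "\<bar>c i\<bar>" c] by simp
  also have "\<dots> \<le> \<bar>?v\<bar>" by simp
  finally show ?thesis .
qed

lemma coeff_unique:
  assumes "(\<Sum>j\<in>I. c j *\<^sub>R x j) = (\<Sum>j\<in>I. d j *\<^sub>R x j)" "i \<in> I"
  shows "c i = d i"
proof -
  have "(\<Sum>j\<in>I. (c j - d j) *\<^sub>R x j) = 0"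
    using assms(1) by (simp add: scaleR_left_diff_distrib sum_subtractf)
  then have "\<bar>c i - d i\<bar> *\<^sub>R x i \<le> 0"
    using abs_coeff_le[OF assms(2), of "\<lambda>j. c j - d j"] by simp
  moreover have "0 \<le> \<bar>c i - d i\<bar> *\<^sub>R x i"
    using x_nonneg[OF assms(2)] by (simp add: scaleR_nonneg_nonneg)
  ultimately have "\<bar>c i - d i\<bar> *\<^sub>R x i = 0"
    by (rule antisym)
  then show ?thesis
    using x_pos[OF assms(2)] by auto
qed

lemma coeff_nonneg:
  assumes "0 \<le> (\<Sum>j\<in>I. c j *\<^sub>R x j)" "i \<in> I"
  shows "0 \<le> c i"
proof (rule ccontr)
  assume neg: "\<not> 0 \<le> c i"
  let ?R = "\<Sum>j\<in>I - {i}. \<bar>c j\<bar> *\<^sub>R x j" and ?a = "(- c i) *\<^sub>R x i"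
  have "?a \<le> (\<Sum>j\<in>I - {i}. c j *\<^sub>R x j)"
    using assms(1) sum.remove[OF fin assms(2), of "\<lambda>j. c j *\<^sub>R x j"]
    by (simp add: neg_le_iff_le minus_le_iff add.commute le_add_iff1) (metis add.commute diff_ge_0_iff_ge diff_minus_eq_add)
  also have "\<dots> \<le> ?R"
    using x_nonneg by (intro sum_mono scaleR_right_mono) auto
  finally have "?a = inf ?R ?a"
    by (simp add: inf_absorb2)
  then have "?a = 0"
    using disjoint_others[OF assms(2), of "- c i" c] neg by simp
  then show False
    using neg x_pos[OF assms(2)] by auto
qed

end

section \<open>Recurrent compact operators\<close>

text \<open>The consequences of irreducibility from which the structure of \<open>K\<close> is derived: there are
  enough positive fixed vectors to generate a dense ideal and enough positive fixed functionals to
  detect positive vectors.\<close>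

locale recurrent_compact_operator =
  fixes K :: "'a::banach_lattice \<Rightarrow>\<^sub>L 'a" and Y :: "'a set" and G :: "('a \<Rightarrow>\<^sub>L real) set"
  assumes K_nonneg: "0 \<le> K" and K_compact: "compact_operator K"
    and Y: "y \<in> Y \<Longrightarrow> 0 \<le> y" "y \<in> Y \<Longrightarrow> K y = y"
    and Y_dense: "closure {z. \<exists>y\<in>Y. \<bar>z\<bar> \<le> y} = UNIV"
    and G: "g \<in> G \<Longrightarrow> 0 \<le> g" "g \<in> G \<Longrightarrow> g o\<^sub>L K = g"
    and G_separates: "0 \<le> z \<Longrightarrow> (\<And>g. g \<in> G \<Longrightarrow> blinfun_apply g z = 0) \<Longrightarrow> z = 0"
begin

lemma fixed_functional_power:
  fixes g :: "'a \<Rightarrow>\<^sub>L real"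
  assumes "g o\<^sub>L K = g" shows "g ((K ^\<^sub>L n) z) = g z"
proof (induction n)
  case (Suc n)
  then show ?case
    using arg_cong[OF assms, of "\<lambda>T. T ((K ^\<^sub>L n) z)"] by simp
qed simp

lemma fixed_vector_power: "K y = y \<Longrightarrow> (K ^\<^sub>L n) y = y"
  by (induction n) auto

text \<open>Suppose that the norms of the powers are unbounded. The first powers to exceed the levels
  \<open>j + 1\<close> give vectors \<open>u j\<close> of norm at most \<open>1\<close> with \<open>norm (K (u j)) > 1\<close>, and fixed functionals are
  small on \<open>|K (u j)|\<close> because they do not see the growth. A limit point of \<open>K (u j)\<close> then
  has norm at least \<open>1\<close> but is annihilated by all of \<open>G\<close>.\<close>

lemma power_bounded: "\<exists>M. \<forall>n. norm (K ^\<^sub>L n) \<le> M"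
proof (rule ccontr)
  assume "\<not> ?thesis"
  then have ex: "\<exists>n. real j + 1 < norm (K ^\<^sub>L n)" for j :: nat
    by (meson not_le)
  define n where "n j = (LEAST n. real j + 1 < norm (K ^\<^sub>L n))" for j :: nat
  have gt: "real j + 1 < norm (K ^\<^sub>L n j)" for j
    unfolding n_def using ex by (rule LeastI_ex)
  have le: "norm (K ^\<^sub>L k) \<le> real j + 1" if "k < n j" for j k
    using not_less_Least[OF that[unfolded n_def]] by simp
  have n0: "n j \<noteq> 0" for j
  proof
    assume "n j = 0"
    then have "real j + 1 < norm (id_blinfun :: 'a \<Rightarrow>\<^sub>L 'a)"
      using gt[of j] by simp
    also have "\<dots> \<le> 1" by (rule norm_blinfun_id_le)
    finally show False by simp
  qed
  define m where "m j = n j - 1" for j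
  have nm: "n j = Suc (m j)" for j
    using n0[of j] by (simp add: m_def)
  have "\<exists>z. norm z \<le> 1 \<and> real j + 1 < norm ((K ^\<^sub>L n j) z)" for j
  proof (rule ccontr)
    assume "\<not> ?thesis"
    then have "norm (K ^\<^sub>L n j) \<le> real j + 1"
      by (intro norm_blinfun_le_unit_ball) (auto simp: not_less)
    then show False using gt[of j] by simp
  qed
  then obtain z where z: "\<And>j. norm (z j) \<le> 1" "\<And>j. real j + 1 < norm ((K ^\<^sub>L n j) (z j))"
    by metis
  define u where "u j = (1 / (real j + 1)) *\<^sub>R (K ^\<^sub>L m j) (z j)" for j
  have nu: "norm (u j) \<le> 1" for j
  proof -
    have "norm ((K ^\<^sub>L m j) (z j)) \<le> norm (K ^\<^sub>L m j) * norm (z j)"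
      by (rule norm_blinfun)
    also have "\<dots> \<le> (real j + 1) * 1"
      using le[of "m j" j] z(1)[of j] by (intro mult_mono) (auto simp: nm)
    finally show ?thesis by (simp add: u_def)
  qed
  have Ku: "K (u j) = (1 / (real j + 1)) *\<^sub>R (K ^\<^sub>L n j) (z j)" for j
    by (simp add: u_def nm blinfun.scaleR_right)
  have nKu: "1 \<le> norm (K (u j))" for j
    using z(2)[of j] by (simp add: Ku)
  obtain w r where r: "strict_mono (r :: nat \<Rightarrow> nat)" "(\<lambda>j. K (u (r j))) \<longlonglongrightarrow> w"
    using compact_operator_subseq[OF K_compact, of u 1] nu by blast
  have nw: "1 \<le> norm w"
    using LIMSEQ_le_const[OF tendsto_norm[OF r(2)], of 1] nKu by blast
  have "g \<bar>w\<bar> = 0" if g: "g \<in> G" for g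
  proof -
    have "norm (g \<bar>K (u j)\<bar>) \<le> norm g * inverse (real (Suc j))" for j
    proof -
      have "g \<bar>(K ^\<^sub>L n j) (z j)\<bar> \<le> g ((K ^\<^sub>L n j) \<bar>z j\<bar>)"
        by (intro blinfun_nonneg_mono G g blinfun_nonneg_abs blinfun_nonneg_power K_nonneg)
      also have "\<dots> = g \<bar>z j\<bar>"
        by (intro fixed_functional_power G g)
      also have "\<dots> \<le> norm g * 1"
        using norm_blinfun[of g "\<bar>z j\<bar>"] mult_left_mono[OF z(1)[of j] norm_ge_zero[of g]] by simp
      finally have 1: "g \<bar>(K ^\<^sub>L n j) (z j)\<bar> \<le> norm g" by simp
      have "0 \<le> g \<bar>(K ^\<^sub>L n j) (z j)\<bar>"
        by (intro blinfun_nonneg_apply G g) simp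
      moreover have "g \<bar>K (u j)\<bar> = (1 / (real j + 1)) * g \<bar>(K ^\<^sub>L n j) (z j)\<bar>"
        by (simp add: Ku blinfun.scaleR_right)
      ultimately show ?thesis
        using 1 by (simp add: field_simps)
    qed
    moreover have "(\<lambda>j. norm g * inverse (real (Suc j))) \<longlonglongrightarrow> norm g * 0"
      by (intro tendsto_intros LIMSEQ_inverse_real_of_nat)
    ultimately have "(\<lambda>j. g \<bar>K (u j)\<bar>) \<longlonglongrightarrow> 0"
      by (intro Lim_null_comparison[of "\<lambda>j. g \<bar>K (u j)\<bar>"] always_eventually allI) simp_all
    then have "(\<lambda>j. g \<bar>K (u (r j))\<bar>) \<longlonglongrightarrow> 0"
      using LIMSEQ_subseq_LIMSEQ[OF _ r(1)] by (auto simp: o_def)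
    moreover have "(\<lambda>j. g \<bar>K (u (r j))\<bar>) \<longlonglongrightarrow> g \<bar>w\<bar>"
      by (intro blinfun.tendsto tendsto_const tendsto_abs_lattice r)
    ultimately show ?thesis
      using LIMSEQ_unique by blast
  qed
  then have "\<bar>w\<bar> = 0"
    by (intro G_separates) auto
  then show False using nw by simp
qed

end

text \<open>On the range of \<open>P\<close> the positive operator \<open>J\<close>, a limit of the preceding powers, is the inverse
  of \<open>K\<close>.\<close>

locale recurrent_projection = recurrent_compact_operator K Y G
  for K :: "'a::banach_lattice \<Rightarrow>\<^sub>L 'a" and Y G +
  fixes P J :: "'a \<Rightarrow>\<^sub>L 'a" and e :: "nat \<Rightarrow> nat"
  assumes e1: "1 \<le> e j" and P_lim: "(\<lambda>j. K ^\<^sub>L e j) \<longlonglongrightarrow> P" and J_lim: "(\<lambda>j. K ^\<^sub>L (e j - 1)) \<longlonglongrightarrow> J"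
    and PP: "P o\<^sub>L P = P" and KJ: "K o\<^sub>L J = P" and JK: "J o\<^sub>L K = P"
begin

lemma P_idem [simp]: "P (P z) = P z"
  and KJ_apply: "K (J z) = P z"
  and JK_apply: "J (K z) = P z"
  using arg_cong[OF PP, of "\<lambda>T. T z"] arg_cong[OF KJ, of "\<lambda>T. T z"] arg_cong[OF JK, of "\<lambda>T. T z"]
  by simp_all

lemma PK: "P (K z) = K (P z)"
  by (metis KJ_apply JK_apply)

lemma P_nonneg: "0 \<le> P" and J_nonneg: "0 \<le> J"
  by (rule blinfun_nonneg_limit[OF P_lim] blinfun_nonneg_limit[OF J_lim],
      rule blinfun_nonneg_power[OF K_nonneg])+

lemma P_compact: "compact_operator P"
  using compact_operator_compose_right[OF K_compact, of J] by (simp add: KJ)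

lemma P_fixed_functional:
  fixes g :: "'a \<Rightarrow>\<^sub>L real"
  assumes "g o\<^sub>L K = g" shows "g (P z) = g z"
proof -
  have "(\<lambda>j. g ((K ^\<^sub>L e j) z)) \<longlonglongrightarrow> g (P z)"
    by (intro blinfun.tendsto tendsto_const P_lim)
  then show ?thesis
    by (simp add: fixed_functional_power[OF assms] LIMSEQ_const_iff)
qed

lemma P_fixed_vector:
  assumes "K y = y" shows "P y = y"
proof -
  have "(\<lambda>j. (K ^\<^sub>L e j) y) \<longlonglongrightarrow> P y"
    by (intro blinfun.tendsto tendsto_const P_lim)
  then show ?thesis
    by (simp add: fixed_vector_power[OF assms] LIMSEQ_const_iff)
qed

lemma P_pos:
  assumes "0 < z" shows "0 < P z"
proof -
  have "P z \<noteq> 0"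
  proof
    assume "P z = 0"
    then have "g z = 0" if "g \<in> G" for g
      using P_fixed_functional[OF G(2)[OF that], of z] by simp
    then have "z = 0"
      using assms by (intro G_separates) auto
    then show False using assms by simp
  qed
  then show ?thesis
    using blinfun_nonneg_apply[OF P_nonneg, of z] assms by (simp add: less_le)
qed

definition range_P :: "'a set" where "range_P = {v. P v = v}"

lemma subspace_range_P: "subspace range_P"
  by (auto simp: subspace_def range_P_def blinfun.add_right blinfun.scaleR_right)

text \<open>A strictly positive projection has a sublattice as its range: \<open>|v| \<le> P |v|\<close> for \<open>v = P v\<close>, and the
  fixed functionals do not see the difference.\<close>

lemma abs_range_P: assumes "v \<in> range_P" shows "\<bar>v\<bar> \<in> range_P"
proof -
  have v: "P v = v" using assms by (simp add: range_P_def)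
  have "0 \<le> P \<bar>v\<bar> - \<bar>v\<bar>"
    using blinfun_nonneg_abs[OF P_nonneg, of v] by (simp add: v)
  then have "P \<bar>v\<bar> - \<bar>v\<bar> = 0"
    by (rule G_separates) (simp add: blinfun.diff_right P_fixed_functional[OF G(2)])
  then show ?thesis by (simp add: range_P_def)
qed

lemma exists_basis:
  "\<exists>E. disjoint_positive E (\<lambda>e. e) \<and> E \<subseteq> range_P \<and> (\<forall>v\<in>range_P. \<exists>c. v = (\<Sum>e\<in>E. c e *\<^sub>R e))"
proof -
  obtain N where N: "\<And>E. unit_disjoint range_P E \<Longrightarrow> card E \<le> N"
    using unit_disjoint_card_bounded[OF P_compact, of range_P] by (auto simp: range_P_def)
  have "unit_disjoint range_P {}" by (simp add: unit_disjoint_def)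
  then obtain E where E: "unit_disjoint range_P E" "\<And>F. unit_disjoint range_P F \<Longrightarrow> card F \<le> card E"
    using ex_has_greatest_nat[of "unit_disjoint range_P" "{}" card "Suc N"] N by (metis less_Suc_eq_le)
  interpret maximal_unit_disjoint range_P E
    by unfold_locales (use E subspace_range_P abs_range_P in auto)
  have "disjoint_positive E (\<lambda>e. e)"
    by unfold_locales (use E_props in \<open>auto simp: less_le\<close>)
  then show ?thesis
    using span_maximal E_props(2) by blast
qed

text \<open>A finite sum of elements of \<open>G\<close> is strictly positive on the basis, and then on all of the
  space since \<open>P z\<close> is not \<open>0\<close> for \<open>z > 0\<close>.\<close>

lemma exists_normalised_basis:
  "\<exists>(r::nat) x (f\<^sub>0 :: 'a \<Rightarrow>\<^sub>L real). disjoint_positive {1..r} x \<and> x ` {1..r} \<subseteq> range_P \<and>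
     (\<forall>v\<in>range_P. \<exists>c. v = (\<Sum>i=1..r. c i *\<^sub>R x i)) \<and>
     0 \<le> f\<^sub>0 \<and> f\<^sub>0 o\<^sub>L K = f\<^sub>0 \<and> (\<forall>i\<in>{1..r}. f\<^sub>0 (x i) = 1)"
proof -
  obtain E where E: "disjoint_positive E (\<lambda>e. e)" "E \<subseteq> range_P"
    and span: "\<And>v. v \<in> range_P \<Longrightarrow> \<exists>c. v = (\<Sum>e\<in>E. c e *\<^sub>R e)"
    using exists_basis by blast
  interpret E: disjoint_positive E "\<lambda>e. e" by fact
  have "\<exists>g\<in>G. 0 < g d" if "d \<in> E" for d
  proof (rule ccontr)
    assume "\<not> ?thesis"
    moreover have "0 \<le> g d" if "g \<in> G" for g
      using blinfun_nonneg_apply[OF G(1)[OF that] E.x_nonneg[OF \<open>d \<in> E\<close>]] .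
    ultimately have "g d = 0" if "g \<in> G" for g
      using that by (meson antisym not_le)
    then have "d = 0"
      using E.x_nonneg[OF that] by (intro G_separates) auto
    then show False using E.x_pos[OF that] by simp
  qed
  then obtain g where g: "\<And>d. d \<in> E \<Longrightarrow> g d \<in> G" "\<And>d. d \<in> E \<Longrightarrow> 0 < g d d"
    by metis
  define f where "f = (\<Sum>d\<in>E. g d)"
  have f_apply: "f z = (\<Sum>d\<in>E. g d z)" for z
    unfolding f_def by (simp add: blinfun.sum_left)
  have gnn: "0 \<le> g d z" if "d \<in> E" "0 \<le> z" for d z
    using that g(1) G(1) blinfun_nonneg_apply by blast
  have f0: "0 \<le> f"
    unfolding blinfun_nonneg_iff f_apply using gnn by (auto intro: sum_nonneg)
  have fK: "f o\<^sub>L K = f"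
  proof (rule blinfun_eqI)
    fix z
    have "g d (K z) = g d z" if "d \<in> E" for d
      using arg_cong[OF G(2)[OF g(1)[OF that]], of "\<lambda>T. T z"] by simp
    then show "(f o\<^sub>L K) z = f z" by (simp add: f_apply)
  qed
  have fE: "0 < f d" if "d \<in> E" for d
    unfolding f_apply using that gnn E.x_nonneg g(2) E.fin
    by (intro sum_pos2[of E d]) auto
  obtain b where b: "bij_betw b {1..card E} E"
    using ex_bij_betw_nat_finite_1[OF E.fin] by blast
  define x where "x i = (1 / f (b i)) *\<^sub>R b i" for i
  have bE: "b i \<in> E" if "i \<in> {1..card E}" for i
    using b that by (auto simp: bij_betw_def)
  have "disjoint_positive {1..card E} x"
  proof
    fix i assume i: "i \<in> {1..card E}"
    show "0 < x i"
      using fE[OF bE[OF i]] E.x_pos[OF bE[OF i]] unfolding x_def less_le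
      by (auto intro: scaleR_nonneg_nonneg)
    fix j assume j: "j \<in> {1..card E}" "i \<noteq> j"
    then have "b i \<noteq> b j"
      using b i unfolding bij_betw_def inj_on_def by blast
    then show "inf (x i) (x j) = 0"
      unfolding x_def using fE[OF bE[OF i]] fE[OF bE[OF j(1)]]
      by (intro disjoint_scaleR E.x_disj bE i j) auto
  qed simp
  moreover have "x ` {1..card E} \<subseteq> range_P"
  proof
    fix v assume "v \<in> x ` {1..card E}"
    then obtain i where "i \<in> {1..card E}" "v = x i" by blast
    then show "v \<in> range_P"
      using E(2) bE[of i] unfolding x_def by (auto intro!: subspace_scale[OF subspace_range_P])
  qed
  moreover have "\<exists>c. v = (\<Sum>i=1..card E. c i *\<^sub>R x i)" if v: "v \<in> range_P" for v
  proof -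
    obtain c where c: "v = (\<Sum>d\<in>E. c d *\<^sub>R d)" using span[OF v] by blast
    also have "\<dots> = (\<Sum>i=1..card E. c (b i) *\<^sub>R b i)"
      using sum.reindex_bij_betw[OF b, of "\<lambda>d. c d *\<^sub>R d"] by simp
    also have "\<dots> = (\<Sum>i=1..card E. (c (b i) * f (b i)) *\<^sub>R x i)"
    proof (rule sum.cong[OF refl])
      fix i assume "i \<in> {1..card E}"
      then have "f (b i) \<noteq> 0" using fE[OF bE] by force
      then show "c (b i) *\<^sub>R b i = (c (b i) * f (b i)) *\<^sub>R x i" by (simp add: x_def)
    qed
    finally show ?thesis
      by (intro exI[of _ "\<lambda>i. c (b i) * f (b i)"])
  qed
  moreover have "f (x i) = 1" if "i \<in> {1..card E}" for i
    using fE[OF bE[OF that]] by (simp add: x_def blinfun.scaleR_right)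
  ultimately show ?thesis
    using f0 fK by blast
qed

end

section \<open>Complex-linear operators\<close>

(* Operators on the complexification are handled through algebraic identities, not by components. *)
declare cscale_apply [simp del] complexify_apply [simp del] split_paired_All [simp del] split_paired_Ex [simp del]

lemma cscale_cscale: "cscale z (cscale w v) = cscale (z * w) v"
  by (simp add: cscale_mult)

lemma cscale_left_diff: "cscale (z - w) v = cscale z v - cscale w v"
  by (simp add: cscale_diff blinfun.diff_left)

lemma cscale_1_apply [simp]: "cscale 1 v = v"
  and cscale_0_apply [simp]: "cscale 0 v = 0"
  by simp_all

lemma cscale_inverse_apply [simp]:
  "z \<noteq> 0 \<Longrightarrow> cscale (1 / z) (cscale z v) = v" "z \<noteq> 0 \<Longrightarrow> cscale z (cscale (1 / z) v) = v"
  by (simp_all add: cscale_cscale)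

lemma cscale_eq_0_iff: "cscale z v = 0 \<longleftrightarrow> z = 0 \<or> v = 0"
  by (metis cscale_inverse_apply(1) blinfun.zero_right cscale_0_apply)

lemma norm_cscale_apply: "norm (cscale z v) \<le> 2 * cmod z * norm v"
  by (rule order_trans[OF norm_blinfun mult_right_mono[OF norm_cscale norm_ge_zero]])

lemma norm_le_cscale_apply: "cmod z * norm v \<le> 2 * norm (cscale z v)"
proof (cases "z = 0")
  case False
  have "norm v = norm (cscale (1 / z) (cscale z v))"
    using False by simp
  also have "\<dots> \<le> 2 * cmod (1 / z) * norm (cscale z v)"
    by (rule norm_cscale_apply)
  finally show ?thesis
    using False by (simp add: norm_divide field_simps)
qed simp

definition complex_linear :: "('a::real_normed_vector \<times> 'a) \<Rightarrow>\<^sub>L ('a \<times> 'a) \<Rightarrow> bool" where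
  "complex_linear T \<longleftrightarrow> (\<forall>z v. T (cscale z v) = cscale z (T v))"

lemma complex_linearD: "complex_linear T \<Longrightarrow> blinfun_apply T (cscale z v) = cscale z (blinfun_apply T v)"
  by (simp add: complex_linear_def)

lemma complex_linear_complexify: "complex_linear (complexify T)"
  by (simp add: complex_linear_def cscale_complexify)

lemma complex_linear_cscale: "complex_linear (cscale c)"
  by (simp add: complex_linear_def cscale_cscale mult.commute)

lemma complex_linear_id: "complex_linear id_blinfun"
  by (simp add: complex_linear_def)

lemma complex_linear_compose: "complex_linear S \<Longrightarrow> complex_linear T \<Longrightarrow> complex_linear (S o\<^sub>L T)"
  by (simp add: complex_linear_def)

lemma complex_linear_diff: "complex_linear S \<Longrightarrow> complex_linear T \<Longrightarrow> complex_linear (S - T)"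
  by (simp add: complex_linear_def blinfun.diff_left blinfun.diff_right)

lemma complex_linear_inverse:
  assumes "blinfun_inverses A B" "complex_linear A" shows "complex_linear B"
  unfolding complex_linear_def
proof (intro allI)
  fix z v
  have "cscale z v = A (cscale z (B v))"
    by (simp add: complex_linearD[OF assms(2)] blinfun_inverses_apply(1)[OF assms(1)])
  then show "B (cscale z v) = cscale z (B v)"
    by (simp add: blinfun_inverses_apply(2)[OF assms(1)])
qed

text \<open>The complex-linear extension of a real functional. Vector-valued statements are reduced to
  scalar ones by means of these extensions.\<close>

definition cfunctional :: "('a::real_normed_vector \<Rightarrow>\<^sub>L real) \<Rightarrow> 'a \<times> 'a \<Rightarrow> complex" where
  "cfunctional \<phi> v = Complex (\<phi> (fst v)) (\<phi> (snd v))"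

lemma bounded_linear_cfunctional: "bounded_linear (cfunctional \<phi>)"
proof -
  have "cfunctional \<phi> = (\<lambda>v. of_real (\<phi> (fst v)) + \<i> * of_real (\<phi> (snd v)))"
    by (rule ext) (simp add: cfunctional_def complex_eq_iff)
  moreover have "bounded_linear (\<lambda>v. of_real (\<phi> (fst v)) + \<i> * of_real (\<phi> (snd v)) :: complex)"
    by (intro bounded_linear_add bounded_linear_compose[OF bounded_linear_mult_right]
      bounded_linear_compose[OF bounded_linear_of_real] blinfun.bounded_linear_right
      bounded_linear_compose[OF blinfun.bounded_linear_right bounded_linear_fst]
      bounded_linear_compose[OF blinfun.bounded_linear_right bounded_linear_snd])
  ultimately show ?thesis by simp
qed

lemma cfunctional_cscale: "cfunctional \<phi> (cscale z v) = z * cfunctional \<phi> v"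
  by (simp add: cfunctional_def cscale_apply complex_eq_iff blinfun.add_right blinfun.diff_right
      blinfun.scaleR_right)

lemma cfunctional_add: "cfunctional \<phi> (v + w) = cfunctional \<phi> v + cfunctional \<phi> w"
  and cfunctional_diff: "cfunctional \<phi> (v - w) = cfunctional \<phi> v - cfunctional \<phi> w"
  and cfunctional_sum: "cfunctional \<phi> (sum h A) = (\<Sum>i\<in>A. cfunctional \<phi> (h i))"
  using bounded_linear.linear[OF bounded_linear_cfunctional[of \<phi>]]
  by (simp_all add: linear_add linear_diff linear_sum)

lemma cfunctional_separates:
  assumes "\<And>\<phi>. cfunctional \<phi> v = cfunctional \<phi> w" shows "v = w"
proof -
  have "x = y" if "\<And>\<phi> :: 'a \<Rightarrow>\<^sub>L real. \<phi> x = \<phi> y" for x y :: 'a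
    using exists_norming_functional[of "x - y"] that by (force simp: blinfun.diff_right)
  then have "fst v = fst w" "snd v = snd w"
    using assms by (auto simp: cfunctional_def)
  then show ?thesis by (simp add: prod_eq_iff)
qed

section \<open>Holomorphy of inverses of linear pencils\<close>

text \<open>With \<open>E = 1\<close> the inverse of the pencil is the resolvent. The general form also covers operators that
  agree with \<open>z - K\<close> on a complemented invariant subspace only.\<close>

abbreviation pencil :: "('a::real_normed_vector \<times> 'a) \<Rightarrow>\<^sub>L ('a \<times> 'a) \<Rightarrow> _ \<Rightarrow> complex \<Rightarrow> ('a \<times> 'a) \<Rightarrow>\<^sub>L ('a \<times> 'a)"
  where "pencil E T z \<equiv> (cscale z o\<^sub>L E) - T"

text \<open>The resolvent identity for pencils.\<close>

lemma pencil_inverse_diff: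
  assumes "blinfun_inverses (pencil E T z) V" "blinfun_inverses (pencil E T w) W"
  shows "V v - W v = V (cscale (w - z) (E (W v)))"
proof -
  have "cscale (w - z) (E (W v)) = pencil E T w (W v) - pencil E T z (W v)"
    by (simp add: blinfun.diff_left cscale_left_diff)
  also have "V \<dots> = V v - W v"
    using blinfun_inverses_apply(1)[OF assms(2)] blinfun_inverses_apply(2)[OF assms(1)]
    by (simp add: blinfun.diff_right)
  finally show ?thesis by simp
qed

lemma pencil_invertible_open:
  fixes E :: "('a::banach \<times> 'a) \<Rightarrow>\<^sub>L ('a \<times> 'a)"
  assumes W: "blinfun_inverses (pencil E T w) W" and z: "2 * cmod (w - z) * norm E * norm W < 1"
  shows "\<exists>V. blinfun_inverses (pencil E T z) V"
proof -
  have "norm (cscale (w - z) o\<^sub>L E) * norm W \<le> 2 * cmod (w - z) * norm E * norm W"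
    by (intro mult_right_mono order_trans[OF norm_blinfun_compose] norm_cscale) auto
  then have "norm (cscale (w - z) o\<^sub>L E) * norm W < 1"
    using z by simp
  from blinfun_inverses_perturb[OF W this]
  have "\<exists>V. blinfun_inverses (pencil E T w - (cscale (w - z) o\<^sub>L E)) V" by blast
  moreover have "pencil E T w - (cscale (w - z) o\<^sub>L E) = pencil E T z"
    by (rule blinfun_eqI) (simp add: blinfun.diff_left cscale_left_diff)
  ultimately show ?thesis by simp
qed

text \<open>The resolvent identity first bounds the inverses near a point, then shows their continuity, and
  finally gives the derivative \<open>- W E W\<close>.\<close>

lemma pencil_inverse_holomorphic:
  fixes E :: "('a::banach \<times> 'a) \<Rightarrow>\<^sub>L ('a \<times> 'a)"
  assumes cl: "complex_linear E" "complex_linear T" and \<Omega>: "open \<Omega>"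
    and W: "\<And>z. z \<in> \<Omega> \<Longrightarrow> blinfun_inverses (pencil E T z) (W z)"
  shows "(\<lambda>z. cfunctional \<phi> (W z v)) holomorphic_on \<Omega>"
  unfolding holomorphic_on_open[OF \<Omega>]
proof (intro ballI exI)
  fix w assume w: "w \<in> \<Omega>"
  have clW: "complex_linear (W z)" if "z \<in> \<Omega>" for z
    by (intro complex_linear_inverse[OF W[OF that]] complex_linear_diff complex_linear_compose
        complex_linear_cscale cl)
  have diff: "W z - W w = W z o\<^sub>L (cscale (w - z) o\<^sub>L (E o\<^sub>L W w))" if "z \<in> \<Omega>" for z
    by (rule blinfun_eqI)
      (simp add: blinfun.diff_left pencil_inverse_diff[OF W[OF that] W[OF w]])
  let ?c = "\<lambda>z. 2 * cmod (w - z) * norm (E o\<^sub>L W w)"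
  have nd: "norm (W z - W w) \<le> norm (W z) * ?c z" if "z \<in> \<Omega>" for z
    unfolding diff[OF that]
    by (intro order_trans[OF norm_blinfun_compose] mult_left_mono mult_right_mono norm_cscale norm_ge_zero)
  have lim0: "(?c \<longlongrightarrow> 2 * cmod (w - w) * norm (E o\<^sub>L W w)) (at w)"
    by (intro tendsto_intros)
  then have lim: "(?c \<longlongrightarrow> 0) (at w)" by simp
  have ev\<Omega>: "\<forall>\<^sub>F z in at w. z \<in> \<Omega>"
    using \<Omega> w eventually_at_topological by blast
  have ev_small: "\<forall>\<^sub>F z in at w. ?c z < 1 / 2"
    by (rule order_tendstoD(2)[OF lim]) simp
  have bound: "norm (W z - W w) \<le> 2 * norm (W w) * ?c z" if "z \<in> \<Omega>" "?c z < 1 / 2" for z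
  proof -
    have "norm (W z) * ?c z \<le> norm (W z) * (1 / 2)"
      using that(2) by (intro mult_left_mono) auto
    then have "norm (W z) \<le> 2 * norm (W w)"
      using nd[OF that(1)] norm_triangle_ineq2[of "W z" "W w"] by linarith
    then show ?thesis
      by (intro order_trans[OF nd[OF that(1)]] mult_right_mono) auto
  qed
  have "((\<lambda>z. 2 * norm (W w) * ?c z) \<longlongrightarrow> 2 * norm (W w) * 0) (at w)"
    by (intro tendsto_mult tendsto_const lim)
  moreover have "\<forall>\<^sub>F z in at w. norm (W z - W w) \<le> 2 * norm (W w) * ?c z"
    using ev\<Omega> ev_small by eventually_elim (rule bound)
  ultimately have "((\<lambda>z. W z - W w) \<longlongrightarrow> 0) (at w)"
    by (intro Lim_null_comparison[of "\<lambda>z. W z - W w"]) auto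
  then have Wlim: "(W \<longlongrightarrow> W w) (at w)"
    by (simp add: LIM_zero_iff)
  have "((\<lambda>z. - cfunctional \<phi> (W z (E (W w v)))) \<longlongrightarrow> - cfunctional \<phi> (W w (E (W w v)))) (at w)"
    by (intro tendsto_minus bounded_linear.tendsto[OF bounded_linear_cfunctional] blinfun.tendsto
        Wlim tendsto_const)
  then show "((\<lambda>z. cfunctional \<phi> (W z v)) has_field_derivative - cfunctional \<phi> (W w (E (W w v)))) (at w)"
    unfolding has_field_derivative_iff
  proof (rule Lim_transform_eventually)
    show "\<forall>\<^sub>F z in at w. - cfunctional \<phi> (W z (E (W w v)))
        = (cfunctional \<phi> (W z v) - cfunctional \<phi> (W w v)) / (z - w)"
      using ev\<Omega> eventually_neq_at_within[of w w UNIV]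
    proof eventually_elim
      case (elim z)
      have "cfunctional \<phi> (W z v) - cfunctional \<phi> (W w v) = (w - z) * cfunctional \<phi> (W z (E (W w v)))"
        by (simp add: pencil_inverse_diff[OF W[OF elim(1)] W[OF w]] complex_linearD[OF clW[OF elim(1)]]
            cfunctional_cscale flip: cfunctional_diff)
      then show ?case
        using elim(2) by (simp add: field_simps)
    qed
  qed
qed

lemma blinfun_inverses_resolvent:
  assumes "z \<notin> spectrum T" shows "blinfun_inverses (cscale z - complexify T) (resolvent T z)"
proof -
  obtain B where B: "blinfun_inverses (cscale z - complexify T) B"
    using assms by (auto simp: spectrum_def)
  show ?thesis
    unfolding resolvent_def by (rule theI[of _ B]) (use B blinfun_inverses_unique in blast)+
qed

lemma pencil_id: "pencil id_blinfun T z = cscale z - T"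
  by (rule blinfun_eqI) (simp add: blinfun.diff_left)

lemma open_resolvent_set:
  fixes T :: "'a::banach \<Rightarrow>\<^sub>L 'a"
  shows "open (- spectrum T)"
  unfolding open_dist
proof
  fix w assume "w \<in> - spectrum T"
  then obtain W where W: "blinfun_inverses (pencil id_blinfun (complexify T) w) W"
    by (auto simp: spectrum_def pencil_id)
  let ?n = "2 * norm (id_blinfun :: ('a \<times> 'a) \<Rightarrow>\<^sub>L _) * norm W + 1"
  have n: "0 < ?n"
    by (simp add: add_nonneg_pos)
  have "z \<in> - spectrum T" if "dist z w < 1 / ?n" for z
  proof -
    have "cmod (w - z) * ?n < 1"
      using that n by (simp add: dist_norm norm_minus_commute field_simps)
    then have "2 * cmod (w - z) * norm (id_blinfun :: ('a \<times> 'a) \<Rightarrow>\<^sub>L _) * norm W < 1"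
      using norm_ge_zero[of "w - z"] by (simp add: algebra_simps del: norm_ge_zero)
    from pencil_invertible_open[OF W this] show ?thesis
      by (simp add: spectrum_def pencil_id)
  qed
  then show "\<exists>e>0. \<forall>z. dist z w < e \<longrightarrow> z \<in> - spectrum T"
    using n by (intro exI[of _ "1 / ?n"]) auto
qed

lemma complex_linear_resolvent:
  assumes "z \<notin> spectrum T" shows "complex_linear (resolvent T z)"
  using blinfun_inverses_resolvent[OF assms]
  by (rule complex_linear_inverse) (intro complex_linear_diff complex_linear_cscale complex_linear_complexify)

section \<open>The spectrum of a compact operator is countable\<close>

lemma compact_operator_complexify:
  assumes "compact_operator T" shows "compact_operator (complexify T)"
proof (rule compact_operatorI)
  fix u :: "nat \<Rightarrow> 'a \<times> 'a" assume u: "\<And>n. norm (u n) \<le> 1"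
  have u1: "norm (fst (u n)) \<le> 1" "norm (snd (u n)) \<le> 1" for n
    using order_trans[OF norm_fst_le[of "fst (u n)" "snd (u n)"], of 1]
      order_trans[OF norm_snd_le[of "snd (u n)" "fst (u n)"], of 1] u[of n] by simp_all
  obtain l r where r: "strict_mono (r :: nat \<Rightarrow> nat)" "(\<lambda>n. T (fst (u (r n)))) \<longlonglongrightarrow> l"
    using compact_operator_subseq[OF assms, of "\<lambda>n. fst (u n)", OF u1(1)] .
  obtain m q where q: "strict_mono (q :: nat \<Rightarrow> nat)" "(\<lambda>n. T (snd (u (r (q n))))) \<longlonglongrightarrow> m"
    using compact_operator_subseq[OF assms, of "\<lambda>n. snd (u (r n))", OF u1(2)] .
  have "(\<lambda>n. T (fst (u (r (q n))))) \<longlonglongrightarrow> l"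
    using LIMSEQ_subseq_LIMSEQ[OF r(2) q(1)] by (simp add: o_def)
  then have "(\<lambda>n. complexify T (u ((r \<circ> q) n))) \<longlonglongrightarrow> (l, m)"
    using q(2) by (simp add: complexify_apply tendsto_Pair)
  then show "\<exists>l r. strict_mono (r :: nat \<Rightarrow> nat) \<and> (\<lambda>n. complexify T (u (r n))) \<longlonglongrightarrow> l"
    using strict_mono_o[OF r(1) q(1)] by blast
qed

definition eigenvalues :: "('a::real_normed_vector \<Rightarrow>\<^sub>L 'a) \<Rightarrow> complex set" where
  "eigenvalues T = {z. \<exists>v. v \<noteq> 0 \<and> complexify T v = cscale z v}"

text \<open>The normalised difference between \<open>v\<close> and a point of \<open>M\<close> whose distance to \<open>v\<close> is less than twice the
  infimum.\<close>

lemma riesz_lemma: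
  fixes v :: "'a::real_normed_vector"
  assumes M: "closed M" "subspace M" "M \<subseteq> N" and N: "subspace N" "v \<in> N" "v \<notin> M"
  shows "\<exists>u\<in>N. norm u = 1 \<and> (\<forall>m\<in>M. 1 / 2 \<le> norm (u - m))"
proof -
  have ne: "M \<noteq> {}" using subspace_0[OF M(2)] by auto
  define d where "d = infdist v M"
  have d: "0 < d"
    unfolding d_def using M(1) ne N(3) by (rule infdist_pos_not_in_closed)
  have "(INF a\<in>M. dist v a) < 2 * d"
    using d ne by (simp add: d_def infdist_notempty)
  then obtain m0 where m0: "m0 \<in> M" "dist v m0 < 2 * d"
    using cInf_lessD[of "dist v ` M"] ne by auto
  define c where "c = norm (v - m0)"
  have c: "0 < c" "c < 2 * d"
    using m0 N(3) by (auto simp: c_def dist_norm)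
  let ?u = "(1 / c) *\<^sub>R (v - m0)"
  have "1 / 2 \<le> norm (?u - m)" if m: "m \<in> M" for m
  proof -
    have "m0 + c *\<^sub>R m \<in> M"
      using M(2) m m0(1) by (intro subspace_add subspace_scale)
    then have "d \<le> norm (v - (m0 + c *\<^sub>R m))"
      unfolding d_def using infdist_le by (metis dist_norm)
    also have "v - (m0 + c *\<^sub>R m) = c *\<^sub>R (?u - m)"
      using c by (simp add: scaleR_right_diff_distrib)
    also have "norm \<dots> = c * norm (?u - m)"
      using c by simp
    finally have "d / c \<le> norm (?u - m)"
      using c by (simp add: field_simps)
    moreover have "1 / 2 \<le> d / c"
      using c by (simp add: field_simps)
    ultimately show ?thesis by linarith
  qed
  moreover have "?u \<in> N"
    using N M(3) m0(1) by (intro subspace_scale subspace_diff) auto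
  moreover have "norm ?u = 1"
    using c by (simp add: c_def)
  ultimately show ?thesis by blast
qed

primrec root_product :: "(nat \<Rightarrow> complex) \<Rightarrow> ('a::real_normed_vector \<times> 'a) \<Rightarrow>\<^sub>L ('a \<times> 'a) \<Rightarrow> nat \<Rightarrow> ('a \<times> 'a) \<Rightarrow>\<^sub>L ('a \<times> 'a)"
where
  "root_product l T 0 = id_blinfun"
| "root_product l T (Suc n) = (T - cscale (l n)) o\<^sub>L root_product l T n"

lemma root_product_commute:
  assumes "complex_linear T"
  shows "root_product l T n (T v) = T (root_product l T n v)"
    and "root_product l T n (cscale z v) = cscale z (root_product l T n v)"
proof (induction n arbitrary: v)
  case (Suc n)
  {
    case 1
    show ?case by (simp add: Suc blinfun.diff_left blinfun.diff_right complex_linearD[OF assms])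
  next
    case 2
    show ?case
      by (simp add: Suc blinfun.diff_left blinfun.diff_right complex_linearD[OF assms] cscale_cscale mult.commute)
  }
qed simp_all

text \<open>The kernels of the products \<open>(T - l\<^sub>0) \<cdots> (T - l\<^bsub>n-1\<^esub>)\<close> for distinct eigenvalues \<open>l\<^sub>i\<close>
  form a strictly increasing chain of closed subspaces, and the images under \<open>T\<close> of almost orthogonal
  unit vectors of the chain stay apart. Kernels are used in place of spans of eigenvectors since they
  are visibly closed.\<close>

lemma finite_eigenvalues_outside_disc:
  assumes cT: "compact_operator T" and e: "0 < e"
  shows "finite {z \<in> eigenvalues T. e \<le> cmod z}"
proof (rule ccontr)
  assume "infinite {z \<in> eigenvalues T. e \<le> cmod z}"
  then obtain l :: "nat \<Rightarrow> complex" where inj: "inj l" and l: "range l \<subseteq> {z \<in> eigenvalues T. e \<le> cmod z}"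
    using infinite_countable_subset by blast
  let ?T = "complexify T" and ?p = "root_product l (complexify T)"
  have le: "e \<le> cmod (l n)" for n using l by auto
  have "\<exists>v. v \<noteq> 0 \<and> ?T v = cscale (l n) v" for n
    using l by (auto simp: eigenvalues_def)
  then obtain v where v: "\<And>n. v n \<noteq> 0" "\<And>n. ?T (v n) = cscale (l n) (v n)" by metis
  note comm = root_product_commute[OF complex_linear_complexify]
  define N where "N n = {w. ?p n w = 0}" for n
  have subN: "subspace (N n)" for n
    by (auto simp: N_def subspace_def blinfun.add_right blinfun.scaleR_right)
  have closedN: "closed (N n)" for n
    unfolding N_def by (intro closed_Collect_eq continuous_intros)
  have N_Suc: "N n \<subseteq> N (Suc n)" for n by (auto simp: N_def)
  have N_mono: "N m \<subseteq> N n" if "m \<le> n" for m n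
    using lift_Suc_mono_le[of N, OF N_Suc that] .
  have N_cscale: "cscale z w \<in> N n" if "w \<in> N n" for z w n
    using that by (simp add: N_def comm)
  have N_T: "?T w \<in> N n" if "w \<in> N n" for w n
    using that by (simp add: N_def comm)
  have down: "?T w - cscale (l n) w \<in> N n" if "w \<in> N (Suc n)" for w n
    using that by (simp add: N_def comm blinfun.diff_left blinfun.diff_right)
  have pv: "\<exists>c. (c \<noteq> 0 \<longleftrightarrow> k \<notin> {..<n}) \<and> ?p n (v k) = cscale c (v k)" for n k
  proof (induction n)
    case 0
    show ?case by (intro exI[of _ 1]) simp
  next
    case (Suc n)
    then obtain c where c: "c \<noteq> 0 \<longleftrightarrow> k \<notin> {..<n}" "?p n (v k) = cscale c (v k)" by blast
    have "?p (Suc n) (v k) = cscale ((l k - l n) * c) (v k)"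
      by (simp add: c(2) blinfun.diff_left cscale_complexify[symmetric] v(2) cscale_cscale
          cscale_left_diff[symmetric] algebra_simps)
    moreover have "(l k - l n) * c \<noteq> 0 \<longleftrightarrow> k \<notin> {..<Suc n}"
      using c(1) inj by (auto simp: less_Suc_eq inj_eq)
    ultimately show ?case by blast
  qed
  have "v n \<in> N (Suc n)" "v n \<notin> N n" for n
    using pv[where k = n and n = n] pv[where k = n and n = "Suc n"] v(1)[of n]
    by (auto simp: N_def cscale_eq_0_iff simp del: root_product.simps)
  then have "\<exists>u\<in>N (Suc n). norm u = 1 \<and> (\<forall>m\<in>N n. 1 / 2 \<le> norm (u - m))" for n
    using riesz_lemma[OF closedN subN N_Suc subN] by blast
  then obtain u where u: "\<And>n. u n \<in> N (Suc n)" "\<And>n. norm (u n) = 1"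
    "\<And>n m. m \<in> N n \<Longrightarrow> 1 / 2 \<le> norm (u n - m)" by metis
  have apart: "e / 4 \<le> norm (?T (u n) - ?T (u m))" if "m < n" for m n
  proof -
    have ln: "l n \<noteq> 0" using le[of n] e by auto
    define y where "y = (?T (u n) - cscale (l n) (u n)) - ?T (u m)"
    have "?T (u m) \<in> N n"
      using N_mono[of "Suc m" n] that N_T[OF u(1)[of m]] by auto
    then have "y \<in> N n"
      unfolding y_def by (intro subspace_diff[OF subN] down u)
    then have "- cscale (1 / l n) y \<in> N n"
      by (intro subspace_neg[OF subN] N_cscale)
    then have "1 / 2 \<le> norm (u n - - cscale (1 / l n) y)" by (rule u(3))
    then have "e * (1 / 2) \<le> cmod (l n) * norm (u n + cscale (1 / l n) y)"
      using le[of n] e by (intro mult_mono) auto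
    also have "\<dots> \<le> 2 * norm (cscale (l n) (u n + cscale (1 / l n) y))"
      by (rule norm_le_cscale_apply)
    also have "cscale (l n) (u n + cscale (1 / l n) y) = ?T (u n) - ?T (u m)"
      using ln by (simp add: blinfun.add_right y_def)
    finally show ?thesis by simp
  qed
  obtain w r where r: "strict_mono (r :: nat \<Rightarrow> nat)" "(\<lambda>n. ?T (u (r n))) \<longlonglongrightarrow> w"
    using compact_operator_subseq[OF compact_operator_complexify[OF cT], of u 1] u(2) by (metis order_refl)
  have "Cauchy (\<lambda>n. ?T (u (r n)))"
    using r(2) by (rule LIMSEQ_imp_Cauchy)
  then obtain k where "\<forall>m\<ge>k. \<forall>n\<ge>k. norm (?T (u (r m)) - ?T (u (r n))) < e / 4"
    using CauchyD[of _ "e / 4"] e by fastforce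
  then have "norm (?T (u (r (Suc k))) - ?T (u (r k))) < e / 4" by simp
  moreover have "r k < r (Suc k)"
    using r(1) by (simp add: strict_mono_Suc_iff)
  ultimately show False
    using apart by fastforce
qed

text \<open>At a boundary point of the spectrum the resolvent blows up, which produces approximate
  eigenvectors. For compact operators these accumulate at an eigenvector.\<close>

lemma frontier_spectrum_eigenvalue:
  fixes T :: "'a::banach \<Rightarrow>\<^sub>L 'a"
  assumes cT: "compact_operator T" and w: "w \<in> frontier (spectrum T)" "w \<noteq> 0"
  shows "w \<in> eigenvalues T"
proof -
  have cl: "closed (spectrum T)"
    using open_resolvent_set[of T] by (simp add: closed_def)
  have ws: "w \<in> spectrum T"
    using w(1) cl by (auto simp: frontier_def)
  have "w \<in> closure (- spectrum T)"
    using w(1) by (simp add: frontier_closures)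
  then obtain z where z: "\<And>n. z n \<notin> spectrum T" "z \<longlonglongrightarrow> w"
    unfolding closure_sequential by auto
  let ?R = "\<lambda>n. resolvent T (z n)" and ?T = "complexify T"
  have inv: "blinfun_inverses (cscale (z n) - ?T) (?R n)" for n
    by (rule blinfun_inverses_resolvent[OF z(1)])
  have big: "1 \<le> 2 * cmod (z n - w) * norm (?R n)" for n
  proof (rule ccontr)
    assume "\<not> ?thesis"
    then have small: "2 * cmod (z n - w) * norm (?R n) < 1" by simp
    have "2 * cmod (z n - w) * norm (id_blinfun :: ('a \<times> 'a) \<Rightarrow>\<^sub>L _) * norm (?R n)
        \<le> 2 * cmod (z n - w) * 1 * norm (?R n)"
      by (intro mult_right_mono mult_left_mono norm_blinfun_id_le) auto
    then have "2 * cmod (z n - w) * norm (id_blinfun :: ('a \<times> 'a) \<Rightarrow>\<^sub>L _) * norm (?R n) < 1"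
      using small by simp
    from pencil_invertible_open[OF _ this, of ?T] inv ws show False
      by (auto simp: pencil_id spectrum_def)
  qed
  have "\<exists>v. norm v \<le> 1 \<and> norm (?R n) / 2 < norm (?R n v)" for n
  proof (rule ccontr)
    assume "\<not> ?thesis"
    then have "norm (?R n) \<le> norm (?R n) / 2"
      by (intro norm_blinfun_le_unit_ball) (auto simp: not_less)
    then show False using big[of n] by simp
  qed
  then obtain v where v: "\<And>n. norm (v n) \<le> 1" "\<And>n. norm (?R n) / 2 < norm (?R n (v n))" by metis
  define c where "c n = norm (?R n (v n))" for n
  have c0: "0 < c n" for n
    using v(2)[of n] norm_ge_zero[of "?R n"] unfolding c_def by linarith
  define u where "u n = (1 / c n) *\<^sub>R ?R n (v n)" for n
  have nu: "norm (u n) = 1" for n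
    using c0[of n] by (simp add: u_def c_def)
  have Tu: "?T (u n) = cscale (z n) (u n) - (1 / c n) *\<^sub>R v n" for n
    using blinfun_inverses_apply(1)[OF inv[of n], of "v n"]
    by (simp add: u_def blinfun.scaleR_right blinfun.diff_left algebra_simps flip: scaleR_right_diff_distrib)
  have "norm ((1 / c n) *\<^sub>R v n) \<le> 4 * cmod (z n - w)" for n
  proof -
    have "1 \<le> 4 * cmod (z n - w) * c n"
    proof -
      have "2 * cmod (z n - w) * norm (?R n) \<le> 2 * cmod (z n - w) * (2 * c n)"
        using v(2)[of n] by (intro mult_left_mono) (auto simp: c_def)
      then have "1 \<le> 2 * cmod (z n - w) * (2 * c n)"
        using big[of n] by (rule order_trans[rotated])
      then show ?thesis by (simp add: mult_ac)
    qed
    then have "1 / c n \<le> 4 * cmod (z n - w)"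
      using c0[of n] by (simp add: field_simps)
    moreover have "norm ((1 / c n) *\<^sub>R v n) \<le> 1 / c n"
      using v(1)[of n] c0[of n] by (simp add: field_simps)
    ultimately show ?thesis by linarith
  qed
  then have ev: "\<forall>\<^sub>F n in sequentially. norm ((1 / c n) *\<^sub>R v n) \<le> 4 * cmod (z n - w)"
    by (intro always_eventually allI)
  have "(\<lambda>n. 4 * cmod (z n - w)) \<longlonglongrightarrow> 4 * cmod (w - w)"
    by (intro tendsto_intros z)
  then have small: "(\<lambda>n. (1 / c n) *\<^sub>R v n) \<longlonglongrightarrow> 0"
    by (intro Lim_null_comparison[OF ev]) simp
  obtain y r where r: "strict_mono (r :: nat \<Rightarrow> nat)" "(\<lambda>n. ?T (u (r n))) \<longlonglongrightarrow> y"
    using compact_operator_subseq[OF compact_operator_complexify[OF cT], of u 1] nu by (metis order_refl)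
  have zr: "(\<lambda>n. z (r n)) \<longlonglongrightarrow> w" and sr: "(\<lambda>n. (1 / c (r n)) *\<^sub>R v (r n)) \<longlonglongrightarrow> 0"
    using LIMSEQ_subseq_LIMSEQ[OF z(2) r(1)] LIMSEQ_subseq_LIMSEQ[OF small r(1)] by (simp_all add: o_def)
  have "(\<lambda>n. ?T (u (r n)) + (1 / c (r n)) *\<^sub>R v (r n)) \<longlonglongrightarrow> y + 0"
    by (intro tendsto_add r sr)
  then have 1: "(\<lambda>n. cscale (z (r n)) (u (r n))) \<longlonglongrightarrow> y"
    by (simp add: Tu)
  have "(\<lambda>n. cscale (w - z (r n)) (u (r n))) \<longlonglongrightarrow> 0"
  proof (rule Lim_null_comparison)
    have "norm (cscale (w - z (r n)) (u (r n))) \<le> 2 * cmod (w - z (r n))" for n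
      using norm_cscale_apply[of "w - z (r n)" "u (r n)"] by (simp add: nu)
    then show "\<forall>\<^sub>F n in sequentially. norm (cscale (w - z (r n)) (u (r n))) \<le> 2 * cmod (w - z (r n))"
      by simp
    have "(\<lambda>n. 2 * cmod (w - z (r n))) \<longlonglongrightarrow> 2 * cmod (w - w)"
      by (intro tendsto_intros zr)
    then show "(\<lambda>n. 2 * cmod (w - z (r n))) \<longlonglongrightarrow> 0" by simp
  qed
  from tendsto_add[OF 1 this] have "(\<lambda>n. cscale w (u (r n))) \<longlonglongrightarrow> y"
    by (simp add: cscale_left_diff)
  then have "(\<lambda>n. cscale (1 / w) (cscale w (u (r n)))) \<longlonglongrightarrow> cscale (1 / w) y"
    by (intro blinfun.tendsto tendsto_const)
  then have ulim: "(\<lambda>n. u (r n)) \<longlonglongrightarrow> cscale (1 / w) y"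
    using w(2) by simp
  have "norm (cscale (1 / w) y) = 1"
    using tendsto_norm[OF ulim] by (simp add: nu LIMSEQ_const_iff)
  moreover have "(\<lambda>n. ?T (u (r n))) \<longlonglongrightarrow> ?T (cscale (1 / w) y)"
    by (intro blinfun.tendsto tendsto_const ulim)
  then have "?T (cscale (1 / w) y) = cscale w (cscale (1 / w) y)"
    using r(2) LIMSEQ_unique w(2) by auto
  ultimately show ?thesis
    unfolding eigenvalues_def by (intro CollectI exI[of _ "cscale (1 / w) y"]) auto
qed

text \<open>A set with countable frontier is countable or co-countable, as the complement of the frontier is
  connected, and the spectrum is bounded.\<close>

lemma countable_spectrum:
  fixes T :: "'a::banach \<Rightarrow>\<^sub>L 'a"
  assumes cT: "compact_operator T" shows "countable (spectrum T)"
proof -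
  have "eigenvalues T - {0} \<subseteq> (\<Union>n. {z \<in> eigenvalues T. 1 / real (Suc n) \<le> cmod z})"
  proof
    fix z assume z: "z \<in> eigenvalues T - {0}"
    then obtain n where "inverse (real (Suc n)) < cmod z"
      using reals_Archimedean[of "cmod z"] by auto
    then show "z \<in> (\<Union>n. {z \<in> eigenvalues T. 1 / real (Suc n) \<le> cmod z})"
      using z by (auto simp: inverse_eq_divide intro!: exI[of _ n])
  qed
  moreover have "countable (\<Union>n. {z \<in> eigenvalues T. 1 / real (Suc n) \<le> cmod z})"
  proof (rule countable_UN)
    show "countable {z \<in> eigenvalues T. 1 / real (Suc n) \<le> cmod z}" for n
      by (intro countable_finite finite_eigenvalues_outside_disc cT) simp
  qed simp
  ultimately have "countable (insert 0 (eigenvalues T - {0}))"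
    using countable_subset by blast
  moreover have "frontier (spectrum T) \<subseteq> insert 0 (eigenvalues T - {0})"
    using frontier_spectrum_eigenvalue[OF cT] by auto
  ultimately have count: "countable (frontier (spectrum T))"
    using countable_subset by blast
  then have "connected (- frontier (spectrum T))"
    by (intro path_connected_imp_connected path_connected_complement_countable) auto
  moreover have cl: "closed (spectrum T)"
    using open_resolvent_set[of T] by (simp add: closed_def)
  have "frontier (spectrum T) \<subseteq> spectrum T"
    using cl by (rule frontier_subset_closed)
  moreover have "of_real (norm T + 1) \<notin> spectrum T"
  proof
    assume *: "of_real (norm T + 1) \<in> spectrum T"
    have "spectrum T \<subseteq> cball 0 (norm T)"
      by (rule spectrum_subset_cball[of T 1]) (auto simp: norm_blinfun_power)
    then have "cmod (of_real (norm T + 1)) \<le> norm T"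
      using * by auto
    moreover have "a < cmod (of_real (a + 1))" for a
      unfolding norm_of_real by linarith
    ultimately show False
      by (meson not_le)
  qed
  ultimately have "- frontier (spectrum T) \<inter> spectrum T = {}"
    using connected_Int_frontier[of "- frontier (spectrum T)" "spectrum T"] by blast
  then have "spectrum T \<subseteq> frontier (spectrum T)" by blast
  then show ?thesis using count countable_subset by blast
qed

section \<open>Contour integrals of the resolvent\<close>

text \<open>The resolvent has local primitives, obtained by integrating its geometric expansion
  term by term.\<close>

lemma resolvent_local_primitive:
  fixes T :: "'a::banach \<Rightarrow>\<^sub>L 'a"
  assumes w: "w \<notin> spectrum T"
  obtains d \<Phi> where "0 < d" "\<And>z. z \<in> ball w d \<Longrightarrow> (\<Phi> has_derivative (\<lambda>h. cscale h o\<^sub>L resolvent T z)) (at z)"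
proof -
  let ?R = "resolvent T w"
  obtain d0 where d0: "0 < d0" "ball w d0 \<subseteq> - spectrum T"
    using open_resolvent_set[of T] w by (meson ComplI openE)
  define n1 where "n1 = norm ?R + 1"
  have n1: "0 < n1" "norm ?R \<le> n1"
    using norm_ge_zero[of ?R] unfolding n1_def by (auto simp: add_nonneg_pos)
  define d where "d = min d0 (1 / (8 * n1))"
  have d: "0 < d" "d \<le> d0" "d \<le> 1 / (8 * n1)"
    using d0 n1 by (auto simp: d_def)
  define Q where "Q z = cscale (w - z) o\<^sub>L ?R" for z
  have clR: "complex_linear ?R"
    by (rule complex_linear_resolvent[OF w])
  have nQ: "norm (Q z) \<le> 1 / 4" if "z \<in> ball w d" for z
  proof -
    have "cmod (w - z) \<le> 1 / (8 * n1)"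
      using that d(3) by (simp add: dist_norm)
    then have "2 * cmod (w - z) * norm ?R \<le> 2 * (1 / (8 * n1)) * n1"
      using n1 by (intro mult_mono) auto
    also have "\<dots> = 1 / 4"
      using n1 by simp
    finally show ?thesis
      unfolding Q_def
      by (intro order_trans[OF norm_blinfun_compose order_trans[OF mult_right_mono[OF norm_cscale norm_ge_zero]]])
  qed
  have zs: "z \<notin> spectrum T" if "z \<in> ball w d" for z
    using that d(2) d0(2) by (meson ComplD mem_ball order_less_le_trans subsetD)
  have ident: "resolvent T z v = ?R v + resolvent T z (Q z v)" if "z \<in> ball w d" for z v
    using pencil_inverse_diff[where E = id_blinfun and T = "complexify T" and z = z and w = w
        and V = "resolvent T z" and W = ?R and v = v]
      blinfun_inverses_resolvent[OF zs[OF that]] blinfun_inverses_resolvent[OF w]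
    by (simp add: pencil_id Q_def diff_eq_eq add.commute)
  have nR: "norm (resolvent T z) \<le> 2 * norm ?R" if z: "z \<in> ball w d" for z
  proof -
    have "resolvent T z = ?R + (resolvent T z o\<^sub>L Q z)"
      by (rule blinfun_eqI) (simp add: blinfun.add_left ident[OF z, symmetric])
    then have "norm (resolvent T z) \<le> norm ?R + norm (resolvent T z o\<^sub>L Q z)"
      by (metis norm_triangle_ineq)
    also have "norm (resolvent T z o\<^sub>L Q z) \<le> norm (resolvent T z) * (1 / 4)"
      by (intro order_trans[OF norm_blinfun_compose] mult_left_mono nQ z norm_ge_zero)
    finally show ?thesis
      using norm_ge_zero[of ?R] by linarith
  qed
  have Qpow: "(Q z ^\<^sub>L n) v = cscale ((w - z) ^ n) ((?R ^\<^sub>L n) v)" for z n v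
    by (induction n) (simp_all add: Q_def complex_linearD[OF clR] cscale_cscale)
  define f where "f i z = cscale (- ((w - z) ^ Suc i / of_nat (Suc i))) o\<^sub>L (?R ^\<^sub>L Suc i)" for i z
  define f' where "f' i z h = cscale ((w - z) ^ i * h) o\<^sub>L (?R ^\<^sub>L Suc i)" for i and z h :: complex
  have "\<exists>g. \<forall>z\<in>ball w d. (\<lambda>n. f n z) sums (g z)
      \<and> (g has_derivative (\<lambda>h. cscale h o\<^sub>L resolvent T z)) (at z within ball w d)"
  proof (rule has_derivative_series)
    show "convex (ball w d)" "w \<in> ball w d"
      using d(1) by auto
    show "(\<lambda>n. f n w) sums 0"
      by (simp add: f_def blinfun_compose_zero)
    fix n :: nat and z assume z: "z \<in> ball w d"
    have "((\<lambda>z. - ((w - z) ^ Suc n / of_nat (Suc n))) has_field_derivative (w - z) ^ n) (at z within ball w d)"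
    proof -
      have D: "((\<lambda>z. (w - z) ^ Suc n) has_field_derivative - (of_nat (Suc n) * (w - z) ^ n)) (at z within ball w d)"
      proof -
        have "((\<lambda>z. w - z) has_field_derivative - 1) (at z within ball w d)"
          by (auto intro!: derivative_eq_intros)
        from DERIV_power_Suc[OF this, of n] show ?thesis by (simp add: algebra_simps)
      qed
      have "of_nat (Suc n) \<noteq> (0 :: complex)"
        by (rule of_nat_neq_0)
      then have "- (- (of_nat (Suc n) * (w - z) ^ n) / of_nat (Suc n)) = (w - z) ^ n"
        by (simp del: of_nat_Suc)
      with DERIV_minus[OF DERIV_cdivide[OF D, of "of_nat (Suc n)"]] show ?thesis
        by simp
    qed
    then have "((\<lambda>z. - ((w - z) ^ Suc n / of_nat (Suc n))) has_derivative (*) ((w - z) ^ n)) (at z within ball w d)"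
      by (simp only: has_field_derivative_def)
    then show "(f n has_derivative f' n z) (at z within ball w d)"
      unfolding f_def f'_def
      by (intro bounded_linear.has_derivative[OF bounded_linear_compose[OF
          bounded_bilinear.bounded_linear_left[OF bounded_bilinear_blinfun_compose] bounded_linear_cscale]])
  next
    have partial: "(\<Sum>i<n. f' i z h) v - (cscale h o\<^sub>L resolvent T z) v = - cscale h (resolvent T z ((Q z ^\<^sub>L n) v))"
      if z: "z \<in> ball w d" for z h n v
    proof (induction n)
      case 0
      then show ?case by simp
    next
      case (Suc n)
      have "f' n z h v = cscale h (?R ((Q z ^\<^sub>L n) v))"
        by (simp add: f'_def Qpow complex_linearD[OF clR] cscale_cscale mult.commute)
      moreover have "cscale h (resolvent T z ((Q z ^\<^sub>L n) v))
          = cscale h (?R ((Q z ^\<^sub>L n) v)) + cscale h (resolvent T z (Q z ((Q z ^\<^sub>L n) v)))"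
        using ident[OF z, of "(Q z ^\<^sub>L n) v"] by (simp add: blinfun.add_right)
      ultimately show ?case
        using Suc by (simp add: blinfun.add_left algebra_simps)
    qed
    fix e :: real assume e: "0 < e"
    have "(\<lambda>n. 4 * norm ?R * (1 / 4) ^ n) \<longlonglongrightarrow> 4 * norm ?R * 0"
      by (intro tendsto_intros LIMSEQ_power_zero) simp
    then have "\<forall>\<^sub>F n in sequentially. 4 * norm ?R * (1 / 4) ^ n < e"
      using e by (intro order_tendstoD(2)) auto
    then show "\<forall>\<^sub>F n in sequentially. \<forall>z\<in>ball w d. \<forall>h.
        norm ((\<Sum>i<n. f' i z h) - (cscale h o\<^sub>L resolvent T z)) \<le> e * norm h"
    proof eventually_elim
      case (elim n)
      show ?case
      proof (intro ballI allI)
        fix z h assume z: "z \<in> ball w d"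
        have "norm ((\<Sum>i<n. f' i z h) - (cscale h o\<^sub>L resolvent T z))
            = norm (cscale h o\<^sub>L (resolvent T z o\<^sub>L Q z ^\<^sub>L n))"
        proof -
          have "(\<Sum>i<n. f' i z h) - (cscale h o\<^sub>L resolvent T z) = - (cscale h o\<^sub>L (resolvent T z o\<^sub>L Q z ^\<^sub>L n))"
            using partial[OF z] by (intro blinfun_eqI) (simp add: blinfun.diff_left blinfun.minus_left)
          then show ?thesis by simp
        qed
        also have "\<dots> \<le> norm (cscale h :: ('a \<times> 'a) \<Rightarrow>\<^sub>L _) * (norm (resolvent T z) * norm (Q z ^\<^sub>L n))"
          by (intro order_trans[OF norm_blinfun_compose] mult_left_mono norm_blinfun_compose norm_ge_zero)
        also have "\<dots> \<le> (2 * cmod h) * ((2 * norm ?R) * (1 / 4) ^ n)"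
          by (intro mult_mono norm_cscale nR z order_trans[OF norm_blinfun_power power_mono[OF nQ]]
              mult_nonneg_nonneg) auto
        also have "\<dots> = (4 * norm ?R * (1 / 4) ^ n) * norm h" by simp
        also have "\<dots> \<le> e * norm h"
          using elim by (intro mult_right_mono) auto
        finally show "norm ((\<Sum>i<n. f' i z h) - (cscale h o\<^sub>L resolvent T z)) \<le> e * norm h" .
      qed
    qed
  qed
  then obtain g where "\<And>z. z \<in> ball w d \<Longrightarrow> (g has_derivative (\<lambda>h. cscale h o\<^sub>L resolvent T z)) (at z within ball w d)"
    by blast
  then have "(g has_derivative (\<lambda>h. cscale h o\<^sub>L resolvent T z)) (at z)" if "z \<in> ball w d" for z
    using that at_within_open[OF that open_ball] by metis
  then show ?thesis using that d(1) by blast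
qed

text \<open>The derivative of a valid path may be unbounded near its exceptional points, so integrability
  is derived from the local primitives.\<close>

lemma riesz_integrand_integrable:
  fixes T :: "'a::banach \<Rightarrow>\<^sub>L 'a"
  assumes \<gamma>: "valid_path \<gamma>" and image: "path_image \<gamma> \<inter> spectrum T = {}"
  shows "(\<lambda>t. cscale (vector_derivative \<gamma> (at t within {0..1})) o\<^sub>L resolvent T (\<gamma> t)) integrable_on {0..1}"
    (is "?f integrable_on _")
proof -
  obtain S where S: "finite S" "\<gamma> C1_differentiable_on ({0..1} - S)" and cont: "continuous_on {0..1} \<gamma>"
    using \<gamma> unfolding valid_path_def piecewise_C1_differentiable_on_def by blast
  have deriv: "(\<gamma> has_vector_derivative vector_derivative \<gamma> (at t within {0..1})) (at t)"
    if t: "t \<in> {0..1} - S" for t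
  proof -
    obtain D where D: "(\<gamma> has_vector_derivative D) (at t)"
      using S(2) t unfolding C1_differentiable_on_def by blast
    moreover have "vector_derivative \<gamma> (at t within {0..1}) = D"
      using t by (intro vector_derivative_at_within_ivl[OF D]) auto
    ultimately show ?thesis by simp
  qed
  have "?f integrable_on cbox 0 1"
  proof (rule integrable_on_little_subintervals, intro ballI)
    fix x :: real assume x: "x \<in> cbox 0 1"
    then have "\<gamma> x \<in> path_image \<gamma>"
      by (simp add: path_image_def)
    then have "\<gamma> x \<notin> spectrum T"
      using image by blast
    then obtain d \<Phi> where d: "0 < d"
      and \<Phi>: "\<And>z. z \<in> ball (\<gamma> x) d \<Longrightarrow> (\<Phi> has_derivative (\<lambda>h. cscale h o\<^sub>L resolvent T z)) (at z)"
      using resolvent_local_primitive by blast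
    obtain \<delta> where \<delta>: "0 < \<delta>" "\<And>y. y \<in> {0..1} \<Longrightarrow> dist y x < \<delta> \<Longrightarrow> dist (\<gamma> y) (\<gamma> x) < d"
      using cont d x unfolding continuous_on_iff by (metis cbox_interval)
    show "\<exists>\<delta>>0. \<forall>u v. x \<in> cbox u v \<and> cbox u v \<subseteq> ball x \<delta> \<and> cbox u v \<subseteq> cbox 0 1 \<longrightarrow> ?f integrable_on cbox u v"
    proof (intro exI[of _ \<delta>] conjI allI impI \<delta>(1))
      fix u v assume uv: "x \<in> cbox u v \<and> cbox u v \<subseteq> ball x \<delta> \<and> cbox u v \<subseteq> cbox 0 1"
      have in_ball: "\<gamma> t \<in> ball (\<gamma> x) d" if "t \<in> {u..v}" for t
        using that uv \<delta>(2)[of t] by (auto simp: dist_commute subset_iff)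
      have "(?f has_integral ((\<Phi> \<circ> \<gamma>) v - (\<Phi> \<circ> \<gamma>) u)) {u..v}"
      proof (rule fundamental_theorem_of_calculus_interior_strong[OF S(1)])
        show "u \<le> v" using uv by auto
        show "continuous_on {u..v} (\<Phi> \<circ> \<gamma>)"
        proof (rule continuous_on_compose)
          show "continuous_on {u..v} \<gamma>"
            using uv by (intro continuous_on_subset[OF cont]) auto
          show "continuous_on (\<gamma> ` {u..v}) \<Phi>"
            using has_derivative_continuous[OF \<Phi>[OF in_ball]]
            by (intro continuous_at_imp_continuous_on) blast
        qed
        fix t assume t: "t \<in> {u<..<v} - S"
        then have t01: "t \<in> {0..1} - S"
          using uv by (auto simp: subset_iff)
        have "(\<Phi> \<circ> \<gamma> has_derivative (\<lambda>h. cscale h o\<^sub>L resolvent T (\<gamma> t))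
            \<circ> (\<lambda>h. h *\<^sub>R vector_derivative \<gamma> (at t within {0..1}))) (at t)"
          using t deriv[OF t01] unfolding has_vector_derivative_def
          by (intro diff_chain_at \<Phi> in_ball) auto
        moreover have "(\<lambda>h. cscale h o\<^sub>L resolvent T (\<gamma> t)) \<circ> (\<lambda>h. h *\<^sub>R vector_derivative \<gamma> (at t within {0..1}))
            = (\<lambda>h. h *\<^sub>R ?f t)"
          by (rule ext) (simp add: linear_scale[OF bounded_linear.linear[OF bounded_linear_cscale]]
              bounded_bilinear.scaleR_left[OF bounded_bilinear_blinfun_compose])
        ultimately show "(\<Phi> \<circ> \<gamma> has_vector_derivative ?f t) (at t)"
          by (simp add: has_vector_derivative_def)
      qed
      then show "?f integrable_on cbox u v"
        by (auto simp: integrable_on_def)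
    qed
  qed
  then show ?thesis by simp
qed

text \<open>Bounded functionals commute with the integral, which turns it into an ordinary contour integral.\<close>

lemma cfunctional_riesz_integral:
  fixes T :: "'a::banach \<Rightarrow>\<^sub>L 'a"
  assumes \<gamma>: "valid_path \<gamma>" "path_image \<gamma> \<inter> spectrum T = {}"
  shows "cfunctional \<phi> (riesz_integral T \<gamma> v)
    = 1 / (2 * of_real pi * \<i>) * contour_integral \<gamma> (\<lambda>z. cfunctional \<phi> (resolvent T z v))"
proof -
  let ?f = "\<lambda>t. cscale (vector_derivative \<gamma> (at t within {0..1})) o\<^sub>L resolvent T (\<gamma> t)"
  have "bounded_linear (\<lambda>Q :: ('a \<times> 'a) \<Rightarrow>\<^sub>L ('a \<times> 'a). cfunctional \<phi> (Q v))"
    by (intro bounded_linear_compose[OF bounded_linear_cfunctional] blinfun.bounded_linear_left)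
  from has_integral_linear[OF integrable_integral[OF riesz_integrand_integrable[OF \<gamma>]] this]
  have "((\<lambda>t. cfunctional \<phi> (?f t v)) has_integral cfunctional \<phi> (integral {0..1} ?f v)) {0..1}"
    by (simp add: o_def)
  then have "((\<lambda>z. cfunctional \<phi> (resolvent T z v)) has_contour_integral cfunctional \<phi> (integral {0..1} ?f v)) \<gamma>"
    unfolding has_contour_integral_def by (simp add: cfunctional_cscale mult.commute)
  then show ?thesis
    by (simp add: riesz_integral_def cfunctional_cscale contour_integral_unique)
qed

text \<open>In a connected open set the paths of a cycle can be linked into one loop by auxiliary paths
  that are run through in both directions.\<close>

lemma cycle_to_loop:
  assumes \<Omega>: "open \<Omega>" "connected \<Omega>" "p \<in> \<Omega>"
    and \<Gamma>: "\<And>\<gamma>. \<gamma> \<in> set \<Gamma> \<Longrightarrow> valid_path \<gamma> \<and> pathfinish \<gamma> = pathstart \<gamma> \<and> path_image \<gamma> \<subseteq> \<Omega>"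
  shows "\<exists>g. valid_path g \<and> pathstart g = p \<and> pathfinish g = p \<and> path_image g \<subseteq> \<Omega> \<and>
    (\<forall>h. h holomorphic_on \<Omega> \<longrightarrow> contour_integral g h = (\<Sum>\<gamma>\<leftarrow>\<Gamma>. contour_integral \<gamma> h))"
  using \<Gamma>
proof (induction \<Gamma>)
  case Nil
  show ?case
    using \<Omega>(3) by (intro exI[of _ "linepath p p"] conjI allI impI)
      (simp_all only: valid_path_linepath pathstart_linepath pathfinish_linepath path_image_linepath
        closed_segment_idem contour_integral_trivial list.map sum_list.Nil empty_subsetI insert_subset)
next
  case (Cons \<gamma> \<Gamma>)
  obtain g where g: "valid_path g" "pathstart g = p" "pathfinish g = p" "path_image g \<subseteq> \<Omega>"
    and gi: "\<And>h. h holomorphic_on \<Omega> \<Longrightarrow> contour_integral g h = (\<Sum>\<gamma>\<leftarrow>\<Gamma>. contour_integral \<gamma> h)"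
    using Cons.IH Cons.prems by (metis list.set_intros(2))
  have \<gamma>: "valid_path \<gamma>" "pathfinish \<gamma> = pathstart \<gamma>" "path_image \<gamma> \<subseteq> \<Omega>"
    using Cons.prems[of \<gamma>] by simp_all
  have "pathstart \<gamma> \<in> \<Omega>"
    using \<gamma>(3) pathstart_in_path_image by blast
  then obtain c where "polynomial_function c" and c: "path_image c \<subseteq> \<Omega>" "pathstart c = p" "pathfinish c = pathstart \<gamma>"
    using connected_open_polynomial_connected[OF \<Omega>(1,2) \<Omega>(3)] by blast
  then have vc: "valid_path c"
    by (intro valid_path_polynomial_function)
  let ?g = "c +++ \<gamma> +++ reversepath c +++ g"
  have valid: "valid_path ?g" "valid_path (\<gamma> +++ reversepath c +++ g)" "valid_path (reversepath c +++ g)"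
    "valid_path (reversepath c)"
    using vc \<gamma> c g by (auto intro!: valid_path_join)
  have "path_image ?g \<subseteq> \<Omega>"
    using \<gamma>(3) c(1) g(4) by (intro subset_path_image_join) (auto simp: path_image_reversepath)
  moreover have "contour_integral ?g h = (\<Sum>\<gamma>\<leftarrow>\<gamma> # \<Gamma>. contour_integral \<gamma> h)" if h: "h holomorphic_on \<Omega>" for h
  proof -
    have int: "h contour_integrable_on q" if "valid_path q" "path_image q \<subseteq> \<Omega>" for q
      using contour_integrable_holomorphic_simple[OF h \<Omega>(1) that] .
    have "h contour_integrable_on c" "h contour_integrable_on \<gamma>" "h contour_integrable_on reversepath c"
      "h contour_integrable_on g"
      using vc c \<gamma> g valid by (auto intro!: int)
    then show ?thesis
      using vc \<gamma>(1) g(1) valid by (simp add: contour_integral_reversepath gi[OF h])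
  qed
  ultimately show ?case
    using valid(1) c(2) g(3) by (intro exI[of _ ?g]) auto
qed

section \<open>The peripheral spectral projection\<close>

text \<open>Multiplication by a primitive root \<open>\<zeta>\<close> permutes the roots of unity and multiplies the sum by
  \<open>\<zeta>\<^bsup>-k\<^esup> \<noteq> 1\<close>.\<close>

lemma sum_roots_unity_power:
  assumes k: "0 < k" "k < m"
  shows "(\<Sum>\<omega> | \<omega> ^ m = 1. (1 / \<omega>) ^ k) = (0 :: complex)"
proof -
  define \<zeta> where "\<zeta> = cis (2 * pi / m)"
  have m: "0 < m" using k by simp
  have bij: "bij_betw (\<lambda>k. cis (2 * pi * real k / real m)) {..<m} {z. z ^ m = 1}"
    by (rule Complex.bij_betw_roots_unity[OF m])
  have \<zeta>k: "\<zeta> ^ j = cis (2 * pi * real j / real m)" for j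
    unfolding \<zeta>_def Complex.DeMoivre by (simp add: mult_ac)
  have \<zeta>1: "\<zeta> ^ m = 1"
    using m by (simp add: \<zeta>k)
  have \<zeta>0: "\<zeta> \<noteq> 0" by (simp add: \<zeta>_def)
  have "\<zeta> ^ k \<noteq> 1"
  proof
    assume "\<zeta> ^ k = 1"
    then have "cis (2 * pi * real k / real m) = cis (2 * pi * real 0 / real m)"
      by (simp add: \<zeta>k)
    then have "k = 0"
      using bij k unfolding bij_betw_def inj_on_def by auto
    then show False using k by simp
  qed
  let ?S = "\<Sum>\<omega> | \<omega> ^ m = 1. (1 / \<omega>) ^ k"
  have "bij_betw (\<lambda>\<omega>. \<zeta> * \<omega>) {z. z ^ m = 1} {z. z ^ m = 1}"
    by (rule bij_betw_byWitness[of _ "\<lambda>\<omega>. \<omega> / \<zeta>"])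
      (use \<zeta>0 \<zeta>1 in \<open>auto simp: power_mult_distrib power_divide\<close>)
  then have "?S = (\<Sum>\<omega> | \<omega> ^ m = 1. (1 / (\<zeta> * \<omega>)) ^ k)"
    using sum.reindex_bij_betw[of "\<lambda>\<omega>. \<zeta> * \<omega>" _ _ "\<lambda>\<omega>. (1 / \<omega>) ^ k"] by simp
  also have "\<dots> = (1 / \<zeta> ^ k) * ?S"
    by (simp add: sum_distrib_left power_divide power_mult_distrib)
  finally show ?thesis
    using \<open>\<zeta> ^ k \<noteq> 1\<close> \<zeta>0 by (simp add: field_simps)
qed

text \<open>A compact operator whose powers act periodically on the range of a commuting projection \<open>P\<close> and
  decay geometrically on its kernel.\<close>

locale periodic_splitting =
  fixes K P :: "'a::banach \<Rightarrow>\<^sub>L 'a" and m :: nat and C \<theta> :: real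
  assumes K_compact: "compact_operator K" and PP: "P o\<^sub>L P = P" and PK: "P o\<^sub>L K = K o\<^sub>L P"
    and m: "1 \<le> m" and periodic: "K ^\<^sub>L m o\<^sub>L P = P"
    and C: "0 \<le> C" and \<theta>: "0 < \<theta>" "\<theta> < 1"
    and decay: "norm (K ^\<^sub>L n o\<^sub>L (id_blinfun - P)) \<le> C * \<theta> ^ n"
begin

abbreviation "Kc \<equiv> complexify K"
abbreviation "Pc \<equiv> complexify P"
abbreviation "Ec \<equiv> complexify (id_blinfun - P)"

definition roots :: "complex set" where "roots = {\<omega>. \<omega> ^ m = 1}"

lemma finite_roots: "finite roots"
  unfolding roots_def using m by (intro finite_roots_unity) simp

lemma Pc_idem [simp]: "Pc (Pc v) = Pc v"
  using arg_cong[OF PP, of "\<lambda>T. complexify T v"] by (simp add: complexify_compose)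

lemma Pc_Kc: "Pc (Kc v) = Kc (Pc v)"
  using arg_cong[OF PK, of "\<lambda>T. complexify T v"] by (simp add: complexify_compose)

lemma Ec_eq: "Ec v = v - Pc v"
  by (simp add: complexify_diff blinfun.diff_left)

lemma Kc_power_period: "(Kc ^\<^sub>L m) (Pc v) = Pc v"
  using arg_cong[OF periodic, of "\<lambda>T. complexify T v"] by (simp add: complexify_compose complexify_power)

lemma Kc_power_Pc: "(Kc ^\<^sub>L n) (Pc v) = Pc ((Kc ^\<^sub>L n) v)"
  by (induction n) (simp_all add: Pc_Kc)

text \<open>The projection onto the eigenspace of \<open>K\<close> for the eigenvalue \<open>\<omega>\<close>.\<close>

definition eigen_part :: "complex \<Rightarrow> ('a \<times> 'a) \<Rightarrow>\<^sub>L ('a \<times> 'a)" where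
  "eigen_part \<omega> = cscale (1 / of_nat m) o\<^sub>L (\<Sum>k<m. cscale ((1 / \<omega>) ^ k) o\<^sub>L (Kc ^\<^sub>L k o\<^sub>L Pc))"

lemma eigen_part_apply:
  "eigen_part \<omega> v = cscale (1 / of_nat m) (\<Sum>k<m. cscale ((1 / \<omega>) ^ k) ((Kc ^\<^sub>L k) (Pc v)))"
  by (simp add: eigen_part_def blinfun.sum_left)

lemma Kc_eigen_part:
  assumes "\<omega> \<in> roots" shows "Kc (eigen_part \<omega> v) = cscale \<omega> (eigen_part \<omega> v)"
proof -
  have \<omega>: "\<omega> ^ m = 1" "\<omega> \<noteq> 0"
    using assms m by (auto simp: roots_def power_0_left)
  define a where "a k = cscale ((1 / \<omega>) ^ k) ((Kc ^\<^sub>L k) (Pc v))" for k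
  have "a m = a 0"
    using \<omega> by (simp add: a_def Kc_power_period power_divide)
  then have shift: "(\<Sum>k<m. a (Suc k)) = (\<Sum>k<m. a k)"
    using sum.lessThan_Suc_shift[of a m] sum.lessThan_Suc[of a m] by simp
  have "Kc (a k) = cscale \<omega> (a (Suc k))" for k
    using \<omega> by (simp add: a_def cscale_complexify[symmetric] cscale_cscale)
  then have "Kc (\<Sum>k<m. a k) = cscale \<omega> (\<Sum>k<m. a (Suc k))"
    by (simp add: blinfun.sum_right)
  then show ?thesis
    unfolding eigen_part_apply a_def[symmetric] shift
    by (simp add: cscale_complexify[symmetric] cscale_cscale mult.commute)
qed

lemma sum_eigen_part: "(\<Sum>\<omega>\<in>roots. eigen_part \<omega> v) = Pc v"
proof -
  have s: "(\<Sum>\<omega>\<in>roots. (1 / \<omega>) ^ k) = (if k = 0 then of_nat m else 0)" if "k < m" for k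
    using sum_roots_unity_power[of k m] that card_roots_unity_eq[of m] m by (auto simp: roots_def)
  have cs: "cscale (sum h A) u = (\<Sum>i\<in>A. cscale (h i) u)" for h and A :: "complex set" and u :: "'a \<times> 'a"
    by (simp add: linear_sum[OF bounded_linear.linear[OF bounded_linear_cscale]] blinfun.sum_left)
  have "(\<Sum>\<omega>\<in>roots. eigen_part \<omega> v)
      = cscale (1 / of_nat m) (\<Sum>k<m. \<Sum>\<omega>\<in>roots. cscale ((1 / \<omega>) ^ k) ((Kc ^\<^sub>L k) (Pc v)))"
    unfolding eigen_part_apply by (subst sum.swap) (simp add: blinfun.sum_right)
  also have "\<dots> = cscale (1 / of_nat m) (\<Sum>k<m. if k = 0 then cscale (of_nat m) (Pc v) else 0)"
    by (intro arg_cong[of _ _ "blinfun_apply (cscale (1 / of_nat m))"] sum.cong refl)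
      (simp add: cs[symmetric] s)
  also have "\<dots> = Pc v"
    using m by (simp add: sum.delta)
  finally show ?thesis .
qed

lemma Pc_eigen_part: "Pc (eigen_part \<omega> v) = eigen_part \<omega> v"
  unfolding eigen_part_apply
  by (simp add: cscale_complexify[symmetric] blinfun.sum_right Kc_power_Pc)

lemma eigen_part_Pc: "eigen_part \<omega> (Pc v) = eigen_part \<omega> v"
  by (simp add: eigen_part_apply)

lemma eigen_part_Kc: "eigen_part \<omega> (Kc v) = Kc (eigen_part \<omega> v)"
proof -
  have "(Kc ^\<^sub>L k) (Kc u) = Kc ((Kc ^\<^sub>L k) u)" for k u
    using arg_cong[OF blinfun_power_commute[of Kc k], of "\<lambda>T. T u"] by simp
  then show ?thesis
    by (simp add: eigen_part_apply Pc_Kc cscale_complexify[symmetric] blinfun.sum_right)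
qed

lemma eigen_part_cscale: "eigen_part \<omega> (cscale c v) = cscale c (eigen_part \<omega> v)"
proof -
  have "(Kc ^\<^sub>L k) (cscale c u) = cscale c ((Kc ^\<^sub>L k) u)" for k u
    by (simp add: cscale_complexify flip: complexify_power)
  then show ?thesis
    by (simp add: eigen_part_apply cscale_complexify[symmetric] blinfun.sum_right cscale_cscale mult.commute)
qed

text \<open>The pencil agrees with \<open>z - K\<close> on the kernel of \<open>P\<close> and with the identity on its range.\<close>

abbreviation "reduced_pencil \<equiv> pencil Ec (complexify ((K o\<^sub>L (id_blinfun - P)) - P))"

lemma reduced_pencil_apply: "reduced_pencil z v = cscale z (Ec v) - Kc (Ec v) + Pc v"
  by (simp add: complexify_diff complexify_compose blinfun.diff_left)

lemma reduced_inverse_resolvent: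
  assumes z: "z \<notin> spectrum K"
  shows "blinfun_inverses (reduced_pencil z) ((resolvent K z o\<^sub>L Ec) + Pc)"
proof -
  let ?R = "resolvent K z"
  note inv = blinfun_inverses_resolvent[OF z]
  have R1: "cscale z (?R v) - Kc (?R v) = v" and R2: "?R (cscale z v - Kc v) = v" for v
    using blinfun_inverses_apply[OF inv, of v] by (simp_all add: blinfun.diff_left)
  have RP: "?R (Pc v) = Pc (?R v)" for v
  proof -
    have "?R (Pc v) = ?R (Pc (cscale z (?R v) - Kc (?R v)))"
      by (simp add: R1)
    also have "Pc (cscale z (?R v) - Kc (?R v)) = cscale z (Pc (?R v)) - Kc (Pc (?R v))"
      by (simp add: blinfun.diff_right cscale_complexify Pc_Kc)
    finally show ?thesis by (simp add: R2)
  qed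
  have PE: "Pc (Ec v) = 0" "Ec (Pc v) = 0" "Ec (Ec v) = Ec v" for v
    by (simp_all add: Ec_eq blinfun.diff_right)
  have ER: "Ec (?R (Ec v)) = ?R (Ec v)" for v
    by (simp add: Ec_eq[of "?R (Ec v)"] PE flip: RP)
  show ?thesis
  proof (rule blinfun_inversesI)
    fix v
    have E: "Ec (((?R o\<^sub>L Ec) + Pc) v) = ?R (Ec v)"
      by (simp add: blinfun.add_left blinfun.add_right ER PE)
    have "Pc (((?R o\<^sub>L Ec) + Pc) v) = Pc v"
      by (simp add: blinfun.add_left blinfun.add_right PE flip: RP)
    then show "reduced_pencil z (((?R o\<^sub>L Ec) + Pc) v) = v"
      unfolding reduced_pencil_apply E by (simp add: R1 Ec_eq)
    have "Ec (reduced_pencil z v) = cscale z (Ec v) - Kc (Ec v)"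
      unfolding reduced_pencil_apply
      by (simp add: Ec_eq blinfun.diff_right blinfun.add_right cscale_complexify Pc_Kc)
    moreover have "Pc (reduced_pencil z v) = Pc v"
      unfolding reduced_pencil_apply
      by (simp add: blinfun.diff_right blinfun.add_right cscale_complexify[symmetric] Pc_Kc PE)
    ultimately show "((?R o\<^sub>L Ec) + Pc) (reduced_pencil z v) = v"
      by (simp add: blinfun.add_left R2 Ec_eq)
  qed
qed

text \<open>For \<open>|z| > \<theta>\<close> the Neumann series on the kernel of \<open>P\<close> converges, whether or not \<open>z\<close> is in the
  spectrum of \<open>K\<close>.\<close>

lemma reduced_inverse_outside_disc:
  assumes z: "\<theta> < cmod z" shows "\<exists>W. blinfun_inverses (reduced_pencil z) W"
proof -
  have z0: "z \<noteq> 0" using z \<theta> by auto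
  let ?E = "id_blinfun - P"
  let ?T = "K o\<^sub>L ?E"
  have EE: "?E (?E x) = ?E x" and EK: "?E (K x) = K (?E x)" for x
    using arg_cong[OF PP, of "\<lambda>T. T x"] arg_cong[OF PK, of "\<lambda>T. T x"]
    by (simp_all add: blinfun.diff_left blinfun.diff_right)
  have EKn: "?E ((K ^\<^sub>L n) x) = (K ^\<^sub>L n) (?E x)" for n x
    by (induction n) (simp_all add: EK del: blinfun.diff_left)
  have pow: "?T ^\<^sub>L Suc n = K ^\<^sub>L Suc n o\<^sub>L ?E" for n
  proof (induction n)
    case 0
    show ?case by (auto intro!: blinfun_eqI)
  next
    case (Suc n)
    have "(?T ^\<^sub>L Suc (Suc n)) x = (K ^\<^sub>L Suc (Suc n) o\<^sub>L ?E) x" for x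
    proof -
      have "(?T ^\<^sub>L Suc (Suc n)) x = K (?E ((?T ^\<^sub>L Suc n) x))" by simp
      also have "(?T ^\<^sub>L Suc n) x = (K ^\<^sub>L Suc n) (?E x)"
        by (simp only: Suc blinfun_apply_blinfun_compose)
      also have "?E \<dots> = (K ^\<^sub>L Suc n) (?E x)"
        by (simp only: EKn EE)
      finally show ?thesis by simp
    qed
    then show ?case by (rule blinfun_eqI)
  qed
  have "norm (?T ^\<^sub>L n) \<le> (C + 1) * \<theta> ^ n" for n
  proof (cases n)
    case 0
    then show ?thesis
      using C norm_blinfun_id_le[where 'a='a] by (simp add: add_increasing)
  next
    case (Suc k)
    have "norm (?T ^\<^sub>L n) \<le> C * \<theta> ^ n"
      unfolding Suc pow by (rule decay)
    also have "\<dots> \<le> (C + 1) * \<theta> ^ n"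
      using \<theta> by (intro mult_right_mono) auto
    finally show ?thesis .
  qed
  then obtain B where B: "blinfun_inverses (id_blinfun - (cscale (1 / z) o\<^sub>L complexify ?T)) B"
    using neumann_outside_disc(2)[of ?T "C + 1" \<theta> z] \<theta> z by auto
  have PE: "Pc (Ec v) = 0" "Ec (Pc v) = 0" "Ec (Ec v) = Ec v" for v
    by (simp_all add: Ec_eq blinfun.diff_right)
  have D: "blinfun_inverses ((cscale z o\<^sub>L Ec) + Pc) ((cscale (1 / z) o\<^sub>L Ec) + Pc)"
  proof (rule blinfun_inversesI)
    fix v
    have sum: "Ec v + Pc v = v" by (simp add: Ec_eq)
    show "((cscale z o\<^sub>L Ec) + Pc) (((cscale (1 / z) o\<^sub>L Ec) + Pc) v) = v"
      "((cscale (1 / z) o\<^sub>L Ec) + Pc) (((cscale z o\<^sub>L Ec) + Pc) v) = v"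
      using z0 sum by (simp_all add: blinfun.add_left blinfun.add_right cscale_complexify[symmetric] PE)
  qed
  have "((cscale z o\<^sub>L Ec) + Pc) o\<^sub>L (id_blinfun - (cscale (1 / z) o\<^sub>L complexify ?T)) = reduced_pencil z"
  proof (rule blinfun_eqI)
    fix v
    have "Ec (Kc (Ec v)) = Kc (Ec v)"
      by (simp add: Ec_eq[of "Kc (Ec v)"] Pc_Kc PE)
    then show "(((cscale z o\<^sub>L Ec) + Pc) o\<^sub>L (id_blinfun - (cscale (1 / z) o\<^sub>L complexify ?T))) v = reduced_pencil z v"
      using z0 unfolding blinfun_apply_blinfun_compose reduced_pencil_apply
      by (simp add: blinfun.add_left blinfun.diff_left blinfun.diff_right complexify_compose
          cscale_complexify[symmetric] Pc_Kc PE)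
  qed
  then show ?thesis
    using blinfun_inverses_compose[OF D B] by auto
qed

text \<open>\<open>z - K\<close> is the product of the reduced pencil and an operator that acts as \<open>z - K\<close> on the range of \<open>P\<close>
  and as the identity on its kernel. The second factor is diagonalised by the spaces belonging
  to the roots of unity, and so it is invertible unless \<open>z\<close> is one of them.\<close>

lemma spectrum_outside_disc:
  assumes z: "z \<in> spectrum K" "\<theta> < cmod z" shows "z \<in> roots"
proof (rule ccontr)
  assume nz: "z \<notin> roots"
  obtain W where W: "blinfun_inverses (reduced_pencil z) W"
    using reduced_inverse_outside_disc[OF z(2)] by blast
  define S where "S = (\<Sum>\<omega>\<in>roots. cscale (1 / (z - \<omega>)) o\<^sub>L eigen_part \<omega>)"
  have S_apply: "S v = (\<Sum>\<omega>\<in>roots. cscale (1 / (z - \<omega>)) (eigen_part \<omega> v))" for v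
    by (simp add: S_def blinfun.sum_left)
  have PE: "Pc (Ec v) = 0" "Ec (Pc v) = 0" "Ec (Ec v) = Ec v" for v
    by (simp_all add: Ec_eq blinfun.diff_right)
  have PS: "Pc (S v) = S v" for v
    by (simp add: S_apply blinfun.sum_right cscale_complexify[symmetric] Pc_eigen_part)
  have SP: "S (Pc v) = S v" for v
    by (simp add: S_apply eigen_part_Pc)
  have zS: "cscale z (S v) - Kc (S v) = Pc v" for v
  proof -
    have "cscale z (S v) - Kc (S v)
        = (\<Sum>\<omega>\<in>roots. cscale z (cscale (1 / (z - \<omega>)) (eigen_part \<omega> v))
            - cscale (1 / (z - \<omega>)) (cscale \<omega> (eigen_part \<omega> v)))"
      by (simp add: S_apply blinfun.sum_right sum_subtractf cscale_complexify[symmetric] Kc_eigen_part)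
    also have "\<dots> = (\<Sum>\<omega>\<in>roots. eigen_part \<omega> v)"
    proof (rule sum.cong[OF refl])
      fix \<omega> assume "\<omega> \<in> roots"
      then have "z - \<omega> \<noteq> 0" using nz by auto
      then have "z * (1 / (z - \<omega>)) - 1 / (z - \<omega>) * \<omega> = 1"
        by (simp add: diff_divide_distrib[symmetric])
      then show "cscale z (cscale (1 / (z - \<omega>)) (eigen_part \<omega> v))
          - cscale (1 / (z - \<omega>)) (cscale \<omega> (eigen_part \<omega> v)) = eigen_part \<omega> v"
        by (simp only: cscale_cscale cscale_left_diff[symmetric] cscale_1_apply)
    qed
    finally show ?thesis by (simp add: sum_eigen_part)
  qed
  have Sz: "S (cscale z v - Kc v) = Pc v" for v
  proof -
    have "S (cscale z v - Kc v) = cscale z (S v) - Kc (S v)"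
      by (simp add: S_apply blinfun.diff_right blinfun.sum_right eigen_part_cscale eigen_part_Kc
          cscale_complexify[symmetric] cscale_cscale mult.commute)
    then show ?thesis by (simp add: zS)
  qed
  have D: "blinfun_inverses (Ec + ((cscale z - Kc) o\<^sub>L Pc)) (Ec + S)"
  proof (rule blinfun_inversesI)
    fix v
    have ES: "Ec (S v) = 0" by (simp add: Ec_eq PS)
    have sum: "Ec v + Pc v = v" by (simp add: Ec_eq)
    show "(Ec + ((cscale z - Kc) o\<^sub>L Pc)) ((Ec + S) v) = v"
      using zS[of v] sum by (simp add: blinfun.add_left blinfun.add_right blinfun.diff_left PE PS ES)
    have "S (Ec v) = 0"
      using SP[of "Ec v"] by (simp add: PE)
    moreover have "Ec (cscale z (Pc v) - Kc (Pc v)) = 0"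
      by (simp add: Ec_eq blinfun.diff_right cscale_complexify Pc_Kc)
    ultimately show "(Ec + S) ((Ec + ((cscale z - Kc) o\<^sub>L Pc)) v) = v"
      using Sz[of "Pc v"] sum by (simp add: blinfun.add_left blinfun.add_right blinfun.diff_left PE)
  qed
  have "reduced_pencil z o\<^sub>L (Ec + ((cscale z - Kc) o\<^sub>L Pc)) = cscale z - Kc"
  proof (rule blinfun_eqI)
    fix v
    have E0: "Ec (cscale z (Pc v) - Kc (Pc v)) = 0"
      by (simp add: Ec_eq blinfun.diff_right cscale_complexify Pc_Kc)
    have 1: "Ec ((Ec + ((cscale z - Kc) o\<^sub>L Pc)) v) = Ec v"
      using E0 by (simp add: blinfun.add_left blinfun.add_right blinfun.diff_left PE)
    have 2: "Pc ((Ec + ((cscale z - Kc) o\<^sub>L Pc)) v) = cscale z (Pc v) - Kc (Pc v)"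
      by (simp add: blinfun.add_left blinfun.add_right blinfun.diff_left blinfun.diff_right PE
          cscale_complexify[symmetric] Pc_Kc)
    show "(reduced_pencil z o\<^sub>L (Ec + ((cscale z - Kc) o\<^sub>L Pc))) v = (cscale z - Kc) v"
      unfolding blinfun_apply_blinfun_compose reduced_pencil_apply 1 2
      by (simp add: Ec_eq blinfun.diff_left blinfun.diff_right)
  qed
  then have "blinfun_inverses (cscale z - Kc) ((Ec + S) o\<^sub>L W)"
    using blinfun_inverses_compose[OF W D] by simp
  then show False using z(1) by (auto simp: spectrum_def)
qed

lemma eigen_part_zero:
  assumes "\<omega> \<in> roots" "\<omega> \<notin> spectrum K" shows "eigen_part \<omega> v = 0"
  using eigenvalue_in_spectrum[of K "eigen_part \<omega> v" \<omega>] Kc_eigen_part[OF assms(1), of v] assms(2) by blast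

text \<open>After application of a functional, the contour integral over a separating cycle becomes one over a
  single loop. The part of the resolvent on the kernel of \<open>P\<close> is holomorphic off the
  rest \<open>B\<close> of the spectrum, around which the loop does not wind, so it contributes nothing. The
  pole at a peripheral point \<open>\<omega>\<close> contributes the projection onto its eigenspace, and these
  projections add up to \<open>P\<close>.\<close>

theorem spectral_projection_peripheral:
  assumes radius: "spectral_radius K = 1"
  shows "spectral_projection K (peripheral_spectrum K) = Pc"
proof -
  define A where "A = peripheral_spectrum K"
  define B where "B = spectrum K - A"
  have A: "A = roots \<inter> spectrum K"
  proof (intro equalityI subsetI)
    fix z assume "z \<in> A"
    then show "z \<in> roots \<inter> spectrum K"
      using spectrum_outside_disc[of z] \<theta> radius by (simp add: A_def peripheral_spectrum_def)
  next
    fix z assume z: "z \<in> roots \<inter> spectrum K"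
    then have "cmod z ^ m = 1 ^ m"
      by (simp add: roots_def flip: norm_power)
    then have "cmod z = 1"
      by (rule power_eq_imp_eq_base) (use m in auto)
    then show "z \<in> A"
      using z radius by (simp add: A_def peripheral_spectrum_def)
  qed
  have A1: "cmod z = 1" if "z \<in> A" for z
    using that radius by (simp add: A_def peripheral_spectrum_def)
  have AB: "A \<union> B = spectrum K"
    using A by (auto simp: B_def)
  have B\<theta>: "cmod z \<le> \<theta>" if "z \<in> B" for z
    using that spectrum_outside_disc[of z] A by (force simp: B_def)
  have finA: "finite A"
    using finite_roots A by auto
  have "B = spectrum K \<inter> cball 0 \<theta>"
    using B\<theta> A1 \<theta> by (force simp: B_def)
  moreover have "closed (spectrum K)"
    using open_resolvent_set[of K] by (simp add: closed_def)
  ultimately have "closed B"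
    by (simp add: closed_Int)
  then have openB: "open (- B)" by (simp add: open_Compl)
  have "\<exists>W. blinfun_inverses (reduced_pencil z) W" if "z \<in> - B" for z
  proof (cases "z \<in> spectrum K")
    case True
    then have "z \<in> A" using that by (simp add: B_def)
    then show ?thesis
      using reduced_inverse_outside_disc[of z] A1 \<theta> by auto
  next
    case False
    then show ?thesis using reduced_inverse_resolvent by blast
  qed
  then obtain W where W: "\<And>z. z \<in> - B \<Longrightarrow> blinfun_inverses (reduced_pencil z) (W z)"
    by metis
  have W_hol: "(\<lambda>z. cfunctional \<phi> (W z u)) holomorphic_on - B" for \<phi> u
    by (intro pencil_inverse_holomorphic[OF complex_linear_complexify complex_linear_complexify openB W])
  have PE: "Pc (Ec u) = 0" "Ec (Ec u) = Ec u" for u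
    by (simp_all add: Ec_eq blinfun.diff_right)

  \<comment> \<open>On the kernel of \<open>P\<close> the resolvent extends holomorphically to the peripheral spectrum; on the range
    it is a sum of simple poles.\<close>
  have split: "resolvent K z v = W z (Ec v) + (\<Sum>\<omega>\<in>A. cscale (1 / (z - \<omega>)) (eigen_part \<omega> v))"
    if z: "z \<notin> spectrum K" for z v
  proof -
    let ?R = "resolvent K z"
    have R: "?R (cscale z u - Kc u) = u" for u
      using blinfun_inverses_apply(2)[OF blinfun_inverses_resolvent[OF z], of u]
      by (simp add: blinfun.diff_left)
    have "W z = (?R o\<^sub>L Ec) + Pc"
      using z by (intro blinfun_inverses_unique[OF W reduced_inverse_resolvent]) (auto simp: B_def)
    then have WE: "W z (Ec v) = ?R (Ec v)"
      by (simp add: blinfun.add_left PE)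
    have RE: "?R (eigen_part \<omega> v) = cscale (1 / (z - \<omega>)) (eigen_part \<omega> v)" if "\<omega> \<in> A" for \<omega>
    proof -
      have ne: "z - \<omega> \<noteq> 0" and root: "\<omega> \<in> roots"
        using that z A by auto
      let ?u = "cscale (1 / (z - \<omega>)) (eigen_part \<omega> v)"
      have "Kc ?u = cscale \<omega> ?u"
        by (simp add: cscale_complexify[symmetric] Kc_eigen_part[OF root] cscale_cscale mult.commute)
      then have "cscale z ?u - Kc ?u = cscale (z - \<omega>) ?u"
        by (simp only: cscale_left_diff)
      also have "\<dots> = eigen_part \<omega> v"
        using ne by simp
      finally show ?thesis using R[of ?u] by simp
    qed
    have "Pc v = (\<Sum>\<omega>\<in>A. eigen_part \<omega> v)"
      unfolding sum_eigen_part[symmetric] A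
      using finite_roots by (intro sum.mono_neutral_right) (auto simp: eigen_part_zero)
    then have "?R (Pc v) = (\<Sum>\<omega>\<in>A. cscale (1 / (z - \<omega>)) (eigen_part \<omega> v))"
      by (simp add: blinfun.sum_right RE)
    moreover have "?R v = ?R (Ec v) + ?R (Pc v)"
      by (simp add: Ec_eq blinfun.diff_right)
    ultimately show ?thesis by (simp add: WE)
  qed

  have main: "(\<Sum>\<gamma>\<leftarrow>\<Gamma>. riesz_integral K \<gamma>) = Pc" if \<Gamma>: "separating_cycle \<Gamma> A B" for \<Gamma>
  proof -
    have paths: "valid_path \<gamma> \<and> pathfinish \<gamma> = pathstart \<gamma> \<and> path_image \<gamma> \<subseteq> - spectrum K" if "\<gamma> \<in> set \<Gamma>" for \<gamma>
      using \<Gamma> that AB unfolding separating_cycle_def by blast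
    have "2 \<notin> spectrum K"
      using spectrum_outside_disc[of 2] \<theta> A1[of 2] A by auto
    moreover have "connected (- spectrum K)"
      by (intro path_connected_imp_connected path_connected_complement_countable
          countable_spectrum K_compact) simp
    ultimately obtain g where g: "valid_path g" "pathstart g = 2" "pathfinish g = 2" "path_image g \<subseteq> - spectrum K"
      and gi: "\<And>h. h holomorphic_on - spectrum K \<Longrightarrow> contour_integral g h = (\<Sum>\<gamma>\<leftarrow>\<Gamma>. contour_integral \<gamma> h)"
      using cycle_to_loop[OF open_resolvent_set[of K], of 2 \<Gamma>] paths by blast
    have wn: "winding_number g w = (\<Sum>\<gamma>\<leftarrow>\<Gamma>. winding_number \<gamma> w)" if w: "w \<in> spectrum K" for w
    proof -
      have "(\<lambda>z. 1 / (z - w)) holomorphic_on - spectrum K"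
        using w by (intro holomorphic_intros) auto
      then have "winding_number g w = 1 / (2 * pi * \<i>) * (\<Sum>\<gamma>\<leftarrow>\<Gamma>. contour_integral \<gamma> (\<lambda>z. 1 / (z - w)))"
        using winding_number_valid_path[OF g(1), of w] g(4) w gi by auto
      also have "\<dots> = (\<Sum>\<gamma>\<leftarrow>\<Gamma>. 1 / (2 * pi * \<i>) * contour_integral \<gamma> (\<lambda>z. 1 / (z - w)))"
        by (simp only: sum_list_const_mult)
      also have "\<dots> = (\<Sum>\<gamma>\<leftarrow>\<Gamma>. winding_number \<gamma> w)"
        using paths w by (intro arg_cong[of _ _ sum_list] map_cong refl winding_number_valid_path[symmetric]) auto
      finally show ?thesis .
    qed
    show ?thesis
    proof (rule blinfun_eqI, rule cfunctional_separates)
      fix v and \<phi> :: "'a \<Rightarrow>\<^sub>L real"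
      let ?h = "\<lambda>z. cfunctional \<phi> (resolvent K z v)"
      have hol: "?h holomorphic_on - spectrum K"
        by (rule pencil_inverse_holomorphic[OF complex_linear_id complex_linear_complexify[of K] open_resolvent_set])
          (simp add: pencil_id blinfun_inverses_resolvent)
      have add: "cfunctional \<phi> ((\<Sum>\<gamma>\<leftarrow>xs. riesz_integral K \<gamma>) v)
          = (\<Sum>\<gamma>\<leftarrow>xs. cfunctional \<phi> (riesz_integral K \<gamma> v))" for xs
        by (induction xs) (simp_all add: blinfun.add_left cfunctional_add
            linear_0[OF bounded_linear.linear[OF bounded_linear_cfunctional]])
      have "cfunctional \<phi> ((\<Sum>\<gamma>\<leftarrow>\<Gamma>. riesz_integral K \<gamma>) v)
          = (\<Sum>\<gamma>\<leftarrow>\<Gamma>. 1 / (2 * of_real pi * \<i>) * contour_integral \<gamma> ?h)"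
        unfolding add using paths
        by (intro arg_cong[of _ _ sum_list] map_cong refl cfunctional_riesz_integral) auto
      also have "\<dots> = 1 / (2 * of_real pi * \<i>) * contour_integral g ?h"
        by (simp only: sum_list_const_mult gi[OF hol])
      also have "contour_integral g ?h = 2 * of_real pi * \<i> * cfunctional \<phi> (Pc v)"
      proof (rule contour_integral_unique)
        have N: "((\<lambda>z. cfunctional \<phi> (W z (Ec v))) has_contour_integral 0) g"
        proof (rule Cauchy_theorem_global[OF openB W_hol g(1)])
          show "pathfinish g = pathstart g" using g by simp
          show "path_image g \<subseteq> - B" using g(4) AB by blast
          fix w assume "w \<notin> - B"
          then show "winding_number g w = 0"
            using wn[of w] \<Gamma> AB unfolding separating_cycle_def by auto
        qed
        have pole: "((\<lambda>z. 1 / (z - \<omega>)) has_contour_integral 2 * of_real pi * \<i>) g" if \<omega>: "\<omega> \<in> A" for \<omega>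
        proof -
          have \<omega>s: "\<omega> \<in> spectrum K" using \<omega> AB by blast
          have "(\<lambda>z. 1 / (z - \<omega>)) holomorphic_on - spectrum K"
            using \<omega>s by (intro holomorphic_intros) auto
          then have int: "(\<lambda>z. 1 / (z - \<omega>)) contour_integrable_on g"
            by (rule contour_integrable_holomorphic_simple[OF _ open_resolvent_set g(1,4)])
          have "winding_number g \<omega> = 1"
            using wn[OF \<omega>s] \<Gamma> \<omega> unfolding separating_cycle_def by auto
          then have "contour_integral g (\<lambda>z. 1 / (z - \<omega>)) = 2 * of_real pi * \<i>"
            using winding_number_valid_path[OF g(1), of \<omega>] g(4) \<omega>s by (auto simp: field_simps)
          then show ?thesis
            using has_contour_integral_integral[OF int] by simp
        qed
        have "((\<lambda>z. cfunctional \<phi> (W z (Ec v)) + (\<Sum>\<omega>\<in>A. cfunctional \<phi> (eigen_part \<omega> v) * (1 / (z - \<omega>))))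
            has_contour_integral 0 + (\<Sum>\<omega>\<in>A. cfunctional \<phi> (eigen_part \<omega> v) * (2 * of_real pi * \<i>))) g"
          by (intro has_contour_integral_add N has_contour_integral_sum finA has_contour_integral_lmul pole)
        moreover have "(\<Sum>\<omega>\<in>A. cfunctional \<phi> (eigen_part \<omega> v) * (2 * of_real pi * \<i>))
            = 2 * of_real pi * \<i> * cfunctional \<phi> (Pc v)"
        proof -
          have "Pc v = (\<Sum>\<omega>\<in>A. eigen_part \<omega> v)"
            unfolding sum_eigen_part[symmetric] A
            using finite_roots by (intro sum.mono_neutral_right) (auto simp: eigen_part_zero)
          then show ?thesis
            by (simp add: cfunctional_sum sum_distrib_left mult_ac)
        qed
        ultimately have "((\<lambda>z. cfunctional \<phi> (W z (Ec v)) + (\<Sum>\<omega>\<in>A. cfunctional \<phi> (eigen_part \<omega> v) * (1 / (z - \<omega>))))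
            has_contour_integral 2 * of_real pi * \<i> * cfunctional \<phi> (Pc v)) g"
          by simp
        then show "(?h has_contour_integral 2 * of_real pi * \<i> * cfunctional \<phi> (Pc v)) g"
        proof (rule has_contour_integral_eq)
          fix z assume "z \<in> path_image g"
          then have "z \<notin> spectrum K" using g(4) by auto
          then show "cfunctional \<phi> (W z (Ec v)) + (\<Sum>\<omega>\<in>A. cfunctional \<phi> (eigen_part \<omega> v) * (1 / (z - \<omega>))) = ?h z"
            by (simp add: split cfunctional_add cfunctional_sum cfunctional_cscale)
        qed
      qed
      finally show "cfunctional \<phi> ((\<Sum>\<gamma>\<leftarrow>\<Gamma>. riesz_integral K \<gamma>) v) = cfunctional \<phi> (Pc v)" by simp
    qed
  qed

  define s where "s = (1 + \<theta>) / 2"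
  have s: "\<theta> < s" "s < 1" "0 < s"
    using \<theta> by (auto simp: s_def)
  have cycle: "separating_cycle [circlepath 0 2, reversepath (circlepath 0 s)] A B"
  proof -
    have img: "path_image (circlepath 0 2) = sphere 0 2" "path_image (circlepath 0 s) = sphere 0 s"
      using s by simp_all
    have "sphere 0 2 \<inter> (A \<union> B) = {}" "sphere 0 s \<inter> (A \<union> B) = {}"
      using A1 B\<theta> s \<theta> by fastforce+
    moreover have "winding_number (circlepath 0 2) z = 1" if "z \<in> A \<union> B" for z
      using that A1[of z] B\<theta>[of z] \<theta> by (intro winding_number_circlepath) auto
    moreover have "winding_number (reversepath (circlepath 0 s)) z = 0" if "z \<in> A" for z
    proof -
      have "winding_number (circlepath 0 s) z = 0"
        using A1[OF that] s by (intro winding_number_zero_outside[of _ "cball 0 s"]) auto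
      then show ?thesis
        using A1[OF that] s by (subst winding_number_reversepath) (auto simp: img)
    qed
    moreover have "winding_number (reversepath (circlepath 0 s)) z = - 1" if "z \<in> B" for z
      using B\<theta>[OF that] s by (subst winding_number_reversepath) (auto simp: img winding_number_circlepath)
    moreover have "path_image \<gamma> \<inter> (A \<union> B) = {}" if "\<gamma> \<in> set [circlepath 0 2, reversepath (circlepath 0 s)]" for \<gamma>
      using that calculation(1,2) by (auto simp only: img path_image_reversepath set_simps)
    ultimately show ?thesis
      unfolding separating_cycle_def by simp
  qed
  show ?thesis
    unfolding spectral_projection_def A_def[symmetric] B_def[symmetric]
  proof (rule the_equality)
    show "\<exists>\<Gamma>. separating_cycle \<Gamma> A B \<and> Pc = (\<Sum>\<gamma>\<leftarrow>\<Gamma>. riesz_integral K \<gamma>)"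
      using cycle main[OF cycle, symmetric] by blast
    show "Q = Pc" if "\<exists>\<Gamma>. separating_cycle \<Gamma> A B \<and> Q = (\<Sum>\<gamma>\<leftarrow>\<Gamma>. riesz_integral K \<gamma>)" for Q
      using that main by auto
  qed
qed

end

declare One_nat_def [simp del]

section \<open>Structure of the range of the limit projection\<close>

locale normalised_basis = recurrent_projection K Y G P J e + disjoint_positive "{1..r}" x
  for K :: "'a::banach_lattice \<Rightarrow>\<^sub>L 'a" and Y G P J e and r :: nat and x :: "nat \<Rightarrow> 'a" +
  fixes f\<^sub>0 :: "'a \<Rightarrow>\<^sub>L real"
  assumes x_range: "i \<in> {1..r} \<Longrightarrow> P (x i) = x i"
    and x_span: "P v = v \<Longrightarrow> \<exists>c. v = (\<Sum>i=1..r. c i *\<^sub>R x i)"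
    and f0_nonneg: "0 \<le> f\<^sub>0" and f0_K: "f\<^sub>0 o\<^sub>L K = f\<^sub>0" and f0_x: "i \<in> {1..r} \<Longrightarrow> f\<^sub>0 (x i) = 1"
    and K_nonzero: "K \<noteq> 0"
begin

text \<open>The coordinates of \<open>P z\<close>, which are unique by disjointness of the basis.\<close>

definition coord :: "nat \<Rightarrow> 'a \<Rightarrow> real" where
  "coord i z = (SOME c. P z = (\<Sum>i=1..r. c i *\<^sub>R x i)) i"

lemma P_expand: "P z = (\<Sum>i=1..r. coord i z *\<^sub>R x i)"
  unfolding coord_def using x_span[of "P z"] by (intro someI_ex[of "\<lambda>c. P z = (\<Sum>i=1..r. c i *\<^sub>R x i)"]) simp

lemma coord_eqI:
  assumes "P z = (\<Sum>i=1..r. c i *\<^sub>R x i)" "i \<in> {1..r}" shows "coord i z = c i"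
  using assms(2) by (rule coeff_unique[rotated]) (metis P_expand assms(1))

lemma coord_nonneg: "0 \<le> z \<Longrightarrow> i \<in> {1..r} \<Longrightarrow> 0 \<le> coord i z"
  using coeff_nonneg[of "\<lambda>i. coord i z" i] blinfun_nonneg_apply[OF P_nonneg, of z] P_expand[of z]
  by simp

definition coord_fun :: "nat \<Rightarrow> 'a \<Rightarrow>\<^sub>L real" where "coord_fun i = Blinfun (coord i)"

lemma coord_fun_apply:
  assumes i: "i \<in> {1..r}" shows "coord_fun i z = coord i z"
proof -
  have "bounded_linear (coord i)"
  proof (rule bounded_linear_intro)
    fix z w :: 'a and c :: real
    show "coord i (z + w) = coord i z + coord i w"
      by (rule coord_eqI[OF _ i]) (simp add: blinfun.add_right P_expand scaleR_left_distrib sum.distrib)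
    show "coord i (c *\<^sub>R z) = c *\<^sub>R coord i z"
      using coord_eqI[OF _ i, of "c *\<^sub>R z" "\<lambda>i. c * coord i z"]
      by (simp add: blinfun.scaleR_right P_expand scaleR_right.sum)
    have "norm (\<bar>coord i z\<bar> *\<^sub>R x i) \<le> norm \<bar>P z\<bar>"
      unfolding P_expand using i x_nonneg[OF i]
      by (intro norm_mono_nonneg abs_coeff_le scaleR_nonneg_nonneg) auto
    then have "\<bar>coord i z\<bar> * norm (x i) \<le> norm P * norm z"
      using norm_blinfun[of P z] by simp
    moreover have "0 < norm (x i)"
      using x_pos[OF i] by auto
    ultimately show "norm (coord i z) \<le> norm z * (norm P / norm (x i))"
      by (simp add: field_simps)
  qed
  then show ?thesis
    by (simp add: coord_fun_def bounded_linear_Blinfun_apply)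
qed

lemma coord_fun_nonneg: "i \<in> {1..r} \<Longrightarrow> 0 \<le> coord_fun i"
  by (simp add: blinfun_nonneg_iff coord_fun_apply coord_nonneg)

lemma coord_fun_x:
  assumes "i \<in> {1..r}" "j \<in> {1..r}" shows "coord_fun i (x j) = (if i = j then 1 else 0)"
proof -
  have "P (x j) = (\<Sum>k=1..r. (if k = j then 1 else 0) *\<^sub>R x k)"
    using x_range[OF assms(2)] assms(2) sum.delta[of "{1..r}" j x] by (simp add: if_distrib[of "\<lambda>c. c *\<^sub>R _"] cong: if_cong)
  from coord_eqI[OF this assms(1)] show ?thesis
    using assms by (simp add: coord_fun_apply)
qed

lemma P_eq_sum: "P = (\<Sum>i=1..r. coord_fun i \<otimes>\<^sub>L x i)"
proof (rule blinfun_eqI)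
  fix z
  show "P z = (\<Sum>i=1..r. coord_fun i \<otimes>\<^sub>L x i) z"
    unfolding P_expand blinfun.sum_left by (intro sum.cong) (simp_all add: coord_fun_apply)
qed

lemma coord_P: "i \<in> {1..r} \<Longrightarrow> coord_fun i (P z) = coord_fun i z"
  by (simp only: coord_fun_apply) (rule coord_eqI, simp_all only: P_idem P_expand[symmetric])

lemma f0_P: "f\<^sub>0 (P z) = f\<^sub>0 z"
  by (rule P_fixed_functional[OF f0_K])

lemma f0_K_apply: "f\<^sub>0 (K z) = f\<^sub>0 z"
  using arg_cong[OF f0_K, of "\<lambda>T. T z"] by simp

lemma f0_sum: "f\<^sub>0 (\<Sum>i=1..r. c i *\<^sub>R x i) = (\<Sum>i=1..r. c i)"
  by (simp add: blinfun.sum_right blinfun.scaleR_right f0_x)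

lemma f0_strictly_positive: "strictly_positive f\<^sub>0"
  unfolding strictly_positive_def
proof (intro conjI allI impI f0_nonneg)
  fix z :: 'a assume z: "0 < z"
  have f0z: "f\<^sub>0 z = (\<Sum>i=1..r. coord i z)"
    by (metis f0_P f0_sum P_expand)
  have nn: "0 \<le> coord i z" if "i \<in> {1..r}" for i
    using z that by (intro coord_nonneg) auto
  show "0 < f\<^sub>0 z"
  proof (rule ccontr)
    assume "\<not> ?thesis"
    moreover have "0 \<le> (\<Sum>i=1..r. coord i z)"
      using nn by (rule sum_nonneg)
    ultimately have "(\<Sum>i=1..r. coord i z) = 0"
      unfolding f0z by linarith
    then have "coord i z = 0" if "i \<in> {1..r}" for i
      using sum_nonneg_eq_0_iff[of "{1..r}" "\<lambda>i. coord i z"] nn that by auto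
    then have "P z = 0" by (simp add: P_expand)
    then show False using P_pos[OF z] by simp
  qed
qed

text \<open>\<open>K\<close> and \<open>J\<close> act on the range of \<open>P\<close> as mutually inverse positive operators. If \<open>x j\<close> occurs in
  the expansion of \<open>K (x i)\<close>, then \<open>J\<close> maps it below a multiple of the atom \<open>x i\<close>, so \<open>x j\<close> is itself
  a multiple of \<open>K (x i)\<close>. The factor is \<open>1\<close> since \<open>f\<^sub>0\<close> is fixed.\<close>

lemma K_x_basis:
  assumes i: "i \<in> {1..r}" shows "\<exists>j\<in>{1..r}. K (x i) = x j"
proof -
  define v where "v = K (x i)"
  have v0: "0 \<le> v"
    unfolding v_def by (intro blinfun_nonneg_apply K_nonneg x_nonneg i)
  have Pv: "P v = v"
    unfolding v_def by (simp add: PK x_range[OF i])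
  have v: "v = (\<Sum>j=1..r. coord j v *\<^sub>R x j)"
    using P_expand[of v] Pv by simp
  have nn: "0 \<le> coord j v" if "j \<in> {1..r}" for j
    using coord_nonneg[OF v0 that] .
  have f0v: "f\<^sub>0 v = 1"
    unfolding v_def by (simp add: f0_K_apply f0_x[OF i])
  have "(\<Sum>j=1..r. coord j v) = f\<^sub>0 v"
    by (subst v) (simp only: f0_sum)
  then have "(\<Sum>j=1..r. coord j v) = 1"
    using f0v by simp
  then obtain j where j: "j \<in> {1..r}" "coord j v \<noteq> 0"
    using sum.neutral[of "{1..r}" "\<lambda>j. coord j v"] by fastforce
  define c where "c = coord j v"
  have c: "0 < c"
    using nn[OF j(1)] j(2) by (simp add: c_def)
  have "c *\<^sub>R x j \<le> v"
    using sum_mono2[of "{1..r}" "{j}" "\<lambda>j. coord j v *\<^sub>R x j"] j nn x_nonneg v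
    by (auto simp: c_def scaleR_nonneg_nonneg)
  define w where "w = J (c *\<^sub>R x j)"
  have w0: "0 \<le> w"
    unfolding w_def using c x_nonneg[OF j(1)]
    by (intro blinfun_nonneg_apply J_nonneg) (simp add: scaleR_nonneg_nonneg)
  have "w \<le> J v"
    unfolding w_def by (rule blinfun_nonneg_mono[OF J_nonneg]) fact
  then have w1: "w \<le> x i"
    by (simp add: v_def JK_apply x_range[OF i])
  have Kw: "K w = c *\<^sub>R x j"
    by (simp add: w_def KJ_apply blinfun.scaleR_right x_range[OF j(1)])
  have "P w = w"
    by (metis JK_apply KJ_apply P_idem blinfun.scaleR_right w_def x_range[OF j(1)])
  then have wsum: "w = (\<Sum>k=1..r. coord k w *\<^sub>R x k)"
    using P_expand[of w] by simp
  have "coord k w = 0" if k: "k \<in> {1..r}" "k \<noteq> i" for k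
  proof -
    have nnw: "0 \<le> coord l w" if "l \<in> {1..r}" for l
      using coord_nonneg[OF w0 that] .
    have "coord k w *\<^sub>R x k \<le> w"
      using sum_mono2[of "{1..r}" "{k}" "\<lambda>l. coord l w *\<^sub>R x l"] k(1) nnw x_nonneg wsum
      by (auto simp: scaleR_nonneg_nonneg)
    then have "coord k w *\<^sub>R x k = inf (coord k w *\<^sub>R x k) (1 *\<^sub>R x i)"
      using w1 by (simp add: inf_absorb1)
    also have "\<dots> = 0"
      using k i nnw[OF k(1)] by (intro disjoint_scaleR x_disj) auto
    finally show ?thesis
      using x_pos[OF k(1)] by auto
  qed
  then have "w = (\<Sum>k=1..r. if k = i then coord i w *\<^sub>R x i else 0)"
    by (subst wsum) (rule sum.cong; simp)
  then have "w = coord i w *\<^sub>R x i"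
    using i by simp
  then have *: "c *\<^sub>R x j = coord i w *\<^sub>R v"
    using Kw by (metis blinfun.scaleR_right v_def)
  from arg_cong[OF this, of "blinfun_apply f\<^sub>0"] have "c = coord i w"
    by (simp add: blinfun.scaleR_right f0_x[OF j(1)] f0v)
  then have "x j = v"
    using * c by simp
  then show ?thesis
    using j(1) unfolding v_def by (intro bexI[of _ j]) simp_all
qed

lemma inj_x: "inj_on x {1..r}"
proof (rule inj_onI, rule ccontr)
  fix i j assume ij: "i \<in> {1..r}" "j \<in> {1..r}" "x i = x j" "i \<noteq> j"
  then have "x i = 0"
    using x_disj[of i j] by simp
  then show False using x_pos[OF ij(1)] by simp
qed

lemma exists_permutation: "\<exists>\<pi>. \<pi> permutes {1..r} \<and> (\<forall>i\<in>{1..r}. K (x i) = x (\<pi> i))"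
proof -
  obtain p where p: "\<And>i. i \<in> {1..r} \<Longrightarrow> p i \<in> {1..r} \<and> K (x i) = x (p i)"
    using K_x_basis by metis
  define \<pi> where "\<pi> i = (if i \<in> {1..r} then p i else i)" for i
  have "inj_on \<pi> {1..r}"
  proof (rule inj_onI)
    fix i j assume ij: "i \<in> {1..r}" "j \<in> {1..r}" "\<pi> i = \<pi> j"
    then have "K (x i) = K (x j)"
      using p by (simp add: \<pi>_def)
    then have "J (K (x i)) = J (K (x j))" by simp
    then have "x i = x j"
      unfolding JK_apply x_range[OF ij(1)] x_range[OF ij(2)] .
    then show "i = j"
      using inj_x ij by (auto dest: inj_onD)
  qed
  moreover have "\<pi> ` {1..r} \<subseteq> {1..r}"
    using p by (auto simp: \<pi>_def)
  ultimately have "bij_betw \<pi> {1..r} {1..r}"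
    by (simp add: bij_betw_def endo_inj_surj)
  then have "\<pi> permutes {1..r}"
    by (rule bij_imp_permutes) (auto simp: \<pi>_def)
  then show ?thesis
    using p by (auto simp: \<pi>_def intro!: exI[of _ \<pi>])
qed

lemma adjoint_permutation:
  assumes \<pi>: "\<pi> permutes {1..r}" "\<And>i. i \<in> {1..r} \<Longrightarrow> K (x i) = x (\<pi> i)" and i: "i \<in> {1..r}"
  shows "banach_adjoint K (coord_fun i) = coord_fun (inv \<pi> i)"
proof (rule blinfun_eqI)
  fix z
  have j: "inv \<pi> i \<in> {1..r}"
    using permutes_in_image[OF permutes_inv[OF \<pi>(1)]] i by blast
  have "coord_fun i (K z) = coord_fun i (K (P z))"
    using coord_P[OF i, of "K z"] by (simp add: PK)
  also have "K (P z) = (\<Sum>k=1..r. coord k z *\<^sub>R x (\<pi> k))"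
    unfolding P_expand blinfun.sum_right by (intro sum.cong) (simp_all add: blinfun.scaleR_right \<pi>(2))
  also have "coord_fun i \<dots> = (\<Sum>k=1..r. coord k z * (if i = \<pi> k then 1 else 0))"
    unfolding blinfun.sum_right blinfun.scaleR_right
    using permutes_in_image[OF \<pi>(1)] i by (intro sum.cong) (auto simp: coord_fun_x)
  also have "\<dots> = (\<Sum>k=1..r. if k = inv \<pi> i then coord (inv \<pi> i) z else 0)"
    using permutes_inverses[OF \<pi>(1)] by (intro sum.cong) auto
  also have "\<dots> = coord (inv \<pi> i) z"
    using j by simp
  finally show "banach_adjoint K (coord_fun i) z = coord_fun (inv \<pi> i) z"
    using j by (simp add: coord_fun_apply)
qed

text \<open>An exponent that turns the permutation of the basis into the identity is a period of \<open>K\<close> on the range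
  of \<open>P\<close>.\<close>

lemma exists_period: "\<exists>m\<ge>1. K ^\<^sub>L m o\<^sub>L P = P"
proof -
  obtain \<pi> where \<pi>: "\<pi> permutes {1..r}" "\<And>i. i \<in> {1..r} \<Longrightarrow> K (x i) = x (\<pi> i)"
    using exists_permutation by blast
  have "permutation \<pi>"
    using \<pi>(1) by (rule permutes_imp_permutation[rotated]) simp
  then obtain m where m: "\<pi> ^^ m = id" "m > 0"
    by (rule permutation_is_nilpotent)
  have pow: "(\<pi> ^^ n) i \<in> {1..r} \<and> (K ^\<^sub>L n) (x i) = x ((\<pi> ^^ n) i)" if "i \<in> {1..r}" for n i
    using that \<pi>(2) permutes_in_image[OF \<pi>(1)] by (induction n) auto
  have "(K ^\<^sub>L m) (P z) = P z" for z
    unfolding P_expand blinfun.sum_right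
    by (intro sum.cong) (simp_all add: blinfun.scaleR_right pow m(1) del: atLeastAtMost_iff)
  then have "K ^\<^sub>L m o\<^sub>L P = P"
    by (intro blinfun_eqI) simp
  then show ?thesis using m(2) by (intro exI[of _ m]) auto
qed

definition x\<^sub>0 :: 'a where "x\<^sub>0 = (\<Sum>i=1..r. x i)"

lemma P_x0: "P x\<^sub>0 = x\<^sub>0"
  by (simp add: x\<^sub>0_def blinfun.sum_right x_range)

lemma x0_nonneg: "0 \<le> x\<^sub>0"
  unfolding x\<^sub>0_def using x_nonneg by (intro sum_nonneg)

lemma K_x0: "K x\<^sub>0 = x\<^sub>0"
proof -
  obtain \<pi> where \<pi>: "\<pi> permutes {1..r}" "\<And>i. i \<in> {1..r} \<Longrightarrow> K (x i) = x (\<pi> i)"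
    using exists_permutation by blast
  have "K x\<^sub>0 = (\<Sum>i=1..r. x (\<pi> i))"
    unfolding x\<^sub>0_def blinfun.sum_right by (intro sum.cong) (simp_all add: \<pi>(2))
  also have "\<dots> = x\<^sub>0"
    using sum.permute[OF \<pi>(1), of x] by (simp add: x\<^sub>0_def o_def)
  finally show ?thesis .
qed

text \<open>Vectors of \<open>Y\<close> are in the range of \<open>P\<close>, hence positive combinations of the basis. Thus \<open>x\<^sub>0\<close>
  alone generates a dense ideal.\<close>

lemma Y_le_x0: assumes "y \<in> Y" shows "\<exists>c\<ge>0. y \<le> c *\<^sub>R x\<^sub>0"
proof -
  have nn: "0 \<le> coord i y" if "i \<in> {1..r}" for i
    using that Y(1)[OF assms] by (intro coord_nonneg)
  let ?c = "\<Sum>i=1..r. coord i y"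
  have "y = (\<Sum>i=1..r. coord i y *\<^sub>R x i)"
    using P_expand[of y] P_fixed_vector[OF Y(2)[OF assms]] by simp
  also have "\<dots> \<le> (\<Sum>i=1..r. ?c *\<^sub>R x i)"
  proof (intro sum_mono scaleR_right_mono x_nonneg)
    fix i assume "i \<in> {1..r}"
    then show "coord i y \<le> ?c"
      using nn by (intro member_le_sum) auto
  qed
  also have "\<dots> = ?c *\<^sub>R x\<^sub>0"
    by (simp add: x\<^sub>0_def scaleR_right.sum)
  finally show ?thesis
    using nn by (intro exI[of _ ?c]) (auto intro: sum_nonneg)
qed

lemma x0_dense: "closure {z. \<exists>y\<in>(\<lambda>c. c *\<^sub>R x\<^sub>0) ` {0..}. \<bar>z\<bar> \<le> y} = UNIV" (is "closure ?I = _")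
proof -
  have "{z. \<exists>y\<in>Y. \<bar>z\<bar> \<le> y} \<subseteq> ?I"
  proof
    fix z assume "z \<in> {z. \<exists>y\<in>Y. \<bar>z\<bar> \<le> y}"
    then obtain y where y: "y \<in> Y" "\<bar>z\<bar> \<le> y" by blast
    obtain c where "0 \<le> c" "y \<le> c *\<^sub>R x\<^sub>0"
      using Y_le_x0[OF y(1)] by blast
    then show "z \<in> ?I"
      using y(2) by (auto intro!: bexI[of _ c] intro: order_trans)
  qed
  then have "closure {z. \<exists>y\<in>Y. \<bar>z\<bar> \<le> y} \<subseteq> closure ?I"
    by (rule closure_mono)
  then show ?thesis
    using Y_dense by auto
qed

lemma nonneg_zero_if_zero_at_x0:
  fixes D :: "'a \<Rightarrow>\<^sub>L 'b::banach_lattice"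
  assumes "0 \<le> D" "D x\<^sub>0 = 0" shows "D = 0"
  by (rule nonneg_blinfun_zero_if_dense[OF assms(1) x0_dense]) (auto simp: blinfun.scaleR_right assms(2))

lemma x0_pos: "0 < x\<^sub>0"
proof -
  have "x\<^sub>0 \<noteq> 0"
  proof
    assume "x\<^sub>0 = 0"
    then have "K = 0"
      using K_nonneg by (intro nonneg_zero_if_zero_at_x0) auto
    then show False using K_nonzero by simp
  qed
  then show ?thesis using x0_nonneg by (simp add: less_le)
qed

lemma x0_quasi_interior: "quasi_interior x\<^sub>0"
proof -
  have "{z. \<exists>y\<in>(\<lambda>c. c *\<^sub>R x\<^sub>0) ` {0..}. \<bar>z\<bar> \<le> y} \<subseteq> lattice_ideal hull {x\<^sub>0}"
  proof (intro hull_minimal subsetI, unfold hull_def, intro InterI)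
    fix z t assume z: "z \<in> {z. \<exists>y\<in>(\<lambda>c. c *\<^sub>R x\<^sub>0) ` {0..}. \<bar>z\<bar> \<le> y}"
      and "t \<in> {t. lattice_ideal t \<and> {x\<^sub>0} \<subseteq> t}"
    then have t: "subspace t" "\<And>u v. v \<in> t \<Longrightarrow> \<bar>u\<bar> \<le> \<bar>v\<bar> \<Longrightarrow> u \<in> t" "x\<^sub>0 \<in> t"
      unfolding lattice_ideal_def by blast+
    obtain c where c: "0 \<le> c" "\<bar>z\<bar> \<le> c *\<^sub>R x\<^sub>0" using z by auto
    have "c *\<^sub>R x\<^sub>0 \<in> t" using t by (intro subspace_scale)
    moreover have "\<bar>z\<bar> \<le> \<bar>c *\<^sub>R x\<^sub>0\<bar>"
      using c x0_nonneg by (simp add: abs_of_nonneg)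
    ultimately show "z \<in> t" by (rule t(2))
  qed
  from closure_mono[OF this] have "UNIV \<subseteq> closure (lattice_ideal hull {x\<^sub>0})"
    by (simp only: x0_dense)
  then show ?thesis
    using x0_pos by (auto simp: quasi_interior_def)
qed

lemma functional_pos_at_x0:
  fixes g :: "'a \<Rightarrow>\<^sub>L real"
  assumes "0 < g" shows "0 < g x\<^sub>0"
proof -
  have g: "0 \<le> g" "g \<noteq> 0"
    using assms by auto
  then have "g x\<^sub>0 \<noteq> 0"
    using nonneg_zero_if_zero_at_x0[of g] by blast
  moreover have "0 \<le> g x\<^sub>0"
    by (rule blinfun_nonneg_apply[OF g(1) x0_nonneg])
  ultimately show ?thesis by simp
qed

text \<open>A lower bound of two coordinate functionals is nonpositive on each order interval
  \<open>[0, x k]\<close>, hence by Riesz decomposition on each \<open>[0, c x\<^sub>0]\<close>, hence by density everywhere.\<close>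

lemma coord_fun_disjoint:
  assumes ij: "i \<in> {1..r}" "j \<in> {1..r}" "i \<noteq> j"
  shows "disjoint_functionals (coord_fun i) (coord_fun j)"
  unfolding disjoint_functionals_def
proof (intro conjI allI impI coord_fun_nonneg ij)
  fix h assume h: "h \<le> coord_fun i \<and> h \<le> coord_fun j"
  have small: "h u \<le> 0" if u: "0 \<le> u" "u \<le> c *\<^sub>R x k" "k \<in> {1..r}" for u c k
  proof -
    have *: "h u \<le> 0" if l: "l \<in> {1..r}" "l \<noteq> k" "h \<le> coord_fun l" for l
    proof -
      have "h u \<le> coord_fun l u"
        using l(3) u(1) by (rule blinfun_le_apply)
      also have "\<dots> \<le> coord_fun l (c *\<^sub>R x k)"
        by (intro blinfun_nonneg_mono coord_fun_nonneg l(1) u(2))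
      also have "\<dots> = 0"
        using l u(3) by (simp add: blinfun.scaleR_right coord_fun_x)
      finally show ?thesis .
    qed
    show ?thesis
      using *[OF ij(1)] *[OF ij(2)] h ij(3) by blast
  qed
  have le: "h z \<le> 0" if z: "0 \<le> z" "z \<le> c *\<^sub>R x\<^sub>0" "0 \<le> c" for z c
  proof -
    have "z \<le> (\<Sum>k=1..r. c *\<^sub>R x k)"
      using z by (simp add: x\<^sub>0_def scaleR_right.sum)
    then obtain u where u: "z = sum u {1..r}" "\<forall>k\<in>{1..r}. 0 \<le> u k \<and> u k \<le> c *\<^sub>R x k"
      using riesz_decomposition[of "{1..r}" "\<lambda>k. c *\<^sub>R x k" z] z x_nonneg
      by (auto simp: scaleR_nonneg_nonneg)
    have "(\<Sum>k=1..r. h (u k)) \<le> 0"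
    proof (rule sum_nonpos)
      show "h (u k) \<le> 0" if "k \<in> {1..r}" for k
        using small[of "u k" c k] u(2) that by blast
    qed
    then show ?thesis
      by (simp add: u(1) blinfun.sum_right)
  qed
  show "h \<le> 0"
    unfolding less_eq_blinfun_def blinfun.zero_left
  proof (intro allI impI)
    fix z :: 'a assume z: "0 \<le> z"
    obtain u where u: "\<And>n. \<exists>y\<in>(\<lambda>c. c *\<^sub>R x\<^sub>0) ` {0..}. \<bar>u n\<bar> \<le> y" "u \<longlonglongrightarrow> z"
      using x0_dense closure_sequential[of z "{z. \<exists>y\<in>(\<lambda>c. c *\<^sub>R x\<^sub>0) ` {0..}. \<bar>z\<bar> \<le> y}"] by auto
    have "(\<lambda>n. inf \<bar>u n\<bar> z) \<longlonglongrightarrow> inf \<bar>z\<bar> z"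
      by (intro tendsto_intros u)
    then have "(\<lambda>n. inf \<bar>u n\<bar> z) \<longlonglongrightarrow> z"
      using z by (simp add: abs_of_nonneg)
    then have "(\<lambda>n. h (inf \<bar>u n\<bar> z)) \<longlonglongrightarrow> h z"
      by (intro blinfun.tendsto tendsto_const)
    moreover have "h (inf \<bar>u n\<bar> z) \<le> 0" for n
    proof -
      obtain c where "0 \<le> c" "\<bar>u n\<bar> \<le> c *\<^sub>R x\<^sub>0"
        using u(1)[of n] by auto
      then show ?thesis
        using z by (intro le[of _ c]) (auto intro: le_infI1)
    qed
    ultimately show "h z \<le> 0"
      by (intro LIMSEQ_le_const2) auto
  qed
qed

lemma rank_P: "r = dim (range (blinfun_apply P))"
proof -
  have "range (blinfun_apply P) \<subseteq> span (x ` {1..r})"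
  proof
    fix v assume "v \<in> range (blinfun_apply P)"
    then obtain z where v: "v = (\<Sum>i=1..r. coord i z *\<^sub>R x i)"
      using P_expand by blast
    show "v \<in> span (x ` {1..r})"
      unfolding v by (rule span_sum, rule span_scale, rule span_base, rule imageI)
  qed
  moreover have "x ` {1..r} \<subseteq> range (blinfun_apply P)"
    using x_range by (metis image_subsetI rangeI)
  moreover have "independent (x ` {1..r})"
  proof (rule independent_if_scalars_zero)
    fix c v assume c: "(\<Sum>v\<in>x ` {1..r}. c v *\<^sub>R v) = 0" and "v \<in> x ` {1..r}"
    then obtain i where i: "i \<in> {1..r}" "v = x i" by blast
    have "(\<Sum>i=1..r. c (x i) *\<^sub>R x i) = (\<Sum>i=1..r. 0 *\<^sub>R x i)"
      using c by (simp add: sum.reindex[OF inj_x])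
    from coeff_unique[OF this i(1)] show "c v = 0"
      using i(2) by simp
  qed simp
  moreover have "card (x ` {1..r}) = r"
    using card_image[OF inj_x] by simp
  ultimately show ?thesis
    by (metis dim_unique)
qed

lemma PK_eq: "P o\<^sub>L K = K o\<^sub>L P"
  by (rule blinfun_eqI) (simp add: PK)

lemma periodic_limit:
  obtains m where "1 \<le> m" "(\<lambda>n. K ^\<^sub>L (n * m)) \<longlonglongrightarrow> P"
    and "spectral_radius K = 1 \<Longrightarrow> spectral_projection K (peripheral_spectrum K) = complexify P"
proof -
  obtain m where pm: "1 \<le> m" "K ^\<^sub>L m o\<^sub>L P = P"
    using exists_period by blast
  obtain M where M: "\<And>n. norm (K ^\<^sub>L n) \<le> M"
    using power_bounded by blast
  obtain C \<theta> where C: "0 \<le> C" "0 < \<theta>" "\<theta> < 1"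
    and decay: "\<And>n. norm (K ^\<^sub>L n o\<^sub>L (id_blinfun - P)) \<le> C * \<theta> ^ n"
    using power_limit_decay[OF M e1 P_lim PP PK_eq] by blast
  interpret periodic_splitting K P m C \<theta>
    by unfold_locales (fact K_compact PP PK_eq pm C decay)+
  have "(K ^\<^sub>L (n * m)) (P z) = P z" for n z
    using arg_cong[OF pm(2), of "\<lambda>T. T z"] by (induction n) (simp_all add: blinfun_power_add)
  then have per: "K ^\<^sub>L (n * m) o\<^sub>L P = P" for n
    by (intro blinfun_eqI) simp
  have "(\<lambda>n. K ^\<^sub>L (n * m) - P) \<longlonglongrightarrow> 0"
  proof (rule Lim_null_comparison)
    have "norm (K ^\<^sub>L (n * m) - P) \<le> C * \<theta> ^ n" for n
    proof -
      have "K ^\<^sub>L (n * m) - P = K ^\<^sub>L (n * m) o\<^sub>L (id_blinfun - P)"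
        using arg_cong[OF per[of n], of "\<lambda>T. T _"]
        by (intro blinfun_eqI) (simp add: blinfun.diff_left blinfun.diff_right)
      then have "norm (K ^\<^sub>L (n * m) - P) \<le> C * \<theta> ^ (n * m)"
        using decay by simp
      also have "\<dots> \<le> C * \<theta> ^ n"
        using C \<theta> pm(1) by (intro mult_left_mono power_decreasing) auto
      finally show ?thesis .
    qed
    then show "\<forall>\<^sub>F n in sequentially. norm (K ^\<^sub>L (n * m) - P) \<le> C * \<theta> ^ n" by simp
    have "(\<lambda>n. C * \<theta> ^ n) \<longlonglongrightarrow> C * 0"
      using \<theta> by (intro tendsto_intros LIMSEQ_power_zero) auto
    then show "(\<lambda>n. C * \<theta> ^ n) \<longlonglongrightarrow> 0" by simp
  qed
  then show ?thesis
    using that[OF pm(1)] spectral_projection_peripheral by (simp add: LIM_zero_iff)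
qed

section \<open>Operators that commute or semi-commute with \<open>K\<close>\<close>

text \<open>Semi-commutation is equality because the commutator has a sign and \<open>f\<^sub>0\<close> annihilates its value
  at \<open>x\<^sub>0\<close>.\<close>

lemma semi_commute_imp_commute:
  assumes "semi_commute S K" shows "S o\<^sub>L K = K o\<^sub>L S"
proof -
  have zero: "D = 0" if "0 \<le> D" "f\<^sub>0 (D x\<^sub>0) = 0" for D :: "'a \<Rightarrow>\<^sub>L 'a"
  proof (rule nonneg_zero_if_zero_at_x0[OF that(1)])
    have "0 \<le> D x\<^sub>0"
      by (intro blinfun_nonneg_apply that(1) x0_nonneg)
    moreover have "\<not> 0 < D x\<^sub>0"
      using f0_strictly_positive that(2) unfolding strictly_positive_def by force
    ultimately show "D x\<^sub>0 = 0" by (simp add: less_le)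
  qed
  have "(S o\<^sub>L K) - (K o\<^sub>L S) = 0 \<or> (K o\<^sub>L S) - (S o\<^sub>L K) = 0"
    using assms unfolding semi_commute_def
  proof
    assume "0 \<le> (S o\<^sub>L K) - (K o\<^sub>L S)"
    then have "(S o\<^sub>L K) - (K o\<^sub>L S) = 0"
      by (rule zero) (simp add: blinfun.diff_left blinfun.diff_right K_x0 f0_K_apply)
    then show ?thesis ..
  next
    assume "(S o\<^sub>L K) - (K o\<^sub>L S) \<le> 0"
    then have "0 \<le> 0 - ((S o\<^sub>L K) - (K o\<^sub>L S))"
      by (rule blinfun_le_iff_diff[THEN iffD1])
    then have "0 \<le> (K o\<^sub>L S) - (S o\<^sub>L K)"
      by simp
    then have "(K o\<^sub>L S) - (S o\<^sub>L K) = 0"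
      by (rule zero) (simp add: blinfun.diff_left blinfun.diff_right K_x0 f0_K_apply)
    then show ?thesis ..
  qed
  then show ?thesis by auto
qed

text \<open>Adding \<open>P\<close> to \<open>S P\<close> makes the spectral radius at least \<open>1\<close>, so that the Krein-Rutman theorem
  applies even if \<open>S\<close> is nilpotent on the range of \<open>P\<close>.\<close>

lemma commuting_eigenvectors:
  assumes S: "0 \<le> S" and comm: "S o\<^sub>L K = K o\<^sub>L S"
  shows "\<exists>c\<ge>0. \<exists>y>0. \<exists>g>0. S y = c *\<^sub>R y \<and> banach_adjoint S g = c *\<^sub>R g"
proof -
  have SKn: "S ((K ^\<^sub>L n) z) = (K ^\<^sub>L n) (S z)" for n z
  proof (induction n)
    case (Suc n)
    then show ?case
      using arg_cong[OF comm, of "\<lambda>T. T ((K ^\<^sub>L n) z)"] by simp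
  qed simp
  have SP: "S (P z) = P (S z)" for z
  proof -
    have "(\<lambda>j. S ((K ^\<^sub>L e j) z)) \<longlonglongrightarrow> S (P z)"
      by (intro blinfun.tendsto tendsto_const P_lim)
    moreover have "(\<lambda>j. S ((K ^\<^sub>L e j) z)) \<longlonglongrightarrow> P (S z)"
      unfolding SKn by (intro blinfun.tendsto tendsto_const P_lim)
    ultimately show ?thesis by (rule LIMSEQ_unique)
  qed
  define T where "T = (S o\<^sub>L P) + P"
  have T_apply: "T z = S (P z) + P z" for z
    by (simp add: T_def blinfun.add_left)
  have T0: "0 \<le> T"
    unfolding T_def by (intro blinfun_nonneg_add blinfun_nonneg_compose S P_nonneg)
  have cT: "compact_operator T"
    unfolding T_def by (intro compact_operator_add compact_operator_compose_left P_compact)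
  have pow: "x\<^sub>0 \<le> (T ^\<^sub>L n) x\<^sub>0" for n
  proof (induction n)
    case (Suc n)
    have Tn0: "0 \<le> (T ^\<^sub>L n) x\<^sub>0"
      using Suc x0_nonneg by (rule order_trans[rotated])
    have "x\<^sub>0 \<le> P ((T ^\<^sub>L n) x\<^sub>0)"
      using blinfun_nonneg_mono[OF P_nonneg Suc] by (simp add: P_x0)
    also have "\<dots> \<le> S (P ((T ^\<^sub>L n) x\<^sub>0)) + P ((T ^\<^sub>L n) x\<^sub>0)"
      using Tn0 by (simp add: blinfun_nonneg_apply S P_nonneg)
    finally show ?case by (simp add: T_apply)
  qed simp
  have "1 \<le> t" if t: "t \<in> pos_resolvent_set T" for t
  proof (rule ccontr)
    assume "\<not> 1 \<le> t"
    then have t01: "0 < t" "t < 1"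
      using t by (auto simp: pos_resolvent_set_def)
    obtain C where C: "\<And>n. norm (T ^\<^sub>L n) \<le> C * t ^ n"
      using pos_resolvent_growth[OF T0 t] by blast
    have "norm x\<^sub>0 \<le> C * t ^ n * norm x\<^sub>0" for n
      using norm_mono_nonneg[OF x0_nonneg pow[of n]] norm_blinfun[of "T ^\<^sub>L n" x\<^sub>0]
        mult_right_mono[OF C[of n] norm_ge_zero[of x\<^sub>0]] by linarith
    moreover have "(\<lambda>n. C * t ^ n * norm x\<^sub>0) \<longlonglongrightarrow> C * 0 * norm x\<^sub>0"
      using t01 by (intro tendsto_intros LIMSEQ_power_zero) auto
    ultimately have "norm x\<^sub>0 \<le> C * 0 * norm x\<^sub>0"
      by (intro LIMSEQ_le_const) auto
    then show False using x0_pos by simp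
  qed
  moreover have "pos_resolvent_set T \<noteq> {}"
    using pos_resolvent_set_large[OF T0, of "norm T + 1"] by auto
  ultimately have \<rho>1: "1 \<le> pos_radius T"
    by (intro cInf_greatest)
  define \<rho> where "\<rho> = pos_radius T"
  have \<rho>: "1 \<le> \<rho>" using \<rho>1 by (simp add: \<rho>_def)
  obtain y and g :: "'a \<Rightarrow>\<^sub>L real" where y: "0 < y" "T y = \<rho> *\<^sub>R y" and g: "0 < g" "g o\<^sub>L T = \<rho> *\<^sub>R g"
    using krein_rutman[OF T0 cT] \<rho>1 unfolding \<rho>_def by auto
  have "P (T y) = T y"
    by (simp add: T_apply blinfun.add_right flip: SP)
  then have Py: "P y = y"
    using \<rho> by (simp add: y(2) blinfun.scaleR_right)
  have gT: "g (S (P z)) + g (P z) = \<rho> * g z" for z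
    using arg_cong[OF g(2), of "\<lambda>h. h z"] by (simp add: T_apply blinfun.add_right blinfun.scaleR_left)
  have gP: "g (P z) = g z" for z
    using gT[of z] gT[of "P z"] \<rho> by simp
  have "S y = (\<rho> - 1) *\<^sub>R y"
    using y(2) by (simp add: T_apply Py scaleR_left_diff_distrib algebra_simps)
  moreover have "banach_adjoint S g = (\<rho> - 1) *\<^sub>R g"
  proof (rule blinfun_eqI)
    fix z
    have "g (S z) = g (S (P z))"
      by (metis SP gP)
    then show "banach_adjoint S g z = ((\<rho> - 1) *\<^sub>R g) z"
      using gT[of z] by (simp add: gP blinfun.scaleR_left blinfun.diff_left algebra_simps)
  qed
  ultimately show ?thesis
    using \<rho> y(1) g(1) by (intro exI[of _ "\<rho> - 1"] conjI exI[of _ y] exI[of _ g]) auto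
qed

end

section \<open>Norms of orbits\<close>

lemma root_bounded_sequence:
  fixes a :: "nat \<Rightarrow> real"
  assumes l: "0 < l" "\<And>n. l \<le> a n" and u: "\<And>n. a n \<le> u"
  shows "0 < (INF n. a n) \<and> (INF n. a n) \<le> (SUP n. a n) \<and> bdd_above (range a) \<and>
    (\<lambda>n. root n (a n)) \<longlonglongrightarrow> 1"
proof (intro conjI)
  have "l \<le> (INF n. a n)"
    using l(2) by (intro cINF_greatest) auto
  then show "0 < (INF n. a n)" using l(1) by simp
  have below: "bdd_below (range a)" and above: "bdd_above (range a)"
    using l(2) u by (auto intro!: bdd_belowI2 bdd_aboveI2)
  show "bdd_above (range a)" by (fact above)
  show "(INF n. a n) \<le> (SUP n. a n)"
    using cINF_lower[OF below, of 0] cSUP_upper[OF _ above, of 0] by simp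
  have "0 < u" using l u by (meson less_le_trans order_trans)
  show "(\<lambda>n. root n (a n)) \<longlonglongrightarrow> 1"
  proof (rule tendsto_sandwich)
    show "(\<lambda>n. root n l) \<longlonglongrightarrow> 1" "(\<lambda>n. root n u) \<longlonglongrightarrow> 1"
      using LIMSEQ_root_const[OF l(1)] LIMSEQ_root_const[OF \<open>0 < u\<close>] by simp_all
    show "\<forall>\<^sub>F n in sequentially. root n l \<le> root n (a n)"
      using eventually_gt_at_top[of 0] by eventually_elim (use l(2) in \<open>auto intro: real_root_le_mono\<close>)
    show "\<forall>\<^sub>F n in sequentially. root n (a n) \<le> root n u"
      using eventually_gt_at_top[of 0] by eventually_elim (use u in \<open>auto intro: real_root_le_mono\<close>)
  qed
qed

context normalised_basis
begin

text \<open>The powers are bounded, and the fixed functional \<open>f\<^sub>0\<close> is constant along the orbit, which keeps the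
  orbit away from \<open>0\<close>. For orbits in the dual space the fixed vector \<open>x\<^sub>0\<close> has the same effect.\<close>

lemma orbit_bounds:
  assumes z: "0 < z"
  shows "0 < (INF n. norm ((K ^\<^sub>L n) z)) \<and> (INF n. norm ((K ^\<^sub>L n) z)) \<le> (SUP n. norm ((K ^\<^sub>L n) z)) \<and>
    bdd_above (range (\<lambda>n. norm ((K ^\<^sub>L n) z))) \<and> (\<lambda>n. root n (norm ((K ^\<^sub>L n) z))) \<longlonglongrightarrow> 1"
proof -
  obtain M where M: "\<And>n. norm (K ^\<^sub>L n) \<le> M"
    using power_bounded by blast
  have f0z: "0 < f\<^sub>0 z"
    using f0_strictly_positive z by (simp add: strictly_positive_def)
  then have nf0: "0 < norm f\<^sub>0" by auto
  have "f\<^sub>0 z \<le> norm f\<^sub>0 * norm ((K ^\<^sub>L n) z)" for n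
    using norm_blinfun[of f\<^sub>0 "(K ^\<^sub>L n) z"] by (simp add: fixed_functional_power[OF f0_K])
  then have "f\<^sub>0 z / norm f\<^sub>0 \<le> norm ((K ^\<^sub>L n) z)" for n
    using nf0 by (simp add: field_simps)
  moreover have "norm ((K ^\<^sub>L n) z) \<le> M * norm z" for n
    by (intro order_trans[OF norm_blinfun] mult_right_mono M norm_ge_zero)
  ultimately show ?thesis
    using f0z nf0 by (intro root_bounded_sequence[of "f\<^sub>0 z / norm f\<^sub>0"]) auto
qed

lemma adjoint_orbit_bounds:
  fixes g :: "'a \<Rightarrow>\<^sub>L real"
  assumes g: "0 < g"
  shows "0 < (INF n. norm (banach_adjoint (K ^\<^sub>L n) g)) \<and>
    (INF n. norm (banach_adjoint (K ^\<^sub>L n) g)) \<le> (SUP n. norm (banach_adjoint (K ^\<^sub>L n) g)) \<and>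
    bdd_above (range (\<lambda>n. norm (banach_adjoint (K ^\<^sub>L n) g))) \<and>
    (\<lambda>n. root n (norm (banach_adjoint (K ^\<^sub>L n) g))) \<longlonglongrightarrow> 1"
proof -
  obtain M where M: "\<And>n. norm (K ^\<^sub>L n) \<le> M"
    using power_bounded by blast
  have gx: "0 < g x\<^sub>0" by (rule functional_pos_at_x0[OF g])
  have nx: "0 < norm x\<^sub>0" using x0_pos by auto
  have "g x\<^sub>0 \<le> norm (g o\<^sub>L K ^\<^sub>L n) * norm x\<^sub>0" for n
    using norm_blinfun[of "g o\<^sub>L K ^\<^sub>L n" x\<^sub>0] by (simp add: fixed_vector_power[OF K_x0])
  then have "g x\<^sub>0 / norm x\<^sub>0 \<le> norm (banach_adjoint (K ^\<^sub>L n) g)" for n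
    using nx by (simp add: field_simps)
  moreover have "norm (banach_adjoint (K ^\<^sub>L n) g) \<le> norm g * M" for n
    using order_trans[OF norm_blinfun_compose mult_left_mono[OF M norm_ge_zero], of g n] by simp
  ultimately show ?thesis
    using gx nx by (intro root_bounded_sequence[of "g x\<^sub>0 / norm x\<^sub>0"]) auto
qed

end

section \<open>Perron-Frobenius theory for irreducible super-commutants\<close>

theorem theorem3p1:
  fixes K :: "'a::banach_lattice \<Rightarrow>\<^sub>L 'a"
  assumes dim: "\<exists>B::'a set. independent B \<and> card B > 1"
    and K_pos: "0 < K"
    and K_compact: "compact_operator K"
    and irreducible: "ideal_irreducible (super_right_commutant K) \<or>
      ideal_irreducible (super_left_commutant K)"
    and radius: "spectral_radius K = 1"
  shows
    "(\<exists>P. complexify P = spectral_projection K (peripheral_spectrum K) \<and>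
       (\<exists>(r::nat) (x :: nat \<Rightarrow> 'a) (f :: nat \<Rightarrow> 'a \<Rightarrow>\<^sub>L real).
          r = dim (range (blinfun_apply P)) \<and>
          (\<forall>i\<in>{1..r}. 0 \<le> x i \<and> 0 \<le> f i) \<and>
          (\<forall>i\<in>{1..r}. \<forall>j\<in>{1..r}. i \<noteq> j \<longrightarrow> inf \<bar>x i\<bar> \<bar>x j\<bar> = 0 \<and> disjoint_functionals (f i) (f j)) \<and>
          P = (\<Sum>i=1..r. f i \<otimes>\<^sub>L x i) \<and>
          (\<forall>i\<in>{1..r}. \<forall>j\<in>{1..r}. blinfun_apply (f i) (x j) = (if i = j then 1 else 0)) \<and>
          (\<exists>\<pi>. \<pi> permutes {1..r} \<and> (\<forall>i\<in>{1..r}. blinfun_apply K (x i) = x (\<pi> i))) \<and>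
          (\<exists>\<rho>. \<rho> permutes {1..r} \<and>
             (\<forall>i\<in>{1..r}. blinfun_apply (banach_adjoint K) (f i) = f (\<rho> i)))) \<and>
       (\<exists>m\<ge>1. (\<lambda>n. K ^\<^sub>L (n * m)) \<longlonglongrightarrow> P)) \<and>
     (\<exists>(x\<^sub>0::'a) (f\<^sub>0 :: 'a \<Rightarrow>\<^sub>L real).
        quasi_interior x\<^sub>0 \<and> 0 < x\<^sub>0 \<and> strictly_positive f\<^sub>0 \<and> 0 < f\<^sub>0 \<and>
        blinfun_apply K x\<^sub>0 = x\<^sub>0 \<and> blinfun_apply (banach_adjoint K) f\<^sub>0 = f\<^sub>0) \<and>
     (\<forall>x::'a. 0 < x \<longrightarrow>
        0 < (INF n. norm (blinfun_apply (K ^\<^sub>L n) x)) \<and>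
        (INF n. norm (blinfun_apply (K ^\<^sub>L n) x)) \<le> (SUP n. norm (blinfun_apply (K ^\<^sub>L n) x)) \<and>
        bdd_above (range (\<lambda>n. norm (blinfun_apply (K ^\<^sub>L n) x))) \<and>
        (\<lambda>n. root n (norm (blinfun_apply (K ^\<^sub>L n) x))) \<longlonglongrightarrow> 1) \<and>
     (\<forall>f :: 'a \<Rightarrow>\<^sub>L real. 0 < f \<longrightarrow>
        0 < (INF n. norm (blinfun_apply (banach_adjoint (K ^\<^sub>L n)) f)) \<and>
        (INF n. norm (blinfun_apply (banach_adjoint (K ^\<^sub>L n)) f)) \<le>
          (SUP n. norm (blinfun_apply (banach_adjoint (K ^\<^sub>L n)) f)) \<and>
        bdd_above (range (\<lambda>n. norm (blinfun_apply (banach_adjoint (K ^\<^sub>L n)) f))) \<and>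
        (\<lambda>n. root n (norm (blinfun_apply (banach_adjoint (K ^\<^sub>L n)) f))) \<longlonglongrightarrow> 1) \<and>
     (\<forall>S :: 'a \<Rightarrow>\<^sub>L 'a. semi_commute S K \<longrightarrow> S o\<^sub>L K = K o\<^sub>L S) \<and>
     super_right_commutant K = super_left_commutant K \<and>
     super_left_commutant K = {S. 0 \<le> S} \<inter> commutant K \<and>
     (\<forall>S :: 'a \<Rightarrow>\<^sub>L 'a. 0 < S \<and> S o\<^sub>L K = K o\<^sub>L S \<longrightarrow>
        (\<exists>c\<ge>0. \<exists>x>0. \<exists>f>0.
           blinfun_apply S x = c *\<^sub>R x \<and> blinfun_apply (banach_adjoint S) f = c *\<^sub>R f))"
proof -
  have K0: "0 \<le> K" "K \<noteq> 0"
    using K_pos by auto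
  have "pos_radius K = 1"
    using spectral_radius_eq_pos_radius[OF K0 K_compact] radius by simp
  then obtain u and h :: "'a \<Rightarrow>\<^sub>L real" where u: "0 < u" "K u = u" and h: "0 < h" "h o\<^sub>L K = h"
    using krein_rutman[OF K0(1) K_compact] by auto
  obtain C where C: "semi_commuting_cone K C" "ideal_irreducible C"
    using irreducible semi_commuting_cone_super_right[of K] semi_commuting_cone_super_left[of K]
    by blast
  note fixed = irreducible_fixed_vectors[OF C u h]
  define Y where "Y = (\<lambda>T. blinfun_apply T u) ` C"
  define G where "G = (\<lambda>S. h o\<^sub>L S) ` C"
  interpret recurrent_compact_operator K Y G
  proof
    have C0: "0 \<le> T" if "T \<in> C" for T
      using C(1) that by (simp add: semi_commuting_cone_def)
    show "0 \<le> y" "K y = y" if "y \<in> Y" for y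
      using that C0 u(1) fixed(3) by (auto simp: Y_def intro: blinfun_nonneg_apply)
    show "closure {z. \<exists>y\<in>Y. \<bar>z\<bar> \<le> y} = UNIV"
      unfolding Y_def by (rule fixed(1))
    show "0 \<le> g" "g o\<^sub>L K = g" if "g \<in> G" for g
      using that C0 h(1) fixed(4) by (auto simp: G_def intro: blinfun_nonneg_compose)
    show "z = 0" if z: "0 \<le> z" "\<And>g. g \<in> G \<Longrightarrow> blinfun_apply g z = 0" for z
      by (rule fixed(2)[OF z(1)], rule z(2), unfold G_def, rule imageI)
  qed (fact K0 K_compact)+
  obtain M where M: "\<And>n. norm (K ^\<^sub>L n) \<le> M"
    using power_bounded by blast
  obtain P J e where "\<And>j. 1 \<le> e j" "(\<lambda>j. K ^\<^sub>L e j) \<longlonglongrightarrow> P" "(\<lambda>j. K ^\<^sub>L (e j - 1)) \<longlonglongrightarrow> J"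
    "P o\<^sub>L P = P" "K o\<^sub>L J = P" "J o\<^sub>L K = P"
    using power_limit_projection[OF K_compact M] by metis
  then interpret recurrent_projection K Y G P J e
    by unfold_locales
  obtain r :: nat and x and f\<^sub>0 :: "'a \<Rightarrow>\<^sub>L real" where x: "disjoint_positive {1..r} x" "x ` {1..r} \<subseteq> range_P"
    and span: "\<And>v. v \<in> range_P \<Longrightarrow> \<exists>c. v = (\<Sum>i=1..r. c i *\<^sub>R x i)"
    and f0: "0 \<le> f\<^sub>0" "f\<^sub>0 o\<^sub>L K = f\<^sub>0" "\<And>i. i \<in> {1..r} \<Longrightarrow> f\<^sub>0 (x i) = 1"
    using exists_normalised_basis by blast
  interpret disjoint_positive "{1..r}" x by (fact x(1))
  interpret normalised_basis K Y G P J e r x f\<^sub>0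
    by unfold_locales (use x(2) span f0 K0(2) in \<open>auto simp: range_P_def image_subset_iff\<close>)
  obtain m where m: "1 \<le> m" "(\<lambda>n. K ^\<^sub>L (n * m)) \<longlonglongrightarrow> P"
    and proj: "spectral_projection K (peripheral_spectrum K) = complexify P"
    using periodic_limit radius by metis
  obtain \<pi> where \<pi>: "\<pi> permutes {1..r}" "\<And>i. i \<in> {1..r} \<Longrightarrow> K (x i) = x (\<pi> i)"
    using exists_permutation by blast
  have abs_x: "\<bar>x i\<bar> = x i" if "i \<in> {1..r}" for i
    using x_nonneg[OF that] by (rule abs_of_nonneg)
  have super: "S \<in> super_right_commutant K \<longleftrightarrow> S \<in> {S. 0 \<le> S} \<inter> commutant K"
    "S \<in> super_left_commutant K \<longleftrightarrow> S \<in> {S. 0 \<le> S} \<inter> commutant K" for S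
  proof -
    have *: "S o\<^sub>L K = K o\<^sub>L S" if "(K o\<^sub>L S) \<le> (S o\<^sub>L K) \<or> (S o\<^sub>L K) \<le> (K o\<^sub>L S)"
    proof (rule semi_commute_imp_commute)
      have "S \<le> T \<longleftrightarrow> S - T \<le> 0" for S T :: "'a \<Rightarrow>\<^sub>L 'a"
        by (simp add: less_eq_blinfun_def blinfun.diff_left)
      then show "semi_commute S K"
        using that blinfun_le_iff_diff unfolding semi_commute_def by blast
    qed
    show "S \<in> super_right_commutant K \<longleftrightarrow> S \<in> {S. 0 \<le> S} \<inter> commutant K"
      "S \<in> super_left_commutant K \<longleftrightarrow> S \<in> {S. 0 \<le> S} \<inter> commutant K"
      unfolding super_right_commutant_def super_left_commutant_def commutant_def using * by auto
  qed
  show ?thesis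
  proof (intro conjI, goal_cases)
    case 1
    show ?case
    proof (rule exI[of _ P], intro conjI, goal_cases)
      case 1
      show ?case by (rule proj[symmetric])
    next
      case 2
      show ?case
      proof (rule exI[of _ r], rule exI[of _ x], rule exI[of _ coord_fun], intro conjI)
        show "\<forall>i\<in>{1..r}. \<forall>j\<in>{1..r}. i \<noteq> j \<longrightarrow>
            inf \<bar>x i\<bar> \<bar>x j\<bar> = 0 \<and> disjoint_functionals (coord_fun i) (coord_fun j)"
        proof (intro ballI impI conjI)
          fix i j assume ij: "i \<in> {1..r}" "j \<in> {1..r}" "i \<noteq> j"
          show "inf \<bar>x i\<bar> \<bar>x j\<bar> = 0"
            unfolding abs_x[OF ij(1)] abs_x[OF ij(2)] by (rule x_disj[OF ij])
          show "disjoint_functionals (coord_fun i) (coord_fun j)"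
            by (rule coord_fun_disjoint[OF ij])
        qed
        show "\<exists>\<rho>. \<rho> permutes {1..r} \<and>
            (\<forall>i\<in>{1..r}. blinfun_apply (banach_adjoint K) (coord_fun i) = coord_fun (\<rho> i))"
          using permutes_inv[OF \<pi>(1)] adjoint_permutation[OF \<pi>] by blast
      qed (use rank_P x_nonneg coord_fun_nonneg P_eq_sum coord_fun_x \<pi> in blast)+
    next
      case 3
      show ?case using m by blast
    qed
  next
    case 2
    have "0 < f\<^sub>0 x\<^sub>0"
      using f0_strictly_positive x0_pos by (simp add: strictly_positive_def)
    then have "f\<^sub>0 \<noteq> 0" by auto
    then have "0 < f\<^sub>0" using f0(1) by (simp add: less_le)
    moreover have "banach_adjoint K f\<^sub>0 = f\<^sub>0" by (simp add: f0(2))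
    ultimately show ?case
      using x0_quasi_interior x0_pos f0_strictly_positive K_x0 by blast
  next
    case 3
    show ?case by (intro allI impI) (rule orbit_bounds)
  next
    case 4
    show ?case by (intro allI impI) (rule adjoint_orbit_bounds)
  next
    case 5
    show ?case by (intro allI impI) (rule semi_commute_imp_commute)
  next
    case 6
    show ?case by (intro set_eqI) (simp only: super)
  next
    case 7
    show ?case by (intro set_eqI) (simp only: super)
  next
    case 8
    show ?case
      by (intro allI impI, elim conjE, rule commuting_eigenvectors) (simp_all only: less_imp_le)
  qed
qed

end
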